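(* Let $p/q$ be rational in lowest terms with $q>0$. The area-preserving twist map $\Phi_0$ (the untilted case $F=0$) has a rotational invariant circle on the cylinder consisting of $(p,q)$-periodic orbits, or of $(p,q)$-periodic orbits together with orbits corresponding to equilibrium advancing discommensurations, if and only if $F_d(p/q+)=0$. Likewise, $\Phi_0$ has a rotational invariant circle on the cylinder consisting of $(p,q)$-periodic orbits, or of $(p,q)$-periodic orbits together with orbits corresponding to equilibrium retreating discommensurations, if and only if $F_d(p/q-)=0$.
   Context: Setting. $h:\mathbb{R}\times\mathbb{R}\to\mathbb{R}$ is $C^2$, satisfies $h(x+1,x'+1)=h(x,x')$, and has $h_{12}(x,x')\le -c<0$ for some constant $c>0$ (subscripts denote partial derivatives). For a tilt $F\ge 0$ the tilted Frenkel-Kontorova chain is $$\dot x_n=-h_2(x_{n-1},x_n)-h_1(x_n,x_{n+1})+F,\qquad n\in\mathbb{Z};$$ equilibria are sequences $\mathbf{x}=(x_n)\in\mathbb{R}^{\mathbb{Z}}$ with $h_2(x_{n-1},x_n)+h_1(x_n,x_{n+1})=F$ for all $n$. Twist map. Equilibria for $F=0$ correspond to orbits $(x_n,p_n)_{n\in\mathbb{Z}}$ of the area-preserving monotone twist map $\Phi_0:(x_n,p_n)\mapsto(x_{n+1},p_{n+1})$ of the cylinder $\mathbb{R}/\mathbb{Z}\times\mathbb{R}$, determined implicitly by $p_n=-h_1(x_n,x_{n+1})$, $p_{n+1}=h_2(x_n,x_{n+1})$. A rotational invariant circle is a homotopically non-trivial invariant circle on the cylinder. A $(p,q)$-periodic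 orbit is one corresponding to an equilibrium of type $(p,q)$. Order and translations. $\mathbf{x}\le\mathbf{y}$ means $x_n\le y_n$ for all $n$; $\mathbf{x}<\mathbf{y}$ means $\mathbf{x}\le\mathbf{y}$, $\mathbf{x}\ne\mathbf{y}$. $(T_{qp}\mathbf{x})_n=x_{n-q}+p$. A configuration is Birkhoff if $\{T_{qp}\mathbf{x}:p,q\in\mathbb{Z}\}$ is totally ordered by $\le$; it then has a mean spacing $\omega=\lim_{n\to\pm\infty}(x_n-x_0)/n$. It is of type $(p,q)$ (or $(p,q)$-periodic) if $T_{qp}\mathbf{x}=\mathbf{x}$. Equilibrium discommensurations. Let $\mathbf{x}^-<\mathbf{x}<\mathbf{x}^+$ be Birkhoff equilibria with $\mathbf{x}^\pm$ $(p,q)$-periodic. If $|x_n-x_n^-|\to0$ as $n\to-\infty$ and $|x_n-x_n^+|\to0$ as $n\to+\infty$, $\mathbf{x}$ is an equilibrium advancing discommensuration (type $p/q+$); if $|x_n-x_n^+|\to0$ as $n\to-\infty$ and $|x_n-x_n^-|\to0$ as $n\to+\infty$, it is an equilibrium retreating discommensuration (type $p/q-$). In the theorem these are equilibria for $F=0$. Depinning force. For each $\omega\in\mathbb{R}$ it is known that there is a unique $F_d(\omega)\ge0$ such that for $0\le F\le F_d(\omega)$ there is a Birkhoff equilibrium of mean spacing $\omega$ (of type $(p,q)$ if $\omega=p/q$), and for $F>F_d(\omega)$ there is none. Set $F_d(p/q+)=\lim_{\omega\searrow p/q}F_d(\omega)$ and $F_d(p/q-)=\lim_{\omega\nearrow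 p/q}F_d(\omega)$ (these limits exist). *)

theory Defs
  imports "HOL-Analysis.Analysis"
begin

definition D1 :: "(real \<Rightarrow> real \<Rightarrow> real) \<Rightarrow> real \<Rightarrow> real \<Rightarrow> real" where
  "D1 f x y = deriv (\<lambda>t. f t y) x"

definition D2 :: "(real \<Rightarrow> real \<Rightarrow> real) \<Rightarrow> real \<Rightarrow> real \<Rightarrow> real" where
  "D2 f x y = deriv (\<lambda>t. f x t) y"

definition C1_plane :: "(real \<Rightarrow> real \<Rightarrow> real) \<Rightarrow> bool" where
  "C1_plane f \<longleftrightarrow>
     (\<forall>x y. (\<lambda>t. f t y) field_differentiable (at x) \<and>
            (\<lambda>t. f x t) field_differentiable (at y)) \<and>
     continuous_on UNIV (\<lambda>(x, y). D1 f x y) \<and>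
     continuous_on UNIV (\<lambda>(x, y). D2 f x y)"

definition C2_plane :: "(real \<Rightarrow> real \<Rightarrow> real) \<Rightarrow> bool" where
  "C2_plane f \<longleftrightarrow> C1_plane f \<and> C1_plane (D1 f) \<and> C1_plane (D2 f)"

type_synonym configuration = "int \<Rightarrow> real"

text \<open>The order on configurations is the pointwise order of the function type:
  \<open>x \<le> y\<close> means \<open>x n \<le> y n\<close> for all \<open>n\<close>, and \<open>x < y\<close> means \<open>x \<le> y\<close> and \<open>x \<noteq> y\<close>.\<close>

definition equilibrium :: "(real \<Rightarrow> real \<Rightarrow> real) \<Rightarrow> real \<Rightarrow> configuration \<Rightarrow> bool" where
  "equilibrium h F x \<longleftrightarrow> (\<forall>n. D2 h (x (n - 1)) (x n) + D1 h (x n) (x (n + 1)) = F)"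

definition translate :: "int \<Rightarrow> int \<Rightarrow> configuration \<Rightarrow> configuration" where
  "translate q p x = (\<lambda>n. x (n - q) + of_int p)"

definition birkhoff :: "configuration \<Rightarrow> bool" where
  "birkhoff x \<longleftrightarrow> Complete_Partial_Order.chain (\<le>) {translate q p x |p q. True}"

definition of_type :: "int \<Rightarrow> int \<Rightarrow> configuration \<Rightarrow> bool" where
  "of_type p q x \<longleftrightarrow> translate q p x = x"

definition has_mean_spacing :: "configuration \<Rightarrow> real \<Rightarrow> bool" where
  "has_mean_spacing x \<omega> \<longleftrightarrow>
     ((\<lambda>n. (x n - x 0) / of_int n) \<longlongrightarrow> \<omega>) at_top \<and>
     ((\<lambda>n. (x n - x 0) / of_int n) \<longlongrightarrow> \<omega>) at_bot"

definition admits_birkhoff_equilibrium ::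
    "(real \<Rightarrow> real \<Rightarrow> real) \<Rightarrow> real \<Rightarrow> real \<Rightarrow> bool" where
  "admits_birkhoff_equilibrium h F \<omega> \<longleftrightarrow>
     (\<exists>x. equilibrium h F x \<and> birkhoff x \<and> has_mean_spacing x \<omega> \<and>
          (\<forall>p q. q > 0 \<and> coprime p q \<and> \<omega> = of_int p / of_int q \<longrightarrow> of_type p q x))"

definition depinning_force :: "(real \<Rightarrow> real \<Rightarrow> real) \<Rightarrow> real \<Rightarrow> real" where
  "depinning_force h \<omega> =
     (THE Fd. Fd \<ge> 0 \<and>
        (\<forall>F. 0 \<le> F \<and> F \<le> Fd \<longrightarrow> admits_birkhoff_equilibrium h F \<omega>) \<and>
        (\<forall>F. F > Fd \<longrightarrow> \<not> admits_birkhoff_equilibrium h F \<omega>))"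

definition periodic_equilibria ::
    "(real \<Rightarrow> real \<Rightarrow> real) \<Rightarrow> int \<Rightarrow> int \<Rightarrow> configuration set" where
  "periodic_equilibria h p q = {x. equilibrium h 0 x \<and> of_type p q x}"

definition advancing_discommensurations ::
    "(real \<Rightarrow> real \<Rightarrow> real) \<Rightarrow> int \<Rightarrow> int \<Rightarrow> configuration set" where
  "advancing_discommensurations h p q =
     {x. \<exists>xm xp. xm < x \<and> x < xp \<and>
        (\<forall>y\<in>{xm, x, xp}. equilibrium h 0 y \<and> birkhoff y) \<and>
        of_type p q xm \<and> of_type p q xp \<and>
        ((\<lambda>n. \<bar>x n - xm n\<bar>) \<longlongrightarrow> 0) at_bot \<and>
        ((\<lambda>n. \<bar>x n - xp n\<bar>) \<longlongrightarrow> 0) at_top}"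

definition retreating_discommensurations ::
    "(real \<Rightarrow> real \<Rightarrow> real) \<Rightarrow> int \<Rightarrow> int \<Rightarrow> configuration set" where
  "retreating_discommensurations h p q =
     {x. \<exists>xm xp. xm < x \<and> x < xp \<and>
        (\<forall>y\<in>{xm, x, xp}. equilibrium h 0 y \<and> birkhoff y) \<and>
        of_type p q xm \<and> of_type p q xp \<and>
        ((\<lambda>n. \<bar>x n - xp n\<bar>) \<longlongrightarrow> 0) at_bot \<and>
        ((\<lambda>n. \<bar>x n - xm n\<bar>) \<longlongrightarrow> 0) at_top}"

text \<open>The cylinder is realised as the unit circle of the complex plane times the reals; the
  class of \<open>x\<close> modulo 1 corresponds to \<open>cis (2 * pi * x)\<close>.\<close>

definition cylinder :: "(complex \<times> real) set" where
  "cylinder = sphere 0 1 \<times> UNIV"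

definition cyl_proj :: "real \<Rightarrow> real \<Rightarrow> complex \<times> real" where
  "cyl_proj x p = (cis (2 * pi * x), p)"

text \<open>Under the twist condition \<open>x'\<close> is determined by \<open>x\<close> and \<open>p\<close>, and by the periodicity of
  \<open>h\<close> the image does not depend on the choice of the lift \<open>x\<close>. Hence for every point of the
  cylinder the description below determines exactly one image point.\<close>

definition twist_map :: "(real \<Rightarrow> real \<Rightarrow> real) \<Rightarrow> complex \<times> real \<Rightarrow> complex \<times> real" where
  "twist_map h z =
     (THE z'. \<exists>x p x' p'. z = cyl_proj x p \<and> z' = cyl_proj x' p' \<and>
        p = - D1 h x x' \<and> p' = D2 h x x')"

definition orbit_of :: "(real \<Rightarrow> real \<Rightarrow> real) \<Rightarrow> configuration \<Rightarrow> (complex \<times> real) set" where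
  "orbit_of h x = range (\<lambda>n. cyl_proj (x n) (- D1 h (x n) (x (n + 1))))"

definition rotational_invariant_circle ::
    "(real \<Rightarrow> real \<Rightarrow> real) \<Rightarrow> (complex \<times> real) set \<Rightarrow> bool" where
  "rotational_invariant_circle h C \<longleftrightarrow>
     (\<exists>\<gamma>. simple_path \<gamma> \<and> pathfinish \<gamma> = pathstart \<gamma> \<and> path_image \<gamma> = C \<and>
          C \<subseteq> cylinder \<and> \<not> (\<exists>a. homotopic_loops cylinder \<gamma> (linepath a a))) \<and>
     twist_map h ` C = C"

end

theory Submission
  imports Defs
begin

text \<open>A circle as in the theorem lifts to a continuous family of equilibria \<open>x\<^sub>t\<close> with
  \<open>x\<^sub>t (n + q) \<ge> x\<^sub>t n + p\<close>. A Birkhoff equilibrium of tilt \<open>\<delta> > 0\<close> and mean spacing above \<open>p / q\<close>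
  can only cross the family upwards; if such equilibria existed with spacings tending to \<open>p / q\<close>,
  a limit would be \<open>(p, q)\<close>-periodic and touch a member of the family from above, which the
  maximum principle forbids. No graph property of the circle is needed.

  Conversely, above the depinning force there is no equilibrium to stop the gradient flow, so there
  are totally ordered, translation-invariant continuous families of configurations on which the
  force is at most \<open>F\<close>. Letting \<open>F\<close> tend to \<open>0\<close> and the spacing to \<open>p / q\<close> yields such a family with
  nonpositive force. Since the total action is periodic along the family, the force must vanish, and
  the family projects to an invariant circle. Its members have \<open>x (n + q) \<ge> x n + p\<close>, hence are
  periodic or advancing discommensurations between limits of their translates. Reversing the chain
  gives the statements about retreating discommensurations.\<close>

section \<open>Translations, Birkhoff configurations and mean spacing\<close>

text \<open>Two losses under limits shape the proof. A limit of Birkhoff equilibria whose spacings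
  decrease to \<open>p / q\<close> has spacing \<open>p / q\<close> but need not be periodic;
  periodicity is recovered as a monotone limit of translates by \<open>(q, p)\<close>, which stays
  bounded because a Birkhoff configuration keeps within distance 1 of a line (\<open>width\<close>).
  And the periods of rational approximants are unbounded, so the mean over a period cannot
  parametrise the limiting family; a geometrically weighted mean over growing windows can, with
  Lipschitz constants that depend on the site only. Every comparison rests on one consequence of the
  twist condition: raising the neighbours of a site lowers its force. It makes small Euler steps of
  the gradient flow preserve order and subsolutions on periodic configurations, so maximal chains of
  such steps can play the role of trajectories. The limiting family is merely Lipschitz in its
  parameter, and its action is therefore followed through one-sided increments. In the other
  direction the positive tilt supplies the strictness that turns a contact with an untilted
  equilibrium into a contradiction.\<close>

lemma inverse_Suc_tendsto: "(\<lambda>k. 1 / (real k + 1)) \<longlonglongrightarrow> 0"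
  using LIMSEQ_inverse_real_of_nat by (simp add: inverse_eq_divide add.commute)

lemma translate_translate [simp]:
  "translate a b (translate c d x) = translate (a + c) (b + d) x"
  by (auto simp: translate_def fun_eq_iff algebra_simps)

lemma translate_0 [simp]: "translate 0 0 x = x"
  by (simp add: translate_def)

lemma translate_mono: "x \<le> y \<Longrightarrow> translate a b x \<le> translate a b y"
  by (simp add: translate_def le_fun_def)

lemma translate_le_iff [simp]: "translate a b x \<le> translate a b y \<longleftrightarrow> x \<le> y"
proof
  assume "translate a b x \<le> translate a b y"
  from translate_mono[OF this, of "-a" "-b"] show "x \<le> y" by simp
qed (rule translate_mono)

text \<open>Translations form a group of order isomorphisms, so comparing two translates reduces to
  comparing one translate with \<open>x\<close>.\<close>

lemma birkhoff_iff: "birkhoff x \<longleftrightarrow> (\<forall>a b. translate a b x \<le> x \<or> x \<le> translate a b x)"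
proof
  assume *: "birkhoff x"
  show "\<forall>a b. translate a b x \<le> x \<or> x \<le> translate a b x"
  proof (intro allI)
    fix a b
    have mem: "translate c d x \<in> {translate q p x |p q. True}" for c d by blast
    from chainD[OF *[unfolded birkhoff_def] mem[of a b] mem[of 0 0]]
    show "translate a b x \<le> x \<or> x \<le> translate a b x" by simp
  qed
next
  assume *: "\<forall>a b. translate a b x \<le> x \<or> x \<le> translate a b x"
  have "translate a b x \<le> translate c d x \<or> translate c d x \<le> translate a b x" for a b c d
  proof -
    have "translate (a - c) (b - d) x \<le> x \<or> x \<le> translate (a - c) (b - d) x"
      using * by blast
    then show ?thesis
      using translate_mono[of "translate (a - c) (b - d) x" x c d]
        translate_mono[of x "translate (a - c) (b - d) x" c d] by auto
  qed
  then show "birkhoff x" unfolding birkhoff_def chain_def by blast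
qed

lemma birkhoff_translate:
  assumes "birkhoff x"
  shows "birkhoff (translate a b x)"
proof (rule iffD2[OF birkhoff_iff], intro allI)
  fix c d
  have "translate c d (translate a b x) = translate a b (translate c d x)"
    by (simp add: translate_def algebra_simps)
  moreover have "translate c d x \<le> x \<or> x \<le> translate c d x"
    using iffD1[OF birkhoff_iff assms] by blast
  ultimately show "translate c d (translate a b x) \<le> translate a b x
      \<or> translate a b x \<le> translate c d (translate a b x)"
    by (simp only: translate_le_iff)
qed

text \<open>The strict inequality at one site excludes one of the two possible orders between
  \<open>x\<close> and its translate.\<close>

lemma birkhoff_shift_le:
  assumes "birkhoff x" "x i + of_int b < x (i + m)"
  shows "x n + of_int b \<le> x (n + m)"
proof -
  have "translate m b x \<le> x \<or> x \<le> translate m b x"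
    using iffD1[OF birkhoff_iff assms(1)] by blast
  moreover have "\<not> x \<le> translate m b x"
  proof
    assume "x \<le> translate m b x"
    from le_funD[OF this, of "i + m"] assms(2) show False by (simp add: translate_def)
  qed
  ultimately have "translate m b x \<le> x" by blast
  from le_funD[OF this, of "n + m"] show ?thesis by (simp add: translate_def)
qed

lemma birkhoff_shift_ge:
  assumes "birkhoff x" "x (i + m) < x i + of_int b"
  shows "x (n + m) \<le> x n + of_int b"
proof -
  have "translate m b x \<le> x \<or> x \<le> translate m b x"
    using iffD1[OF birkhoff_iff assms(1)] by blast
  moreover have "\<not> translate m b x \<le> x"
  proof
    assume "translate m b x \<le> x"
    from le_funD[OF this, of "i + m"] assms(2) show False by (simp add: translate_def)
  qed
  ultimately have "x \<le> translate m b x" by blast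
  from le_funD[OF this, of "n + m"] show ?thesis by (simp add: translate_def)
qed

lemma of_type_iff: "of_type p q x \<longleftrightarrow> (\<forall>n. x (n + q) = x n + of_int p)"
proof
  assume *: "of_type p q x"
  show "\<forall>n. x (n + q) = x n + of_int p"
  proof
    fix n
    show "x (n + q) = x n + of_int p"
      using fun_cong[OF *[unfolded of_type_def translate_def], of "n + q"] by simp
  qed
next
  assume *: "\<forall>n. x (n + q) = x n + of_int p"
  show "of_type p q x"
    unfolding of_type_def translate_def
  proof
    fix n
    show "x (n - q) + of_int p = x n" using spec[OF *, of "n - q"] by simp
  qed
qed

lemma of_type_multiple:
  assumes "of_type p q x"
  shows "x (n + k * q) = x n + of_int (k * p)"
proof (induction k rule: int_induct[of _ 0])
  case (step1 k)
  then show ?case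
    using assms[unfolded of_type_iff, rule_format, of "n + k * q"] by (simp add: algebra_simps)
next
  case (step2 k)
  then show ?case
    using assms[unfolded of_type_iff, rule_format, of "n + (k - 1) * q"] by (simp add: algebra_simps)
qed simp

lemma of_type_translate:
  assumes "of_type p q x"
  shows "of_type p q (translate a b x)"
  unfolding of_type_iff
proof
  fix n
  have "x (n - a + q) = x (n - a) + of_int p" using assms by (simp only: of_type_iff)
  then show "translate a b x (n + q) = translate a b x n + of_int p"
    by (simp add: translate_def algebra_simps)
qed

text \<open>Quantitative substitute for mean spacing. Each instance involves two sites only, so the
  condition survives pointwise limits even when the spacing varies along them. For Birkhoff
  configurations it is equivalent to \<open>has_mean_spacing\<close>, by
  \<open>birkhoff_width\<close> and \<open>width_spacing\<close>.\<close>

definition width :: "real \<Rightarrow> configuration \<Rightarrow> bool" where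
  "width \<omega> x \<longleftrightarrow> (\<forall>i m. \<bar>x (i + m) - x i - of_int m * \<omega>\<bar> \<le> 1)"

lemma widthD:
  assumes "width \<omega> x"
  shows "\<bar>x n - x i - of_int (n - i) * \<omega>\<bar> \<le> 1"
proof -
  have "\<bar>x (i + (n - i)) - x i - of_int (n - i) * \<omega>\<bar> \<le> 1"
    using assms unfolding width_def by blast
  then show ?thesis by simp
qed

lemma width_step: assumes "width \<omega> x" shows "\<bar>x (n + 1) - x n\<bar> \<le> \<bar>\<omega>\<bar> + 1"
  using widthD[OF assms, of "n + 1" n] by simp

lemma width_bound: assumes "width \<omega> x" shows "\<bar>x n - x i\<bar> \<le> of_int \<bar>n - i\<bar> * \<bar>\<omega>\<bar> + 1"
proof -
  have "\<bar>of_int (n - i) * \<omega>\<bar> = of_int \<bar>n - i\<bar> * \<bar>\<omega>\<bar>"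
    by (simp add: abs_mult)
  then show ?thesis using widthD[OF assms, of n i] by linarith
qed

lemma width_translate: "width \<omega> x \<Longrightarrow> width \<omega> (translate a b x)"
  unfolding width_def translate_def
proof (intro allI)
  fix i m assume "\<forall>i m. \<bar>x (i + m) - x i - of_int m * \<omega>\<bar> \<le> 1"
  then have "\<bar>x (i - a + m) - x (i - a) - of_int m * \<omega>\<bar> \<le> 1" by blast
  then show "\<bar>x (i + m - a) + of_int b - (x (i - a) + of_int b) - of_int m * \<omega>\<bar> \<le> 1"
    by (simp add: algebra_simps)
qed

lemma filterlim_nat_mult_at_top: "m > 0 \<Longrightarrow> filterlim (\<lambda>k. i + int k * m) at_top sequentially"
proof (subst filterlim_at_top, intro allI)
  fix Z :: int assume "m > 0"
  show "\<forall>\<^sub>F k in sequentially. Z \<le> i + int k * m"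
    using eventually_ge_at_top[of "nat (\<bar>Z\<bar> + \<bar>i\<bar>)"]
  proof eventually_elim
    case (elim k)
    then have "\<bar>Z\<bar> + \<bar>i\<bar> \<le> int k" by linarith
    moreover have "int k * 1 \<le> int k * m" using \<open>m > 0\<close> by (intro mult_left_mono) auto
    ultimately show ?case by linarith
  qed
qed

lemma spacing_along_progression:
  assumes "((\<lambda>n. (x n - x 0) / of_int n) \<longlongrightarrow> \<omega>) at_top" "m > 0"
  shows "(\<lambda>k. (x (i + int k * m) - x i) / real k) \<longlonglongrightarrow> of_int m * \<omega>"
proof -
  let ?n = "\<lambda>k. i + int k * m"
  have 1: "(\<lambda>k. (x (?n k) - x 0) / of_int (?n k)) \<longlonglongrightarrow> \<omega>"
    by (rule filterlim_compose[OF assms(1) filterlim_nat_mult_at_top[OF assms(2)]])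
  have "(\<lambda>k. of_int i * (1 / real k) + of_int m) \<longlonglongrightarrow> of_int i * 0 + of_int m"
    by (intro tendsto_intros lim_1_over_n)
  then have 2: "(\<lambda>k. of_int i * (1 / real k) + of_int m) \<longlonglongrightarrow> of_int m" by simp
  have 3: "(\<lambda>k. (x 0 - x i) * (1 / real k)) \<longlonglongrightarrow> (x 0 - x i) * 0"
    by (intro tendsto_intros lim_1_over_n)
  have "(\<lambda>k. (x (?n k) - x 0) / of_int (?n k) * (of_int i * (1 / real k) + of_int m)
      + (x 0 - x i) * (1 / real k)) \<longlonglongrightarrow> \<omega> * of_int m + (x 0 - x i) * 0"
    by (intro tendsto_add tendsto_mult[OF 1 2] 3)
  then have "(\<lambda>k. (x (?n k) - x 0) / of_int (?n k) * (of_int i * (1 / real k) + of_int m)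
      + (x 0 - x i) * (1 / real k)) \<longlonglongrightarrow> of_int m * \<omega>" by (simp add: mult.commute)
  moreover have "\<forall>\<^sub>F k in sequentially. (x (?n k) - x 0) / of_int (?n k) * (of_int i * (1 / real k)
      + of_int m) + (x 0 - x i) * (1 / real k) = (x (?n k) - x i) / real k"
    using eventually_gt_at_top[of "nat \<bar>i\<bar>"]
  proof eventually_elim
    case (elim k)
    then have k: "real k > 0" by simp
    have "int k * 1 \<le> int k * m" using assms(2) by (intro mult_left_mono) auto
    then have n: "of_int (?n k) \<noteq> (0::real)" using elim by linarith
    have "of_int i * (1 / real k) + of_int m = (of_int (?n k) / real k :: real)"
      using k by (simp add: field_simps)
    then have "(x (?n k) - x 0) / of_int (?n k) * (of_int i * (1 / real k) + of_int m)
       = (x (?n k) - x 0) / real k"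
      using n by simp
    then show ?case by (simp add: diff_divide_distrib)
  qed
  ultimately show ?thesis by (rule Lim_transform_eventually)
qed

text \<open>A strict comparison of \<open>x (i + m)\<close> with \<open>x i + b\<close> propagates
  from one site to all; iterated along a progression of step \<open>m\<close> it bounds
  \<open>m * \<omega>\<close> by \<open>b\<close>. Applied to the integers just below and just above
  the displacement, this locates \<open>m * \<omega>\<close> within 1 of it.\<close>

lemma birkhoff_width:
  assumes "birkhoff x" "((\<lambda>n. (x n - x 0) / of_int n) \<longlongrightarrow> \<omega>) at_top"
  shows "width \<omega> x"
proof -
  have lower: "of_int b \<le> of_int m * \<omega>" if "m > 0" "x i + of_int b < x (i + m)" for i m b
  proof -
    have *: "x i + of_int (int k * b) \<le> x (i + int k * m)" for k
    proof (induction k)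
      case (Suc k)
      then show ?case
        using birkhoff_shift_le[OF assms(1) that(2), of "i + int k * m"]
        by (simp add: algebra_simps)
    qed simp
    have "real k * of_int b \<le> x (i + int k * m) - x i" for k
      using *[of k] by simp
    then have "of_int b \<le> (x (i + int k * m) - x i) / real k" if "k \<ge> 1" for k
      using that by (simp add: field_simps)
    then show ?thesis
      using LIMSEQ_le_const[OF spacing_along_progression[OF assms(2) that(1), of i]] by blast
  qed
  have upper: "of_int m * \<omega> \<le> of_int b" if "m > 0" "x (i + m) < x i + of_int b" for i m b
  proof -
    have *: "x (i + int k * m) \<le> x i + of_int (int k * b)" for k
    proof (induction k)
      case (Suc k)
      then show ?case
        using birkhoff_shift_ge[OF assms(1) that(2), of "i + int k * m"]
        by (simp add: algebra_simps)
    qed simp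
    have "x (i + int k * m) - x i \<le> real k * of_int b" for k
      using *[of k] by simp
    then have "(x (i + int k * m) - x i) / real k \<le> of_int b" if "k \<ge> 1" for k
      using that by (simp add: field_simps)
    then show ?thesis
      using LIMSEQ_le_const2[OF spacing_along_progression[OF assms(2) that(1), of i]] by blast
  qed
  have pos: "\<bar>x (i + m) - x i - of_int m * \<omega>\<bar> \<le> 1" if "m > 0" for i m
  proof -
    let ?d = "x (i + m) - x i"
    have "of_int (\<lceil>?d\<rceil> - 1) \<le> of_int m * \<omega>"
      by (rule lower[OF that, of i]) (use ceiling_correct[of ?d] in linarith)
    moreover have "of_int m * \<omega> \<le> of_int (\<lfloor>?d\<rfloor> + 1)"
      by (rule upper[OF that, of i]) (use floor_correct[of ?d] in linarith)
    ultimately show ?thesis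
      using floor_correct[of ?d] ceiling_correct[of ?d] by simp linarith
  qed
  show ?thesis unfolding width_def
  proof (intro allI)
    fix i m :: int
    consider "m > 0" | "m = 0" | "m < 0" by linarith
    then show "\<bar>x (i + m) - x i - of_int m * \<omega>\<bar> \<le> 1"
    proof cases
      case 3
      then show ?thesis using pos[of "-m" "i + m"] by (simp add: abs_minus_commute)
    qed (use pos in auto)
  qed
qed

lemma bounded_distance_spacing:
  assumes "\<And>n. \<bar>x n - of_int n * \<omega>\<bar> \<le> B"
  shows "has_mean_spacing x \<omega>"
proof -
  have lim: "((\<lambda>n. (x n - x 0) / of_int n) \<longlongrightarrow> \<omega>) F" if F: "F = at_top \<or> F = at_bot" for F
  proof -
    have "\<forall>\<^sub>F n::int in F. Z \<le> \<bar>real_of_int n\<bar>" for Z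
    proof -
      have "\<forall>\<^sub>F n::int in F. n \<ge> \<bar>\<lceil>Z\<rceil>\<bar> \<or> n \<le> - \<bar>\<lceil>Z\<rceil>\<bar>"
        using F
      proof
        assume "F = at_top"
        then show ?thesis by (simp add: eventually_mono[OF eventually_ge_at_top[of "\<bar>\<lceil>Z\<rceil>\<bar>"]])
      next
        assume "F = at_bot"
        then show ?thesis by (simp add: eventually_mono[OF eventually_le_at_bot[of "- \<bar>\<lceil>Z\<rceil>\<bar>"]])
      qed
      then show ?thesis
      proof eventually_elim
        case (elim n)
        then have "\<lceil>Z\<rceil> \<le> \<bar>n\<bar>" by linarith
        then show ?case by (simp add: ceiling_le_iff)
      qed
    qed
    then have "filterlim (\<lambda>n::int. \<bar>real_of_int n\<bar>) at_top F" by (simp add: filterlim_at_top)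
    then have 1: "((\<lambda>n::int. (2 * B) / \<bar>real_of_int n\<bar>) \<longlongrightarrow> 0) F"
      by (intro tendsto_divide_0[OF tendsto_const] filterlim_at_top_imp_at_infinity)
    have nz: "\<forall>\<^sub>F n::int in F. n \<noteq> 0"
      using F
    proof
      assume "F = at_top"
      then show ?thesis by (simp add: eventually_mono[OF eventually_gt_at_top[of "0::int"]])
    next
      assume "F = at_bot"
      then show ?thesis by (simp add: eventually_mono[OF eventually_le_at_bot[of "-1::int"]])
    qed
    have "((\<lambda>n. (x n - x 0) / of_int n - \<omega>) \<longlongrightarrow> 0) F"
    proof (rule Lim_null_comparison[OF _ 1])
      show "\<forall>\<^sub>F n in F. norm ((x n - x 0) / of_int n - \<omega>) \<le> (2 * B) / \<bar>real_of_int n\<bar>"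
        using nz
      proof eventually_elim
        case (elim n)
        have "(x n - x 0) / of_int n - \<omega> = (x n - x 0 - of_int n * \<omega>) / of_int n"
          using elim by (simp add: field_simps)
        moreover have "\<bar>x n - x 0 - of_int n * \<omega>\<bar> \<le> 2 * B"
          using assms[of n] assms[of 0] by simp
        ultimately show ?case by (simp add: divide_right_mono)
      qed
    qed
    then show ?thesis by (simp add: LIM_zero_iff)
  qed
  show ?thesis unfolding has_mean_spacing_def using lim by blast
qed

lemma width_spacing: "width \<omega> x \<Longrightarrow> has_mean_spacing x \<omega>"
proof (rule bounded_distance_spacing[of _ _ "1 + \<bar>x 0\<bar>"])
  fix n assume "width \<omega> x"
  from widthD[OF this, of n 0] show "\<bar>x n - of_int n * \<omega>\<bar> \<le> 1 + \<bar>x 0\<bar>" by simp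
qed

text \<open>Any bound \<open>B\<close> improves to 1: it serves to identify the mean spacing, and
  the Birkhoff property does the rest.\<close>

lemma birkhoff_bounded_width:
  assumes "birkhoff x" "\<And>n. \<bar>x n - of_int n * \<omega>\<bar> \<le> B"
  shows "width \<omega> x"
  using birkhoff_width[OF assms(1)] bounded_distance_spacing[of x \<omega> B] assms(2)
  unfolding has_mean_spacing_def by blast

text \<open>Tychonoff's theorem provides pointwise limits along a finer filter for families over an
  arbitrary index set; this replaces diagonal subsequences.\<close>

lemma pointwise_cluster:
  fixes f :: "'k \<Rightarrow> 'i \<Rightarrow> real"
  assumes F: "F \<noteq> bot" and bd: "\<And>i. \<exists>B. \<forall>\<^sub>F k in F. \<bar>f k i\<bar> \<le> B"
  obtains G l where "G \<le> F" "G \<noteq> bot" "\<And>i. ((\<lambda>k. f k i) \<longlongrightarrow> l i) G"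
proof -
  obtain B where B: "\<And>i. \<forall>\<^sub>F k in F. \<bar>f k i\<bar> \<le> B i" using bd by metis
  \<comment> \<open>Truncation places every member in the compact box \<open>K\<close>; at each
    fixed site it eventually changes nothing.\<close>
  define g where "g = (\<lambda>k i. max (- \<bar>B i\<bar>) (min \<bar>B i\<bar> (f k i)))"
  define K where "K = PiE (UNIV :: 'i set) (\<lambda>i. {- \<bar>B i\<bar> .. \<bar>B i\<bar>})"
  have "compactin (product_topology (\<lambda>i::'i. euclideanreal) UNIV) K"
    unfolding K_def by (subst compactin_PiE) auto
  then have K: "compact K" by (simp add: euclidean_product_topology)
  have "g k \<in> K" for k
    by (auto simp: K_def g_def)
  then have "\<forall>\<^sub>F y in filtermap g F. y \<in> K" by (simp add: eventually_filtermap)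
  moreover have "filtermap g F \<noteq> bot" using F by (simp add: filtermap_bot_iff)
  ultimately obtain l where l: "inf (nhds l) (filtermap g F) \<noteq> bot"
    using K unfolding compact_filter by blast
  \<comment> \<open>Intersecting \<open>F\<close> with the preimages of the neighbourhoods of the
    cluster point \<open>l\<close> gives a proper filter along which \<open>g\<close> converges to
    \<open>l\<close>.\<close>
  define G where "G = inf F (filtercomap g (nhds l))"
  have "G \<noteq> bot"
  proof
    assume "G = bot"
    then have "eventually (\<lambda>_. False) G" by simp
    then obtain P Q where PQ: "eventually P F" "eventually Q (filtercomap g (nhds l))"
      "\<And>k. P k \<Longrightarrow> Q k \<Longrightarrow> False"
      unfolding G_def eventually_inf by auto
    then obtain R where R: "eventually R (nhds l)" "\<And>k. R (g k) \<Longrightarrow> Q k"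
      unfolding eventually_filtercomap by auto
    have "eventually (\<lambda>y. \<not> R y) (filtermap g F)"
      unfolding eventually_filtermap using PQ(1) by (rule eventually_mono) (use PQ(3) R(2) in blast)
    with R(1) have "eventually (\<lambda>_. False) (inf (nhds l) (filtermap g F))"
      unfolding eventually_inf by blast
    with l show False by (simp add: trivial_limit_def)
  qed
  moreover have "G \<le> F" by (simp add: G_def)
  moreover have "((\<lambda>k. f k i) \<longlongrightarrow> l i) G" for i
  proof -
    have "filterlim g (nhds l) G"
      unfolding G_def by (metis filterlim_filtercomap filterlim_mono inf_le2 order_refl)
    then have "((\<lambda>k. g k i) \<longlongrightarrow> l i) G"
      using continuous_on_tendsto_compose[OF continuous_on_product_coordinates[of i], of g l G] by simp
    moreover have "\<forall>\<^sub>F k in G. g k i = f k i"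
      using filter_leD[OF \<open>G \<le> F\<close> B[of i]]
      by eventually_elim (auto simp: g_def)
    ultimately show ?thesis by (rule Lim_transform_eventually)
  qed
  ultimately show ?thesis using that by blast
qed

section \<open>Closure of order, width and periodicity under pointwise limits\<close>

lemma translate_tendsto:
  assumes "\<And>n. ((\<lambda>k. X k n) \<longlongrightarrow> x n) G"
  shows "((\<lambda>k. translate a b (X k) n) \<longlongrightarrow> translate a b x n) G"
  unfolding translate_def by (intro tendsto_intros assms)

text \<open>The direction of the inequality may vary with \<open>k\<close>. Two sites violating the
  two limit inequalities would carry strict opposite inequalities for eventually all
  \<open>k\<close>, which no comparable pair allows.\<close>

lemma comparable_limit:
  assumes "G \<noteq> bot" "\<And>n. ((\<lambda>k. X k n) \<longlongrightarrow> x n) G" "\<And>n. ((\<lambda>k. Y k n) \<longlongrightarrow> y n) G"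
    and "\<forall>\<^sub>F k in G. X k \<le> Y k \<or> Y k \<le> X k"
  shows "x \<le> y \<or> y \<le> (x :: configuration)"
proof (rule ccontr)
  assume "\<not> ?thesis"
  then obtain n m where nm: "y n < x n" "x m < y m" by (auto simp: le_fun_def not_le)
  have 1: "\<forall>\<^sub>F k in G. 0 < X k n - Y k n"
    by (rule order_tendstoD(1)[OF tendsto_diff[OF assms(2,3)]]) (use nm in simp)
  have 2: "\<forall>\<^sub>F k in G. 0 < Y k m - X k m"
    by (rule order_tendstoD(1)[OF tendsto_diff[OF assms(3,2)]]) (use nm in simp)
  have "\<forall>\<^sub>F k in G. False"
    using 1 2 assms(4)
  proof eventually_elim
    case (elim k)
    from elim(3) show False
    proof
      assume "X k \<le> Y k"
      from le_funD[OF this, of n] elim show False by simp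
    next
      assume "Y k \<le> X k"
      from le_funD[OF this, of m] elim show False by simp
    qed
  qed
  with assms(1) show False by simp
qed

lemma birkhoff_limit:
  assumes "G \<noteq> bot" "\<And>n. ((\<lambda>k. X k n) \<longlongrightarrow> x n) G" "\<forall>\<^sub>F k in G. birkhoff (X k)"
  shows "birkhoff x"
  unfolding birkhoff_iff
proof (intro allI)
  fix a b
  show "translate a b x \<le> x \<or> x \<le> translate a b x"
    by (rule comparable_limit[OF assms(1) translate_tendsto[OF assms(2)] assms(2)])
      (rule eventually_mono[OF assms(3)], simp add: birkhoff_iff)
qed

lemma width_limit:
  assumes "G \<noteq> bot" "\<And>n. ((\<lambda>k. X k n) \<longlongrightarrow> x n) G" "\<forall>\<^sub>F k in G. width (\<omega> k) (X k)" "(\<omega> \<longlongrightarrow> \<omega>') G"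
  shows "width \<omega>' x"
  unfolding width_def
proof (intro allI)
  fix i m
  have "((\<lambda>k. \<bar>X k (i + m) - X k i - of_int m * \<omega> k\<bar>) \<longlongrightarrow> \<bar>x (i + m) - x i - of_int m * \<omega>'\<bar>) G"
    by (intro tendsto_intros assms)
  then show "\<bar>x (i + m) - x i - of_int m * \<omega>'\<bar> \<le> 1"
    by (rule tendsto_upperbound[OF _ _ assms(1)])
      (use assms(3) in \<open>auto simp: width_def elim: eventually_mono\<close>)
qed

lemma of_type_limit:
  assumes "G \<noteq> bot" "\<And>n. ((\<lambda>k. X k n) \<longlongrightarrow> x n) G" "\<forall>\<^sub>F k in G. of_type p q (X k)"
  shows "of_type p q x"
  unfolding of_type_iff
proof
  fix n
  have "((\<lambda>k. X k n + of_int p) \<longlongrightarrow> x n + of_int p) G" by (intro tendsto_intros assms)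
  moreover have "\<forall>\<^sub>F k in G. X k n + of_int p = X k (n + q)"
    using assms(3) by eventually_elim (auto simp: of_type_iff)
  ultimately have "((\<lambda>k. X k (n + q)) \<longlongrightarrow> x n + of_int p) G"
    by (rule Lim_transform_eventually)
  then show "x (n + q) = x n + of_int p"
    using tendsto_unique[OF assms(1) assms(2)] by blast
qed

section \<open>Monotone twist generating functions\<close>

text \<open>The partial derivative with respect to \<open>x n\<close> of the formal action, the sum
  of all \<open>h (x n) (x (n + 1))\<close>. The tilted chain moves with velocity
  \<open>F - force h x n\<close>, so configurations with force at most \<open>F\<close> are
  subsolutions.\<close>

definition force :: "(real \<Rightarrow> real \<Rightarrow> real) \<Rightarrow> configuration \<Rightarrow> int \<Rightarrow> real" where
  "force h x n = D2 h (x (n - 1)) (x n) + D1 h (x n) (x (n + 1))"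

lemma equilibrium_iff: "equilibrium h F x \<longleftrightarrow> (\<forall>n. force h x n = F)"
  by (simp add: equilibrium_def force_def)

text \<open>The consequences of smoothness that the proof works with. The twist condition is kept in
  integrated form for both partial derivatives, which makes the locale symmetric under exchanging
  the arguments of \<open>h\<close>.\<close>

locale twist =
  fixes h :: "real \<Rightarrow> real \<Rightarrow> real" and c :: real
  assumes c_pos: "0 < c"
    and D1_deriv: "((\<lambda>t. h t y) has_real_derivative D1 h x y) (at x)"
    and D2_deriv: "((\<lambda>t. h x t) has_real_derivative D2 h x y) (at y)"
    and D1_cont: "continuous_on UNIV (\<lambda>(x, y). D1 h x y)"
    and D2_cont: "continuous_on UNIV (\<lambda>(x, y). D2 h x y)"
    and periodic: "h (x + 1) (y + 1) = h x y"
    and D1_twist: "y \<le> y' \<Longrightarrow> D1 h x y' \<le> D1 h x y - c * (y' - y)"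
    and D2_twist: "x \<le> x' \<Longrightarrow> D2 h x' y \<le> D2 h x y - c * (x' - x)"
begin

lemma periodic_int: "h (x + of_int k) (y + of_int k) = h x y"
proof (induction k rule: int_induct[of _ 0])
  case (step1 k)
  then show ?case using periodic[of "x + of_int k" "y + of_int k"] by (simp add: add.assoc)
next
  case (step2 k)
  then show ?case using periodic[of "x + of_int (k - 1)" "y + of_int (k - 1)"] by simp
qed simp

lemma D1_periodic: "D1 h (x + of_int k) (y + of_int k) = D1 h x y"
proof -
  have "((\<lambda>t. h (t + of_int k) (y + of_int k)) has_real_derivative D1 h (x + of_int k) (y + of_int k)) (at x)"
    using D1_deriv[of "y + of_int k" "x + of_int k"] by (simp only: DERIV_shift)
  then show ?thesis
    unfolding periodic_int using DERIV_unique[OF D1_deriv] by metis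
qed

lemma D2_periodic: "D2 h (x + of_int k) (y + of_int k) = D2 h x y"
proof -
  have "((\<lambda>t. h (x + of_int k) (t + of_int k)) has_real_derivative D2 h (x + of_int k) (y + of_int k)) (at y)"
    using D2_deriv[of "x + of_int k" "y + of_int k"] by (simp only: DERIV_shift)
  then show ?thesis
    unfolding periodic_int using DERIV_unique[OF D2_deriv] by metis
qed

lemma D1_tendsto:
  assumes "(f \<longlongrightarrow> x) G" "(g \<longlongrightarrow> y) G"
  shows "((\<lambda>k. D1 h (f k) (g k)) \<longlongrightarrow> D1 h x y) G"
  using continuous_on_tendsto_compose[OF D1_cont tendsto_Pair[OF assms]] by (simp add: case_prod_beta)

lemma D2_tendsto:
  assumes "(f \<longlongrightarrow> x) G" "(g \<longlongrightarrow> y) G"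
  shows "((\<lambda>k. D2 h (f k) (g k)) \<longlongrightarrow> D2 h x y) G"
  using continuous_on_tendsto_compose[OF D2_cont tendsto_Pair[OF assms]] by (simp add: case_prod_beta)

lemma force_tendsto:
  assumes "\<And>m. ((\<lambda>k. X k m) \<longlongrightarrow> x m) G"
  shows "((\<lambda>k. force h (X k) n) \<longlongrightarrow> force h x n) G"
  unfolding force_def by (intro tendsto_add D1_tendsto D2_tendsto assms)

lemma force_translate: "force h (translate a b x) n = force h x (n - a)"
proof -
  have "n + 1 - a = n - a + 1" "n - 1 - a = n - a - 1" by simp_all
  then show ?thesis unfolding force_def translate_def by (simp only: D1_periodic D2_periodic)
qed

lemma equilibrium_translate: "equilibrium h F x \<Longrightarrow> equilibrium h F (translate a b x)"
  by (simp add: equilibrium_iff force_translate)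

lemma equilibrium_limit:
  assumes "G \<noteq> bot" "\<And>n. ((\<lambda>k. X k n) \<longlongrightarrow> x n) G" "\<forall>\<^sub>F k in G. equilibrium h (F k) (X k)" "(F \<longlongrightarrow> F') G"
  shows "equilibrium h F' x"
  unfolding equilibrium_iff
proof
  fix n
  have "\<forall>\<^sub>F k in G. force h (X k) n = F k"
    using assms(3) by eventually_elim (simp add: equilibrium_iff)
  then have "(F \<longlongrightarrow> force h x n) G"
    by (rule Lim_transform_eventually[OF force_tendsto[OF assms(2)]])
  then show "force h x n = F'" using tendsto_unique[OF assms(1)] assms(4) by blast
qed

section \<open>Comparison principles for the force\<close>

lemma force_mono:
  assumes "x n = y n" "x (n - 1) \<le> y (n - 1)" "x (n + 1) \<le> y (n + 1)"
  shows "force h y n + c * (y (n - 1) - x (n - 1)) + c * (y (n + 1) - x (n + 1)) \<le> force h x n"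
  using D1_twist[OF assms(3), of "y n"] D2_twist[OF assms(2), of "y n"] assms(1)
  unfolding force_def by simp

lemma force_antimono:
  assumes "x n = y n" "x (n - 1) \<le> y (n - 1)" "x (n + 1) \<le> y (n + 1)"
  shows "force h y n \<le> force h x n"
proof -
  have "0 \<le> c * (y (n - 1) - x (n - 1))" "0 \<le> c * (y (n + 1) - x (n + 1))"
    using assms c_pos by (simp_all add: mult_nonneg_nonneg)
  then show ?thesis using force_mono[OF assms] by linarith
qed

text \<open>The terms in \<open>force_mono\<close> that multiply the neighbour gaps by
  \<open>c\<close> have to vanish when the force does not drop from \<open>x\<close> to
  \<open>y\<close>.\<close>

lemma touching_neighbours:
  assumes "x n = y n" "x (n - 1) \<le> y (n - 1)" "x (n + 1) \<le> y (n + 1)" "force h x n \<le> force h y n"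
  shows "x (n - 1) = y (n - 1)" "x (n + 1) = y (n + 1)"
proof -
  have "0 \<le> c * (y (n - 1) - x (n - 1))" "0 \<le> c * (y (n + 1) - x (n + 1))"
    using assms c_pos by (simp_all add: mult_nonneg_nonneg)
  then have "c * (y (n - 1) - x (n - 1)) = 0" "c * (y (n + 1) - x (n + 1)) = 0"
    using force_mono[OF assms(1-3)] assms(4) by linarith+
  then show "x (n - 1) = y (n - 1)" "x (n + 1) = y (n + 1)" using c_pos by auto
qed

text \<open>Strong comparison principle: contact at one site spreads to both neighbours, hence along
  the whole chain.\<close>

lemma touching_equal:
  assumes "x \<le> y" "x n = y n" "\<And>m. force h x m \<le> force h y m"
  shows "x = y"
proof
  fix m
  show "x m = y m"
  proof (induction m rule: int_induct[of _ n])
    case base show ?case by (rule assms(2))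
  next
    case (step1 i)
    show ?case by (rule touching_neighbours(2)[OF step1(2) _ _ assms(3)]) (auto intro: le_funD[OF assms(1)])
  next
    case (step2 i)
    show ?case by (rule touching_neighbours(1)[OF step2(2) _ _ assms(3)]) (auto intro: le_funD[OF assms(1)])
  qed
qed

lemma equilibria_strict:
  assumes "x \<le> y" "x \<noteq> y" "equilibrium h F x" "equilibrium h F y"
  shows "x n < y n"
proof -
  have "x n \<noteq> y n"
    using touching_equal[OF assms(1)] assms(2-4) by (auto simp: equilibrium_iff)
  then show ?thesis using le_funD[OF assms(1), of n] by simp
qed

text \<open>Stability of the subsolution inequality under suprema and upper limits. At the
  neighbours only upper bounds are asked, because raising a neighbour lowers the force; the
  approximating \<open>y\<close> may be chosen anew for each site \<open>n\<close>.\<close>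

lemma force_le_approx:
  assumes "\<And>k::nat. \<exists>y. force h y n \<le> F \<and> \<bar>y n - w n\<bar> \<le> 1 / (real k + 1) \<and>
    y (n - 1) \<le> w (n - 1) + 1 / (real k + 1) \<and> y (n + 1) \<le> w (n + 1) + 1 / (real k + 1)"
  shows "force h w n \<le> F"
proof -
  obtain y where y: "\<And>k::nat. force h (y k) n \<le> F" "\<And>k. \<bar>y k n - w n\<bar> \<le> 1 / (real k + 1)"
    "\<And>k. y k (n - 1) \<le> w (n - 1) + 1 / (real k + 1)" "\<And>k. y k (n + 1) \<le> w (n + 1) + 1 / (real k + 1)"
    using assms by metis
  \<comment> \<open>Keeping \<open>y k\<close> at \<open>n\<close> only and putting all other sites
    slightly above \<open>w\<close> lowers the force at \<open>n\<close> further and gives a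
    sequence converging to \<open>w\<close> at every site.\<close>
  define v where "v = (\<lambda>k m. if m = n then y k n else w m + 1 / (real k + 1))"
  have "(\<lambda>k. y k n - w n) \<longlonglongrightarrow> 0"
    by (rule Lim_null_comparison[OF _ inverse_Suc_tendsto]) (simp add: y(2))
  then have "(\<lambda>k. y k n) \<longlonglongrightarrow> w n" by (simp add: LIM_zero_iff)
  moreover have "(\<lambda>k. w m + 1 / (real k + 1)) \<longlonglongrightarrow> w m" for m
    using tendsto_add[OF tendsto_const inverse_Suc_tendsto, of "w m"] by simp
  ultimately have "(\<lambda>k. v k m) \<longlonglongrightarrow> w m" for m
    unfolding v_def by (cases "m = n") auto
  then have "(\<lambda>k. force h (v k) n) \<longlonglongrightarrow> force h w n" by (rule force_tendsto)
  moreover have "force h (v k) n \<le> F" for k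
    by (rule order_trans[OF force_antimono y(1)[of k]]) (use y(3,4)[of k] in \<open>auto simp: v_def\<close>)
  ultimately show ?thesis by (intro LIMSEQ_le_const2[of _ _ F]) auto
qed

section \<open>First-order expansion and uniform bounds for the generating function\<close>

lemma D1_near:
  assumes "\<kappa> > 0"
  shows "\<exists>\<delta>>0. \<forall>u v. \<bar>u - x\<bar> < \<delta> \<longrightarrow> \<bar>v - y\<bar> < \<delta> \<longrightarrow> \<bar>D1 h u v - D1 h x y\<bar> \<le> \<kappa> \<and> \<bar>D2 h u v - D2 h x y\<bar> \<le> \<kappa>"
proof -
  have "\<forall>\<^sub>F z in nhds (x, y). dist (D1 h (fst z) (snd z)) (D1 h x y) < \<kappa>"
    by (intro tendstoD[OF D1_tendsto _] assms)
      (use tendsto_fst[OF tendsto_ident_at] tendsto_snd in \<open>auto intro!: tendsto_eq_intros filterlim_ident\<close>)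
  moreover have "\<forall>\<^sub>F z in nhds (x, y). dist (D2 h (fst z) (snd z)) (D2 h x y) < \<kappa>"
    by (intro tendstoD[OF D2_tendsto _] assms)
      (use tendsto_fst[OF tendsto_ident_at] tendsto_snd in \<open>auto intro!: tendsto_eq_intros filterlim_ident\<close>)
  ultimately have "\<forall>\<^sub>F z in nhds (x, y). dist (D1 h (fst z) (snd z)) (D1 h x y) < \<kappa>
      \<and> dist (D2 h (fst z) (snd z)) (D2 h x y) < \<kappa>"
    by (rule eventually_conj)
  then obtain d where d: "d > 0" "\<And>z. dist z (x, y) < d \<Longrightarrow> dist (D1 h (fst z) (snd z)) (D1 h x y) < \<kappa>
      \<and> dist (D2 h (fst z) (snd z)) (D2 h x y) < \<kappa>"
    unfolding eventually_nhds_metric by blast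
  have "\<bar>D1 h u v - D1 h x y\<bar> \<le> \<kappa> \<and> \<bar>D2 h u v - D2 h x y\<bar> \<le> \<kappa>" if "\<bar>u - x\<bar> < d / 2" "\<bar>v - y\<bar> < d / 2" for u v
  proof -
    have "dist (u, v) (x, y) \<le> \<bar>u - x\<bar> + \<bar>v - y\<bar>"
      using sqrt_sum_squares_le_sum_abs by (simp add: dist_Pair_Pair dist_real_def)
    then show ?thesis using d(2)[of "(u, v)"] that by (simp add: dist_real_def less_imp_le)
  qed
  then show ?thesis using d(1) by (intro exI[of _ "d / 2"]) auto
qed

text \<open>Continuous partial derivatives give total differentiability: change one argument at a
  time and apply the mean value inequality.\<close>

lemma h_increment:
  assumes "\<kappa> > 0"
  shows "\<exists>\<delta>>0. \<forall>u v. \<bar>u - x\<bar> < \<delta> \<longrightarrow> \<bar>v - y\<bar> < \<delta> \<longrightarrow>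
    \<bar>h u v - h x y - D1 h x y * (u - x) - D2 h x y * (v - y)\<bar> \<le> \<kappa> * (\<bar>u - x\<bar> + \<bar>v - y\<bar>)"
proof -
  obtain \<delta> where \<delta>: "\<delta> > 0" "\<And>u v. \<bar>u - x\<bar> < \<delta> \<Longrightarrow> \<bar>v - y\<bar> < \<delta> \<Longrightarrow> \<bar>D1 h u v - D1 h x y\<bar> \<le> \<kappa>"
    "\<And>u v. \<bar>u - x\<bar> < \<delta> \<Longrightarrow> \<bar>v - y\<bar> < \<delta> \<Longrightarrow> \<bar>D2 h u v - D2 h x y\<bar> \<le> \<kappa>"
    using D1_near[OF assms, of x y] by blast
  have "\<bar>h u v - h x y - D1 h x y * (u - x) - D2 h x y * (v - y)\<bar> \<le> \<kappa> * (\<bar>u - x\<bar> + \<bar>v - y\<bar>)"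
    if uv: "\<bar>u - x\<bar> < \<delta>" "\<bar>v - y\<bar> < \<delta>" for u v
  proof -
    have mem: "t \<in> {x - \<delta><..<x + \<delta>} \<longleftrightarrow> \<bar>t - x\<bar> < \<delta>" "t \<in> {y - \<delta><..<y + \<delta>} \<longleftrightarrow> \<bar>t - y\<bar> < \<delta>" for t
      by auto
    have "norm ((h u v - D1 h x y * u) - (h x v - D1 h x y * x)) \<le> \<kappa> * norm (u - x)"
    proof (rule field_differentiable_bound[of "{x - \<delta><..<x + \<delta>}" "\<lambda>t. h t v - D1 h x y * t" "\<lambda>t. D1 h t v - D1 h x y"])
      show "((\<lambda>t. h t v - D1 h x y * t) has_field_derivative D1 h t v - D1 h x y) (at t within {x - \<delta><..<x + \<delta>})" for t
        by (auto intro!: derivative_eq_intros has_field_derivative_at_within[OF D1_deriv])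
    qed (use \<delta> uv in \<open>auto simp: mem\<close>)
    moreover have "norm ((h x v - D2 h x y * v) - (h x y - D2 h x y * y)) \<le> \<kappa> * norm (v - y)"
    proof (rule field_differentiable_bound[of "{y - \<delta><..<y + \<delta>}" "\<lambda>t. h x t - D2 h x y * t" "\<lambda>t. D2 h x t - D2 h x y"])
      show "((\<lambda>t. h x t - D2 h x y * t) has_field_derivative D2 h x t - D2 h x y) (at t within {y - \<delta><..<y + \<delta>})" for t
        by (auto intro!: derivative_eq_intros has_field_derivative_at_within[OF D2_deriv])
    qed (use \<delta> uv in \<open>auto simp: mem\<close>)
    ultimately show ?thesis by (simp add: algebra_simps)
  qed
  then show ?thesis using \<delta>(1) by blast
qed

text \<open>Adding a common integer to both arguments leaves the derivatives unchanged, so the strip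
  reduces to a compact piece of it.\<close>

lemma strip_bound:
  obtains B where "B > 0" "\<And>x y. \<bar>y - x\<bar> \<le> K \<Longrightarrow> \<bar>D1 h x y\<bar> \<le> B" "\<And>x y. \<bar>y - x\<bar> \<le> K \<Longrightarrow> \<bar>D2 h x y\<bar> \<le> B"
proof -
  define S where "S = {0..1::real} \<times> {- K..K + 1}"
  have "compact S" by (simp add: S_def compact_Times)
  then have "bounded ((\<lambda>(x, y). D1 h x y) ` S)" "bounded ((\<lambda>(x, y). D2 h x y) ` S)"
    using D1_cont D2_cont by (auto intro!: compact_imp_bounded compact_continuous_image intro: continuous_on_subset)
  then obtain B1 B2 where B: "\<And>z. z \<in> S \<Longrightarrow> \<bar>(\<lambda>(x, y). D1 h x y) z\<bar> \<le> B1"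
    "\<And>z. z \<in> S \<Longrightarrow> \<bar>(\<lambda>(x, y). D2 h x y) z\<bar> \<le> B2"
    unfolding bounded_iff by force
  have "\<bar>D1 h x y\<bar> \<le> \<bar>B1\<bar> + \<bar>B2\<bar> + 1 \<and> \<bar>D2 h x y\<bar> \<le> \<bar>B1\<bar> + \<bar>B2\<bar> + 1" if "\<bar>y - x\<bar> \<le> K" for x y
  proof -
    let ?k = "- \<lfloor>x\<rfloor>"
    have x: "of_int \<lfloor>x\<rfloor> \<le> x" "x \<le> of_int \<lfloor>x\<rfloor> + 1" by linarith+
    have "(x + of_int ?k, y + of_int ?k) \<in> S"
      using that x unfolding S_def mem_Times_iff fst_conv snd_conv atLeastAtMost_iff of_int_minus
      by linarith
    from B(1)[OF this] B(2)[OF this] show ?thesis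
      unfolding prod.case D1_periodic D2_periodic by linarith
  qed
  then show ?thesis using that[of "\<bar>B1\<bar> + \<bar>B2\<bar> + 1"] by fastforce
qed

text \<open>Perron's method with the supersolution \<open>x\<close> as barrier: the supremum of all
  subsolutions below \<open>x\<close> is an equilibrium. This supremum depends on \<open>x\<close>
  and \<open>F\<close> alone, so it inherits from \<open>x\<close> the order relations with its
  translates, in particular Birkhoff property and periodicity; \<open>y\<close> guarantees that
  there is a subsolution at all.\<close>

lemma perron:
  assumes "birkhoff x" "\<And>n. force h y n \<le> F" "\<And>n. F \<le> force h x n" "y \<le> x"
  obtains z where "y \<le> z" "z \<le> x" "equilibrium h F z" "birkhoff z"
    "\<And>a b. translate a b x = x \<Longrightarrow> translate a b z = z"
proof -
  define A where "A = {w. (\<forall>n. force h w n \<le> F) \<and> w \<le> x}"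
  define z where "z = (\<lambda>n. SUP w\<in>A. w n)"
  have "y \<in> A" using assms by (simp add: A_def)
  have bdd: "bdd_above ((\<lambda>w. w n) ` A)" for n
    by (rule bdd_aboveI[of _ "x n"]) (auto simp: A_def le_fun_def)
  have upper: "w \<le> z" if "w \<in> A" for w
    unfolding z_def le_fun_def using that bdd by (auto intro: cSUP_upper)
  have least: "z n \<le> v" if "\<And>w. w \<in> A \<Longrightarrow> w n \<le> v" for n v
    unfolding z_def using that \<open>y \<in> A\<close> by (auto intro: cSUP_least)
  have zx: "z \<le> x"
    unfolding le_fun_def by (auto intro!: least simp: A_def le_fun_def)
  have sub: "force h z n \<le> F" for n
  proof (rule force_le_approx)
    fix k :: nat
    obtain w where w: "w \<in> A" "z n - 1 / (real k + 1) < w n"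
      using least[of n "z n - 1 / (real k + 1)"] by (force simp: not_le)
    have "w m \<le> z m" for m using le_funD[OF upper[OF w(1)]] .
    then have "w n \<le> z n" "w (n - 1) \<le> z (n - 1)" "w (n + 1) \<le> z (n + 1)" by blast+
    moreover have "0 < 1 / (real k + 1)" by simp
    ultimately have "\<bar>w n - z n\<bar> \<le> 1 / (real k + 1)"
      "w (n - 1) \<le> z (n - 1) + 1 / (real k + 1)" "w (n + 1) \<le> z (n + 1) + 1 / (real k + 1)"
      using w(2) by linarith+
    then show "\<exists>w. force h w n \<le> F \<and> \<bar>w n - z n\<bar> \<le> 1 / (real k + 1) \<and>
      w (n - 1) \<le> z (n - 1) + 1 / (real k + 1) \<and> w (n + 1) \<le> z (n + 1) + 1 / (real k + 1)"
      using w(1) unfolding A_def by blast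
  qed
  have "force h z n = F" for n
  proof (rule ccontr)
    assume "force h z n \<noteq> F"
    with sub[of n] have less: "force h z n < F" by simp
    \<comment> \<open>Contact with the barrier at \<open>n\<close> would make the force of
      \<open>z\<close> there at least that of \<open>x\<close>, hence at least
      \<open>F\<close>.\<close>
    have "z n \<noteq> x n"
    proof
      assume "z n = x n"
      then have "force h x n \<le> force h z n"
        by (rule force_antimono) (auto intro: le_funD[OF zx])
      with less assms(3)[of n] show False by simp
    qed
    then have zn: "z n < x n" using le_funD[OF zx, of n] by simp
    \<comment> \<open>A bump at the single site \<open>n\<close> lowers the force at the neighbours
      and, if small, keeps it below \<open>F\<close> at \<open>n\<close>. It would be a subsolution
      below \<open>x\<close> exceeding the supremum.\<close>
    define u where "u = (\<lambda>\<theta>. z(n := z n + \<theta>))"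
    have lim: "((\<lambda>\<theta>. u \<theta> m) \<longlongrightarrow> z m) (at_right 0)" for m
      unfolding u_def by (cases "m = n") (auto intro!: tendsto_eq_intros)
    have "\<forall>\<^sub>F \<theta> in at_right 0. force h (u \<theta>) n < F"
      by (rule order_tendstoD(2)[OF force_tendsto less]) (rule lim)
    moreover have "\<forall>\<^sub>F \<theta> in at_right 0. u \<theta> n < x n"
      by (rule order_tendstoD(2)[OF lim zn])
    moreover have "\<forall>\<^sub>F \<theta> in at_right 0. (0::real) < \<theta>" by (simp add: eventually_at_right_less)
    ultimately have "\<forall>\<^sub>F \<theta> in at_right 0. force h (u \<theta>) n < F \<and> u \<theta> n < x n \<and> 0 < \<theta>"
      by eventually_elim blast
    then obtain \<theta> where \<theta>: "force h (u \<theta>) n < F" "u \<theta> n < x n" "0 < \<theta>"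
      using eventually_happens[of _ "at_right (0::real)"] by force
    have "force h (u \<theta>) m \<le> F" for m
    proof (cases "m = n")
      case False
      have "force h (u \<theta>) m \<le> force h z m"
        by (rule force_antimono) (use False \<theta>(3) in \<open>auto simp: u_def\<close>)
      then show ?thesis using sub[of m] by simp
    qed (use \<theta> in simp)
    moreover have "u \<theta> \<le> x"
      unfolding le_fun_def using \<theta>(2) le_funD[OF zx] by (auto simp: u_def)
    ultimately have "u \<theta> \<in> A" by (simp add: A_def)
    from le_funD[OF upper[OF this], of n] \<theta>(3) show False by (simp add: u_def)
  qed
  then have "equilibrium h F z" by (simp add: equilibrium_iff)
  \<comment> \<open>A translation that moves \<open>x\<close> down maps \<open>A\<close> into
    itself, so it moves the supremum of \<open>A\<close> down as well.\<close>
  have le: "translate a b z \<le> z" if "translate a b x \<le> x" for a b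
    unfolding le_fun_def
  proof
    fix n
    have "z (n - a) \<le> z n - of_int b"
    proof (rule least)
      fix w assume "w \<in> A"
      then have "translate a b w \<le> translate a b x" by (simp add: A_def)
      from order_trans[OF this that] have "translate a b w \<in> A"
        using \<open>w \<in> A\<close> by (simp add: A_def force_translate)
      from le_funD[OF upper[OF this], of n] show "w (n - a) \<le> z n - of_int b"
        by (simp add: translate_def)
    qed
    then show "translate a b z n \<le> z n" by (simp add: translate_def)
  qed
  have ge: "z \<le> translate a b z" if "x \<le> translate a b x" for a b
  proof -
    have "translate (- a) (- b) x \<le> x"
      using translate_mono[OF that, of "- a" "- b"] by simp
    from translate_mono[OF le[OF this], of a b] show ?thesis by simp
  qed
  have "birkhoff z"
    unfolding birkhoff_iff using iffD1[OF birkhoff_iff assms(1)] le ge by blast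
  moreover have "translate a b z = z" if "translate a b x = x" for a b
    using le[of a b] ge[of a b] that by (simp add: order_antisym)
  ultimately show ?thesis
    using that[of z] upper[OF \<open>y \<in> A\<close>] zx \<open>equilibrium h F z\<close> by blast
qed

end

text \<open>The bound on \<open>D2 (D1 h)\<close> integrates to \<open>D1_twist\<close>. For
  \<open>D2_twist\<close>, that inequality is integrated once more in the first argument to compare
  increments of \<open>h\<close> in the second, and the difference quotients pass to the
  limit.\<close>

lemma twist_of_C2:
  assumes "C2_plane h" and per: "\<forall>x x'. h (x + 1) (x' + 1) = h x x'"
    and c: "c > 0" "\<forall>x x'. D2 (D1 h) x x' \<le> - c"
  shows "twist h c"
proof -
  have C1: "C1_plane h" "C1_plane (D1 h)" using assms(1) by (simp_all add: C2_plane_def)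
  have d1: "((\<lambda>t. h t y) has_real_derivative D1 h x y) (at x)" for x y
    using C1(1) by (simp add: C1_plane_def D1_def field_differentiable_derivI)
  have d2: "((\<lambda>t. h x t) has_real_derivative D2 h x y) (at y)" for x y
    using C1(1) by (simp add: C1_plane_def D2_def field_differentiable_derivI)
  have d12: "((\<lambda>t. D1 h x t) has_real_derivative D2 (D1 h) x y) (at y)" for x y
    using C1(2) by (simp add: C1_plane_def D2_def[of "D1 h"] field_differentiable_derivI)
  have t1: "D1 h x y' \<le> D1 h x y - c * (y' - y)" if "y \<le> y'" for x y y'
  proof -
    have "D1 h x y' + c * y' \<le> D1 h x y + c * y"
    proof (rule DERIV_nonpos_imp_nonincreasing[OF that])
      fix t
      have "((\<lambda>t. D1 h x t + c * t) has_real_derivative D2 (D1 h) x t + c) (at t)"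
        by (auto intro!: derivative_eq_intros d12)
      then show "\<exists>y. ((\<lambda>t. D1 h x t + c * t) has_real_derivative y) (at t) \<and> y \<le> 0"
        using spec[OF spec[OF c(2)], of x t] by (intro exI[of _ "D2 (D1 h) x t + c"]) simp
    qed
    then show ?thesis by (simp add: algebra_simps)
  qed
  have t2: "D2 h x' y \<le> D2 h x y - c * (x' - x)" if "x \<le> x'" for x x' y
  proof -
    have quot: "(h x' t - h x' y) / (t - y) \<le> (h x t - h x y) / (t - y) - c * (x' - x)" if "t > y" for t
    proof -
      have "(h x' t - h x' y) + c * (t - y) * x' \<le> (h x t - h x y) + c * (t - y) * x"
      proof (rule DERIV_nonpos_imp_nonincreasing[OF \<open>x \<le> x'\<close>])
        fix u
        have "((\<lambda>u. h u t - h u y + c * (t - y) * u) has_real_derivative D1 h u t - D1 h u y + c * (t - y)) (at u)"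
          by (auto intro!: derivative_eq_intros d1)
        moreover have "D1 h u t - D1 h u y + c * (t - y) \<le> 0" using t1[of y t u] that by simp
        ultimately show "\<exists>y'. ((\<lambda>u. h u t - h u y + c * (t - y) * u) has_real_derivative y') (at u) \<and> y' \<le> 0"
          by blast
      qed
      then have "(h x' t - h x' y) \<le> (h x t - h x y) - c * (x' - x) * (t - y)" by (simp add: algebra_simps)
      then have "(h x' t - h x' y) / (t - y) \<le> ((h x t - h x y) - c * (x' - x) * (t - y)) / (t - y)"
        by (rule divide_right_mono) (use that in simp)
      then show ?thesis using that by (simp add: diff_divide_distrib)
    qed
    have lim: "((\<lambda>t. (h z t - h z y) / (t - y)) \<longlongrightarrow> D2 h z y) (at_right y)" for z
      using d2[of z y] unfolding has_field_derivative_iff by (rule tendsto_within_subset) simp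
    show ?thesis
      by (rule tendsto_le[OF _ tendsto_diff[OF lim tendsto_const] lim])
        (use quot in \<open>auto simp: eventually_at_filter intro!: eventually_mono[OF eventually_True]\<close>)
  qed
  show ?thesis
    by unfold_locales (use c(1) d1 d2 C1(1) per t1 t2 in \<open>auto simp: C1_plane_def\<close>)
qed

lemma D1_swap: "D1 (\<lambda>x y. h y x) x y = D2 h y x"
  by (simp add: D1_def D2_def)

lemma D2_swap: "D2 (\<lambda>x y. h y x) x y = D1 h y x"
  by (simp add: D1_def D2_def)

lemma twist_swap:
  assumes "twist h c"
  shows "twist (\<lambda>x y. h y x) c"
proof -
  interpret twist h c by (rule assms)
  have swap: "continuous_on UNIV (\<lambda>z::real \<times> real. (snd z, fst z))"
    by (intro continuous_intros)
  have c1: "continuous_on UNIV (\<lambda>(x, y). D2 h y x)"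
    using continuous_on_compose2[OF D2_cont swap] by (simp add: case_prod_beta)
  have c2: "continuous_on UNIV (\<lambda>(x, y). D1 h y x)"
    using continuous_on_compose2[OF D1_cont swap] by (simp add: case_prod_beta)
  show ?thesis
  proof (rule twist.intro, unfold D1_swap[of h] D2_swap[of h])
    show "((\<lambda>t. h y t) has_real_derivative D2 h y x) (at x)" for x y by (rule D2_deriv)
    show "((\<lambda>t. h t x) has_real_derivative D1 h y x) (at y)" for x y by (rule D1_deriv)
    show "D2 h y' x \<le> D2 h y x - c * (y' - y)" if "y \<le> y'" for x y y' by (rule D2_twist[OF that])
    show "D1 h y x' \<le> D1 h y x - c * (x' - x)" if "x \<le> x'" for x x' y by (rule D1_twist[OF that])
  qed (rule c_pos c1 c2 periodic)+
qed

section \<open>Periodic configurations and periodic equilibria\<close>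

lemma translate_multiple:
  assumes "of_type p q x"
  shows "translate (k * q) (k * p) x = x"
proof
  fix n
  show "translate (k * q) (k * p) x n = x n"
    using of_type_multiple[OF assms, of "n - k * q" k] by (simp add: translate_def)
qed

lemma of_type_residue:
  assumes "of_type p q x"
  shows "x n = x (n mod q) + of_int (n div q * p)"
  using of_type_multiple[OF assms, of "n mod q" "n div q"] by simp

lemma of_type_le:
  assumes "of_type p q x" "of_type p q y" "q > 0" "\<And>n. n \<in> {0..<q} \<Longrightarrow> x n \<le> y n"
  shows "x \<le> y"
  unfolding le_fun_def
proof
  fix n
  show "x n \<le> y n"
    unfolding of_type_residue[OF assms(1), of n] of_type_residue[OF assms(2), of n]
    using assms(3,4) by simp
qed

lemma residue_all:
  assumes "q > 0" "\<And>n. P (n + q) \<longleftrightarrow> P n" "\<And>n. n \<in> {0..<q} \<Longrightarrow> P n"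
  shows "P (n :: int)"
proof -
  have "P (n mod q + k * q) \<longleftrightarrow> P (n mod q)" for k
  proof (induction k rule: int_induct[of _ 0])
    case (step1 i)
    then show ?case using assms(2)[of "n mod q + i * q"] by (simp add: algebra_simps)
  next
    case (step2 i)
    then show ?case using assms(2)[of "n mod q + (i - 1) * q"] by (simp add: algebra_simps)
  qed simp
  from this[of "n div q"] show ?thesis using assms(1,3) by simp
qed

lemma sum_period_shift:
  fixes f :: "int \<Rightarrow> real"
  assumes "q > 0" "\<And>n. f (n + q) = f n + d"
  shows "(\<Sum>n\<in>{0..<q}. f (n + 1)) = (\<Sum>n\<in>{0..<q}. f n) + d"
proof -
  have "(\<Sum>n\<in>{0..<q}. f (n + 1)) = (\<Sum>n\<in>{1..<q + 1}. f n)"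
    by (rule sum.reindex_bij_witness[of _ "\<lambda>n. n - 1" "\<lambda>n. n + 1"]) auto
  also have "{1..<q + 1} = insert q {1..<q}" using assms(1) by auto
  also have "sum f (insert q {1..<q}) = f (0 + q) + sum f {1..<q}" by simp
  also have "\<dots> = sum f (insert 0 {1..<q}) + d" unfolding assms(2) by simp
  also have "insert 0 {1..<q} = {0..<q}" using assms(1) by auto
  finally show ?thesis .
qed

lemma of_type_distance:
  assumes "of_type p q x" "q > 0"
  shows "\<bar>x n - of_int n * (of_int p / of_int q)\<bar> \<le> (\<Sum>r\<in>{0..<q}. \<bar>x r\<bar>) + \<bar>of_int p\<bar>"
proof -
  let ?r = "n mod q"
  have "of_int n = of_int (n div q) * of_int q + (of_int ?r :: real)"
    by (metis div_mult_mod_eq of_int_add of_int_mult)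
  then have "of_int n * (of_int p / of_int q) = of_int (n div q) * of_int p + of_int ?r * of_int p / (of_int q :: real)"
    using assms(2) by (simp add: field_simps)
  then have "x n - of_int n * (of_int p / of_int q) = x ?r - of_int ?r / of_int q * of_int p"
    using of_type_residue[OF assms(1), of n] by simp
  moreover have "\<bar>of_int ?r / of_int q * of_int p\<bar> \<le> 1 * \<bar>of_int p :: real\<bar>"
    unfolding abs_mult using assms(2) by (intro mult_right_mono) (auto simp: less_imp_le)
  moreover have "\<bar>x ?r\<bar> \<le> (\<Sum>r\<in>{0..<q}. \<bar>x r\<bar>)"
    using assms(2) by (intro member_le_sum[of ?r "{0..<q}" "\<lambda>r. \<bar>x r\<bar>"]) auto
  ultimately show ?thesis by linarith
qed

text \<open>For coprime \<open>p\<close>, \<open>q\<close> the translation by \<open>(\<alpha>, \<beta>)\<close> generates the action of all translations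
  on the configurations of type \<open>(p, q)\<close>, and moves such a configuration by \<open>1 / q\<close> on average.\<close>

locale bezout_type =
  fixes p q \<alpha> \<beta> :: int
  assumes q_pos: "0 < q" and bezout: "\<beta> * q - \<alpha> * p = 1"
begin

text \<open>One inequality encodes the Birkhoff property of a periodic configuration: all
  translations act as powers of the generator \<open>(\<alpha>, \<beta>)\<close>, and since the
  generator moves by \<open>1 / q\<close> on average, a comparable one can only move up. The
  condition is closed and translation-invariant, which makes it a good constraint set for
  minimisation.\<close>

definition rising :: "configuration \<Rightarrow> bool" where
  "rising x \<longleftrightarrow> of_type p q x \<and> x \<le> translate \<alpha> \<beta> x"

text \<open>By the Bezout identity \<open>(\<alpha>, \<beta>)\<close> and \<open>(q, p)\<close> form
  a basis of the integer lattice; \<open>j\<close> and \<open>k\<close> are the coordinates of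
  \<open>(a, b)\<close>, and the \<open>(q, p)\<close> component acts trivially.\<close>

lemma translate_generator:
  assumes "of_type p q x"
  shows "translate a b x = translate ((b * q - a * p) * \<alpha>) ((b * q - a * p) * \<beta>) x"
proof -
  let ?j = "b * q - a * p" and ?k = "a * \<beta> - b * \<alpha>"
  have "?j * \<alpha> + ?k * q = a * (\<beta> * q - \<alpha> * p)" "?j * \<beta> + ?k * p = b * (\<beta> * q - \<alpha> * p)"
    by (simp_all add: algebra_simps)
  then have "translate (?j * \<alpha>) (?j * \<beta>) (translate (?k * q) (?k * p) x) = translate a b x"
    using bezout by simp
  then show ?thesis using translate_multiple[OF assms, of ?k] by simp
qed

lemma rising_multiple:
  assumes "rising x" "j \<ge> 0"
  shows "x \<le> translate (j * \<alpha>) (j * \<beta>) x"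
  using assms(2)
proof (induction j rule: int_ge_induct)
  case (step j)
  have "translate \<alpha> \<beta> x \<le> translate \<alpha> \<beta> (translate (j * \<alpha>) (j * \<beta>) x)"
    by (rule translate_mono) (rule step)
  then show ?case
    using assms(1) by (auto simp: rising_def algebra_simps intro: order_trans)
qed simp

lemma rising_birkhoff: "rising x \<Longrightarrow> birkhoff x"
  unfolding birkhoff_iff
proof (intro allI)
  fix a b assume x: "rising x"
  define j where "j = b * q - a * p"
  have T: "translate a b x = translate (j * \<alpha>) (j * \<beta>) x"
    using translate_generator x unfolding rising_def j_def by blast
  show "translate a b x \<le> x \<or> x \<le> translate a b x"
  proof (cases "j \<ge> 0")
    case True
    then show ?thesis using rising_multiple[OF x] T by simp
  next
    case False
    then have "x \<le> translate (- j * \<alpha>) (- j * \<beta>) x" using rising_multiple[OF x, of "- j"] by simp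
    from translate_mono[OF this, of "j * \<alpha>" "j * \<beta>"] show ?thesis using T by simp
  qed
qed

lemma rising_width: "rising x \<Longrightarrow> width (of_int p / of_int q) x"
  by (rule birkhoff_bounded_width[OF rising_birkhoff of_type_distance[OF _ q_pos]]) (simp_all add: rising_def)

lemma rising_translate: "rising x \<Longrightarrow> rising (translate a b x)"
proof -
  assume x: "rising x"
  have "translate a b x \<le> translate a b (translate \<alpha> \<beta> x)"
    by (rule translate_mono) (use x in \<open>simp add: rising_def\<close>)
  then show ?thesis using x by (simp add: rising_def of_type_translate add.commute)
qed

lemma rising_limit:
  assumes "G \<noteq> bot" "\<And>n. ((\<lambda>k. X k n) \<longlongrightarrow> x n) G" "\<forall>\<^sub>F k in G. rising (X k)"
  shows "rising x"
  unfolding rising_def le_fun_def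
proof (intro conjI allI)
  show "of_type p q x"
    by (rule of_type_limit[OF assms(1,2)]) (use assms(3) in \<open>auto simp: rising_def elim: eventually_mono\<close>)
  fix n
  show "x n \<le> translate \<alpha> \<beta> x n"
    by (rule tendsto_le[OF assms(1) translate_tendsto[OF assms(2)] assms(2)])
      (use assms(3) in \<open>auto simp: rising_def le_fun_def elim: eventually_mono\<close>)
qed

lemma rising_linear: "rising (\<lambda>n. of_int n * (of_int p / of_int q))"
proof -
  have q: "real_of_int q > 0" using q_pos by simp
  have b: "real_of_int \<beta> * real_of_int q - real_of_int \<alpha> * real_of_int p = 1"
    using arg_cong[OF bezout, of real_of_int] by simp
  have "real_of_int (n - \<alpha>) * (of_int p / of_int q) + of_int \<beta> = of_int n * (of_int p / of_int q) + 1 / of_int q" for n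
  proof -
    have "1 / of_int q = (real_of_int \<beta> * real_of_int q - real_of_int \<alpha> * real_of_int p) / real_of_int q"
      by (simp only: b)
    also have "\<dots> = real_of_int \<beta> - real_of_int \<alpha> * (of_int p / of_int q)"
      using q by (simp add: field_simps)
    finally have "real_of_int \<beta> = 1 / of_int q + real_of_int \<alpha> * (of_int p / of_int q)" by simp
    then show ?thesis unfolding of_int_diff left_diff_distrib by linarith
  qed
  then show ?thesis
    using q by (simp add: rising_def of_type_iff le_fun_def translate_def field_simps)
qed

end

text \<open>One explicit Euler step, of length \<open>\<theta>\<close>, of the gradient flow with
  tilt \<open>F\<close>.\<close>

definition flow :: "(real \<Rightarrow> real \<Rightarrow> real) \<Rightarrow> real \<Rightarrow> real \<Rightarrow> configuration \<Rightarrow> configuration" where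
  "flow h F \<theta> x = (\<lambda>n. x n + \<theta> * (F - force h x n))"

locale twist_type = twist + bezout_type
begin

lemma force_of_type: "of_type p q x \<Longrightarrow> force h x (n + q) = force h x n"
  using force_translate[of q p x "n + q"] by (simp add: of_type_def)

lemma flow_translate: "translate a b (flow h F \<theta> x) = flow h F \<theta> (translate a b x)"
  by (rule ext) (simp only: flow_def force_translate, simp add: translate_def)

lemma flow_of_type: "of_type p q x \<Longrightarrow> of_type p q (flow h F \<theta> x)"
  unfolding of_type_iff by (simp add: flow_def force_of_type[unfolded of_type_iff])

lemma flow_tendsto: "((\<lambda>\<theta>. flow h F \<theta> x n) \<longlongrightarrow> x n) (at_right 0)"
  unfolding flow_def by (auto intro!: tendsto_eq_intros)

text \<open>Where \<open>x\<close> and its translate touch, comparison of forces gives the right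
  order of velocities; where they differ, the gap survives small steps. Periodicity leaves finitely
  many sites, so one range of step sizes serves them all.\<close>

lemma flow_rising:
  assumes "rising x"
  shows "\<forall>\<^sub>F \<theta> in at_right 0. rising (flow h F \<theta> x)"
proof -
  let ?y = "translate \<alpha> \<beta> x"
  have le: "x n \<le> ?y n" for n using assms by (simp add: rising_def le_fun_def)
  have ty: "of_type p q x" using assms by (simp add: rising_def)
  have "\<forall>\<^sub>F \<theta> in at_right 0. flow h F \<theta> x n \<le> flow h F \<theta> ?y n" for n
  proof (cases "x n = ?y n")
    case True
    then have "force h ?y n \<le> force h x n" by (rule force_antimono) (rule le)+
    then have "0 \<le> \<theta> \<Longrightarrow> flow h F \<theta> x n \<le> flow h F \<theta> ?y n" for \<theta>
      using True by (simp add: flow_def mult_left_mono)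
    then show ?thesis using eventually_at_right_less[of "0::real"] by (auto elim: eventually_mono)
  next
    case False
    then have "0 < ?y n - x n" using le[of n] by simp
    from order_tendstoD(1)[OF tendsto_diff[OF flow_tendsto[of F ?y n] flow_tendsto[of F x n]] this]
    show ?thesis by (rule eventually_mono) simp
  qed
  then have "\<forall>\<^sub>F \<theta> in at_right 0. \<forall>n\<in>{0..<q}. flow h F \<theta> x n \<le> flow h F \<theta> ?y n"
    by (intro eventually_ball_finite) auto
  then show ?thesis
  proof eventually_elim
    case (elim \<theta>)
    have "flow h F \<theta> x \<le> flow h F \<theta> ?y"
      by (rule of_type_le[OF _ _ q_pos]) (use elim flow_of_type[OF ty] flow_of_type[OF of_type_translate[OF ty]] in auto)
    then show ?case by (simp add: rising_def flow_of_type[OF ty] flow_translate)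
  qed
qed

text \<open>A site with force exactly \<open>F\<close> stays put while its neighbours go up or stay,
  so its force cannot increase; at the other sites the strict inequality persists for small
  steps.\<close>

lemma flow_subsolution:
  assumes "of_type p q x" "\<And>n. force h x n \<le> F"
  shows "\<forall>\<^sub>F \<theta> in at_right 0. \<forall>n. force h (flow h F \<theta> x) n \<le> F"
proof -
  have "\<forall>\<^sub>F \<theta> in at_right 0. force h (flow h F \<theta> x) n \<le> F" for n
  proof (cases "force h x n = F")
    case True
    have "force h (flow h F \<theta> x) n \<le> F" if "0 \<le> \<theta>" for \<theta>
    proof -
      have "x m \<le> flow h F \<theta> x m" for m
        using assms(2)[of m] that by (simp add: flow_def)
      moreover have "x n = flow h F \<theta> x n" using True by (simp add: flow_def)
      ultimately have "force h (flow h F \<theta> x) n \<le> force h x n" by (intro force_antimono)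
      then show ?thesis using True by simp
    qed
    then show ?thesis using eventually_at_right_less[of "0::real"] by (auto elim: eventually_mono)
  next
    case False
    then have "force h x n < F" using assms(2)[of n] by simp
    from order_tendstoD(2)[OF force_tendsto[of "\<lambda>\<theta>. flow h F \<theta> x", OF flow_tendsto] this]
    show ?thesis by (rule eventually_mono) simp
  qed
  then have "\<forall>\<^sub>F \<theta> in at_right 0. \<forall>n\<in>{0..<q}. force h (flow h F \<theta> x) n \<le> F"
    by (intro eventually_ball_finite) auto
  then show ?thesis
  proof eventually_elim
    case (elim \<theta>)
    show ?case
    proof (rule allI, rule residue_all[OF q_pos])
      show "force h (flow h F \<theta> x) (n + q) \<le> F \<longleftrightarrow> force h (flow h F \<theta> x) n \<le> F" for n
        by (simp only: force_of_type[OF flow_of_type[OF assms(1)]])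
      show "force h (flow h F \<theta> x) n \<le> F" if "n \<in> {0..<q}" for n using elim that by (rule bspec)
    qed
  qed
qed

end

context twist
begin

lemma h_expansion:
  assumes "(u \<longlongrightarrow> x) G" "(v \<longlongrightarrow> y) G" "\<kappa> > 0"
  shows "\<forall>\<^sub>F k in G. \<bar>h (u k) (v k) - h x y - D1 h x y * (u k - x) - D2 h x y * (v k - y)\<bar>
    \<le> \<kappa> * (\<bar>u k - x\<bar> + \<bar>v k - y\<bar>)"
proof -
  obtain \<delta> where \<delta>: "\<delta> > 0" "\<And>u v. \<bar>u - x\<bar> < \<delta> \<Longrightarrow> \<bar>v - y\<bar> < \<delta> \<Longrightarrow>
    \<bar>h u v - h x y - D1 h x y * (u - x) - D2 h x y * (v - y)\<bar> \<le> \<kappa> * (\<bar>u - x\<bar> + \<bar>v - y\<bar>)"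
    using h_increment[OF assms(3), of x y] by blast
  show ?thesis
    using tendstoD[OF assms(1) \<delta>(1)] tendstoD[OF assms(2) \<delta>(1)]
    by eventually_elim (rule \<delta>(2), simp_all add: dist_real_def)
qed

lemma h_tendsto:
  assumes "(u \<longlongrightarrow> x) G" "(v \<longlongrightarrow> y) G"
  shows "((\<lambda>k. h (u k) (v k)) \<longlongrightarrow> h x y) G"
proof -
  have u: "((\<lambda>k. u k - x) \<longlongrightarrow> 0) G" and v: "((\<lambda>k. v k - y) \<longlongrightarrow> 0) G"
    using assms by (simp_all add: LIM_zero)
  have "((\<lambda>k. h (u k) (v k) - h x y - D1 h x y * (u k - x) - D2 h x y * (v k - y)) \<longlongrightarrow> 0) G"
  proof (rule Lim_null_comparison)
    show "\<forall>\<^sub>F k in G. norm (h (u k) (v k) - h x y - D1 h x y * (u k - x) - D2 h x y * (v k - y))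
        \<le> 1 * (\<bar>u k - x\<bar> + \<bar>v k - y\<bar>)"
      using h_expansion[OF assms, of 1] by simp
    show "((\<lambda>k. 1 * (\<bar>u k - x\<bar> + \<bar>v k - y\<bar>)) \<longlongrightarrow> 0) G"
      using tendsto_add[OF tendsto_rabs[OF u] tendsto_rabs[OF v]] by simp
  qed
  from tendsto_add[OF tendsto_add[OF this tendsto_mult[OF tendsto_const[of "D1 h x y"] u]]
      tendsto_mult[OF tendsto_const[of "D2 h x y"] v]]
  have "((\<lambda>k. h (u k) (v k) - h x y) \<longlongrightarrow> 0) G" by (simp add: algebra_simps)
  then show ?thesis by (simp add: LIM_zero_iff)
qed

lemma width_cluster:
  assumes "F \<noteq> bot" "\<And>k. width (\<omega> k) (x k)" "(\<omega> \<longlongrightarrow> \<omega>') F" "\<And>k. 0 \<le> x k 0 \<and> x k 0 \<le> 1"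
  obtains G z where "G \<le> F" "G \<noteq> bot" "\<And>n. ((\<lambda>k. x k n) \<longlongrightarrow> z n) G"
proof -
  have "\<exists>B. \<forall>\<^sub>F k in F. \<bar>x k n\<bar> \<le> B" for n
  proof -
    have "\<forall>\<^sub>F k in F. \<bar>\<omega> k\<bar> < \<bar>\<omega>'\<bar> + 1"
      by (rule order_tendstoD(2)[OF tendsto_rabs[OF assms(3)]]) simp
    then have "\<forall>\<^sub>F k in F. \<bar>x k n\<bar> \<le> of_int \<bar>n\<bar> * (\<bar>\<omega>'\<bar> + 1) + 2"
    proof eventually_elim
      case (elim k)
      have "\<bar>x k n - x k 0\<bar> \<le> of_int \<bar>n\<bar> * \<bar>\<omega> k\<bar> + 1"
        using width_bound[OF assms(2)[of k], of n 0] by simp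
      also have "\<dots> \<le> of_int \<bar>n\<bar> * (\<bar>\<omega>'\<bar> + 1) + 1"
        using elim by (intro add_mono mult_left_mono) auto
      finally show ?case using assms(4)[of k] by linarith
    qed
    then show ?thesis by blast
  qed
  from pointwise_cluster[OF assms(1), of x, OF this] that show ?thesis by metis
qed

text \<open>The basic compactness result: integer shifts bring site 0 into the unit interval, and
  \<open>width\<close> bounds the remaining sites. The shifts \<open>m\<close> are returned so that
  further translation-invariant properties can be carried to the limit.\<close>

lemma equilibria_cluster:
  assumes "F \<noteq> bot" "\<And>k. equilibrium h (f k) (x k)" "\<And>k. birkhoff (x k)" "\<And>k. width (\<omega> k) (x k)"
    "(f \<longlongrightarrow> f') F" "(\<omega> \<longlongrightarrow> \<omega>') F"
  obtains G z m where "G \<le> F" "G \<noteq> bot" "\<And>n. ((\<lambda>k. translate 0 (m k) (x k) n) \<longlongrightarrow> z n) G"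
    "equilibrium h f' z" "birkhoff z" "width \<omega>' z"
proof -
  define m where "m = (\<lambda>k. - \<lfloor>x k 0\<rfloor>)"
  define y where "y = (\<lambda>k. translate 0 (m k) (x k))"
  have y0: "0 \<le> y k 0 \<and> y k 0 \<le> 1" for k
    unfolding y_def m_def translate_def using floor_correct[of "x k 0"] by simp linarith
  have "width (\<omega> k) (y k)" for k unfolding y_def by (rule width_translate[OF assms(4)])
  then obtain G z where G: "G \<le> F" "G \<noteq> bot" "\<And>n. ((\<lambda>k. y k n) \<longlongrightarrow> z n) G"
    using width_cluster[of F \<omega> y \<omega>', OF assms(1) _ assms(6) y0] by blast
  have "equilibrium h f' z"
    by (rule equilibrium_limit[OF G(2,3) _ tendsto_mono[OF G(1) assms(5)]])
      (simp add: y_def equilibrium_translate assms(2))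
  moreover have "birkhoff z"
    by (rule birkhoff_limit[OF G(2,3)]) (simp add: y_def birkhoff_translate assms(3))
  moreover have "width \<omega>' z"
    by (rule width_limit[OF G(2,3) _ tendsto_mono[OF G(1) assms(6)]])
      (simp add: y_def width_translate assms(4))
  ultimately show ?thesis using that[of G m z] G unfolding y_def by blast
qed

end

section \<open>Periodic equilibria by minimising the action over one period\<close>

context twist_type
begin

definition action :: "configuration \<Rightarrow> real" where
  "action x = (\<Sum>n\<in>{0..<q}. h (x n) (x (n + 1)))"

lemma action_translate: "action (translate 0 m x) = action x"
  by (simp add: action_def translate_def periodic_int)

lemma action_minimiser:
  obtains x where "rising x" "\<And>y. rising y \<Longrightarrow> action x \<le> action y"
proof -
  \<comment> \<open>The bounded, increasing and continuous function \<open>arctan\<close> gives a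
    finite infimum before anything is known about lower bounds for the action, and has the same
    minimisers.\<close>
  let ?A = "(\<lambda>x. arctan (action x)) ` Collect rising"
  have bdd: "bdd_below ?A" by (rule bdd_belowI[of _ "- pi / 2"]) (auto simp: less_imp_le arctan_lbound)
  have ne: "?A \<noteq> {}" using rising_linear by blast
  have "\<exists>x. rising x \<and> 0 \<le> x 0 \<and> x 0 \<le> 1 \<and> arctan (action x) < Inf ?A + 1 / (real k + 1)" for k
  proof -
    obtain x where x: "rising x" "arctan (action x) < Inf ?A + 1 / (real k + 1)"
      using cInf_lessD[OF ne, of "Inf ?A + 1 / (real k + 1)"] by auto
    have "0 \<le> translate 0 (- \<lfloor>x 0\<rfloor>) x 0 \<and> translate 0 (- \<lfloor>x 0\<rfloor>) x 0 \<le> 1"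
      unfolding translate_def using floor_correct[of "x 0"] by simp linarith
    then show ?thesis
      using x rising_translate[OF x(1), of 0 "- \<lfloor>x 0\<rfloor>"] by (metis action_translate)
  qed
  then obtain X where X: "\<And>k::nat. rising (X k)" "\<And>k. 0 \<le> X k 0 \<and> X k 0 \<le> 1"
    "\<And>k. arctan (action (X k)) < Inf ?A + 1 / (real k + 1)" by metis
  obtain G x where G: "G \<le> sequentially" "G \<noteq> bot" "\<And>n. ((\<lambda>k. X k n) \<longlongrightarrow> x n) G"
    using width_cluster[of sequentially "\<lambda>_. of_int p / of_int q" X, OF _ rising_width[OF X(1)] tendsto_const X(2)]
    by auto
  have "rising x" by (rule rising_limit[OF G(2,3)]) (simp add: X(1))
  moreover have "action x \<le> action y" if "rising y" for y
  proof -
    have l1: "((\<lambda>k. arctan (action (X k))) \<longlongrightarrow> arctan (action x)) G"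
      unfolding action_def by (intro tendsto_arctan tendsto_sum h_tendsto G(3))
    have l2: "(\<lambda>k. Inf ?A + 1 / (real k + 1)) \<longlonglongrightarrow> Inf ?A"
      using tendsto_add[OF tendsto_const inverse_Suc_tendsto, of "Inf ?A"] by simp
    have "arctan (action x) \<le> Inf ?A"
      by (rule tendsto_le[OF G(2) tendsto_mono[OF G(1) l2] l1])
        (rule always_eventually, rule allI, rule less_imp_le, rule X(3))
    also have "\<dots> \<le> arctan (action y)" by (rule cInf_lower[OF _ bdd]) (use that in blast)
    finally show ?thesis by (simp add: arctan_le_iff)
  qed
  ultimately show ?thesis by (rule that)
qed

text \<open>Since \<open>flow\<close> stays inside the constraint set for small times, a constrained minimiser of the
  action is a genuine critical point.\<close>

lemma rising_equilibrium:
  obtains x where "rising x" "equilibrium h 0 x"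
proof -
  obtain x where x: "rising x" "\<And>y. rising y \<Longrightarrow> action x \<le> action y" by (rule action_minimiser) blast
  have ty: "of_type p q x" using x(1) by (simp add: rising_def)
  define f where "f = force h x"
  define C where "C = (\<Sum>n\<in>{0..<q}. \<bar>f n\<bar> + \<bar>f (n + 1)\<bar>)"
  define g where "g = (\<lambda>n. D2 h (x (n - 1)) (x n) * f n)"
  have "f (n + q) = f n" for n unfolding f_def by (rule force_of_type[OF ty])
  moreover have "D2 h (x (n + q - 1)) (x (n + q)) = D2 h (x (n - 1)) (x n)" for n
    using ty[unfolded of_type_iff, rule_format, of "n - 1"] ty[unfolded of_type_iff, rule_format, of n]
      D2_periodic[of "x (n - 1)" p "x n"]
    by (simp add: diff_add_eq)
  ultimately have shift: "(\<Sum>n\<in>{0..<q}. g (n + 1)) = (\<Sum>n\<in>{0..<q}. g n) + 0"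
    unfolding g_def by (intro sum_period_shift[OF q_pos]) simp
  \<comment> \<open>Over a full period the \<open>D2\<close> term of each bond can be attributed to
    its right end; the derivative of the action in the direction \<open>f\<close> becomes the sum of
    the squared forces.\<close>
  have grad: "(\<Sum>n\<in>{0..<q}. D1 h (x n) (x (n + 1)) * f n + D2 h (x n) (x (n + 1)) * f (n + 1)) = (\<Sum>n\<in>{0..<q}. (f n)\<^sup>2)"
  proof -
    have "(f n)\<^sup>2 = D1 h (x n) (x (n + 1)) * f n + g n" for n
      by (simp add: g_def f_def force_def power2_eq_square algebra_simps)
    moreover have "D2 h (x n) (x (n + 1)) * f (n + 1) = g (n + 1)" for n by (simp add: g_def)
    ultimately show ?thesis using shift by (simp add: sum.distrib)
  qed
  have "(\<Sum>n\<in>{0..<q}. (f n)\<^sup>2) \<le> \<kappa> * C" if \<kappa>: "\<kappa> > 0" for \<kappa>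
  proof -
    have flow: "flow h 0 \<theta> x n - x n = - \<theta> * f n" for \<theta> n by (simp add: flow_def f_def)
    have ev: "\<forall>\<^sub>F \<theta> in at_right 0. \<forall>n\<in>{0..<q}. \<bar>h (flow h 0 \<theta> x n) (flow h 0 \<theta> x (n + 1)) - h (x n) (x (n + 1))
        - D1 h (x n) (x (n + 1)) * (- \<theta> * f n) - D2 h (x n) (x (n + 1)) * (- \<theta> * f (n + 1))\<bar>
        \<le> \<kappa> * (\<bar>- \<theta> * f n\<bar> + \<bar>- \<theta> * f (n + 1)\<bar>)"
      unfolding flow[symmetric] by (intro eventually_ball_finite ballI h_expansion[OF flow_tendsto flow_tendsto \<kappa>]) auto
    obtain \<theta> where elim: "rising (flow h 0 \<theta> x)" "0 < \<theta>" "\<forall>n\<in>{0..<q}. \<bar>h (flow h 0 \<theta> x n) (flow h 0 \<theta> x (n + 1)) - h (x n) (x (n + 1))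
        - D1 h (x n) (x (n + 1)) * (- \<theta> * f n) - D2 h (x n) (x (n + 1)) * (- \<theta> * f (n + 1))\<bar>
        \<le> \<kappa> * (\<bar>- \<theta> * f n\<bar> + \<bar>- \<theta> * f (n + 1)\<bar>)"
      using eventually_happens[OF eventually_conj[OF flow_rising[OF x(1)] eventually_conj[OF eventually_at_right_less[of "0::real"] ev]]]
      by auto
    \<comment> \<open>An Euler step changes the action by \<open>- \<theta>\<close> times the
      squared forces, with a remainder of at most \<open>\<theta> * \<kappa> * C\<close>. Minimality
      forbids a decrease, so the squared forces are bounded by \<open>\<kappa> * C\<close> for every
      positive \<open>\<kappa>\<close>.\<close>
    have "0 \<le> action (flow h 0 \<theta> x) - action x" using x(2)[OF elim(1)] by simp
    also have "\<dots> = (\<Sum>n\<in>{0..<q}. h (flow h 0 \<theta> x n) (flow h 0 \<theta> x (n + 1)) - h (x n) (x (n + 1)))"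
      by (simp add: action_def sum_subtractf)
    also have "\<dots> \<le> (\<Sum>n\<in>{0..<q}. - \<theta> * (D1 h (x n) (x (n + 1)) * f n + D2 h (x n) (x (n + 1)) * f (n + 1))
        + \<theta> * \<kappa> * (\<bar>f n\<bar> + \<bar>f (n + 1)\<bar>))"
    proof (rule sum_mono)
      fix n assume "n \<in> {0..<q}"
      from bspec[OF elim(3) this] elim(2)
      show "h (flow h 0 \<theta> x n) (flow h 0 \<theta> x (n + 1)) - h (x n) (x (n + 1)) \<le>
        - \<theta> * (D1 h (x n) (x (n + 1)) * f n + D2 h (x n) (x (n + 1)) * f (n + 1)) + \<theta> * \<kappa> * (\<bar>f n\<bar> + \<bar>f (n + 1)\<bar>)"
        by (simp add: abs_mult algebra_simps abs_le_iff)
    qed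
    also have "\<dots> = - \<theta> * (\<Sum>n\<in>{0..<q}. D1 h (x n) (x (n + 1)) * f n + D2 h (x n) (x (n + 1)) * f (n + 1)) + \<theta> * \<kappa> * C"
      unfolding C_def sum_distrib_left by (rule sum.distrib)
    also have "\<dots> = \<theta> * (\<kappa> * C - (\<Sum>n\<in>{0..<q}. (f n)\<^sup>2))"
      unfolding grad by (simp add: algebra_simps)
    finally show ?thesis using elim(2) by (simp add: zero_le_mult_iff)
  qed
  note small = this
  have "(\<Sum>n\<in>{0..<q}. (f n)\<^sup>2) \<le> 0"
  proof (rule field_le_epsilon)
    fix e :: real assume "e > 0"
    have C: "C \<ge> 0" unfolding C_def by (intro sum_nonneg) simp
    then have "e / (C + 1) * C \<le> e" using \<open>e > 0\<close> by (simp add: field_simps)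
    moreover have "e / (C + 1) > 0" using C \<open>e > 0\<close> by simp
    ultimately show "(\<Sum>n\<in>{0..<q}. (f n)\<^sup>2) \<le> 0 + e" using small[of "e / (C + 1)"] by linarith
  qed
  then have "(\<Sum>n\<in>{0..<q}. (f n)\<^sup>2) = 0" by (intro antisym sum_nonneg) auto
  then have zero: "f n = 0" if "n \<in> {0..<q}" for n using that by (subst (asm) sum_nonneg_eq_0_iff) auto
  have "f n = 0" for n
  proof (rule residue_all[OF q_pos])
    show "f (n + q) = 0 \<longleftrightarrow> f n = 0" for n unfolding f_def force_of_type[OF ty] ..
  qed (rule zero)
  then have "equilibrium h 0 x" by (simp add: equilibrium_iff f_def)
  with x(1) show ?thesis by (rule that)
qed

end

section \<open>The depinning force\<close>

lemma bezout_type_exists: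
  assumes "q > 0" "coprime p q"
  obtains \<alpha> \<beta> where "bezout_type p q \<alpha> \<beta>"
proof -
  obtain u v where "u * p + v * q = gcd p q" using bezout_int by blast
  then have "v * q - (- u) * p = 1" using assms(2) by simp
  then have "bezout_type p q (- u) v" using assms(1) by unfold_locales
  then show ?thesis by (rule that)
qed

lemma lowest_terms_unique:
  fixes p q p' q' :: int
  assumes "q > 0" "coprime p q" "q' > 0" "coprime p' q'" "(of_int p / of_int q :: real) = of_int p' / of_int q'"
  shows "p = p' \<and> q = q'"
proof -
  have "real_of_int (p * q') = real_of_int (q * p')"
    using assms(1,3,5) by (simp add: field_simps)
  then have "p * q' = q * p'" by (simp only: of_int_eq_iff)
  then show ?thesis using coprime_crossproduct'[of q q' p p'] assms by simp
qed

context twist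
begin

lemma admits_iff:
  "admits_birkhoff_equilibrium h F \<omega> \<longleftrightarrow>
    (\<exists>x. equilibrium h F x \<and> birkhoff x \<and> width \<omega> x \<and>
      (\<forall>p q. q > 0 \<and> coprime p q \<and> \<omega> = of_int p / of_int q \<longrightarrow> of_type p q x))"
  unfolding admits_birkhoff_equilibrium_def
  using birkhoff_width width_spacing by (auto simp: has_mean_spacing_def)

lemma rational_equilibrium:
  assumes "q > 0" "coprime p q"
  obtains x where "equilibrium h 0 x" "birkhoff x" "width (of_int p / of_int q) x" "of_type p q x"
proof -
  obtain \<alpha> \<beta> where "bezout_type p q \<alpha> \<beta>" using bezout_type_exists[OF assms] .
  then interpret bezout_type p q \<alpha> \<beta> .
  interpret twist_type h c p q \<alpha> \<beta> by unfold_locales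
  obtain x where "rising x" "equilibrium h 0 x" by (rule rising_equilibrium)
  then show ?thesis using that[of x] rising_birkhoff rising_width by (simp add: rising_def)
qed

lemma rational_sequence:
  obtains p q :: "nat \<Rightarrow> int" where "\<And>k. q k > 0" "\<And>k. coprime (p k) (q k)"
    "(\<lambda>k. of_int (p k) / of_int (q k) :: real) \<longlonglongrightarrow> \<omega>"
proof -
  define r where "r = (\<lambda>k::nat. of_int \<lfloor>\<omega> * (real k + 1)\<rfloor> / (real k + 1))"
  have "\<exists>a b. b > 0 \<and> coprime a b \<and> r k = of_int a / of_int b" for k
  proof -
    have "r k \<in> \<rat>" by (simp add: r_def)
    then show ?thesis by (rule Rats_cases') blast
  qed
  then obtain p q where pq: "\<And>k. q k > 0" "\<And>k. coprime (p k) (q k)" "\<And>k. r k = of_int (p k) / of_int (q k)"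
    by metis
  have "(\<lambda>k. r k - \<omega>) \<longlonglongrightarrow> 0"
  proof (rule Lim_null_comparison[OF _ inverse_Suc_tendsto], rule always_eventually, rule allI)
    fix k
    have "r k - \<omega> = (of_int \<lfloor>\<omega> * (real k + 1)\<rfloor> - \<omega> * (real k + 1)) / (real k + 1)"
      by (simp add: r_def field_simps)
    moreover have "\<bar>of_int \<lfloor>\<omega> * (real k + 1)\<rfloor> - \<omega> * (real k + 1)\<bar> \<le> 1" by linarith
    ultimately show "norm (r k - \<omega>) \<le> 1 / (real k + 1)" by (simp add: divide_right_mono)
  qed
  then have "r \<longlonglongrightarrow> \<omega>" by (simp add: LIM_zero_iff)
  then have "(\<lambda>k. of_int (p k) / of_int (q k) :: real) \<longlonglongrightarrow> \<omega>" by (simp only: pq(3)[symmetric])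
  with pq(1,2) show ?thesis by (rule that)
qed

text \<open>Rational spacings are covered by action minimisers. An irrational spacing is a limit of
  rational ones, and the periodicity clause of the definition is then vacuous.\<close>

lemma admits_0: "admits_birkhoff_equilibrium h 0 \<omega>"
proof (cases "\<omega> \<in> \<rat>")
  case True
  then obtain p q where pq: "q > 0" "coprime p q" "\<omega> = of_int p / of_int q" by (rule Rats_cases')
  obtain x where x: "equilibrium h 0 x" "birkhoff x" "width (of_int p / of_int q) x" "of_type p q x"
    by (rule rational_equilibrium[OF pq(1,2)])
  have "of_type p' q' x" if "q' > 0 \<and> coprime p' q' \<and> \<omega> = of_int p' / of_int q'" for p' q'
    using lowest_terms_unique[of q p q' p'] pq that x(4) by simp
  then show ?thesis unfolding admits_iff using x pq(3) by blast
next
  case False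
  obtain p q where pq: "\<And>k. q k > 0" "\<And>k. coprime (p k) (q k)"
    "(\<lambda>k. of_int (p k) / of_int (q k) :: real) \<longlonglongrightarrow> \<omega>" by (rule rational_sequence[of \<omega>]) (rule that)
  have "\<exists>x. equilibrium h 0 x \<and> birkhoff x \<and> width (of_int (p k) / of_int (q k)) x" for k
    using rational_equilibrium[OF pq(1,2)[of k]] by metis
  then obtain x where x: "\<And>k. equilibrium h 0 (x k)" "\<And>k. birkhoff (x k)"
    "\<And>k. width (of_int (p k) / of_int (q k)) (x k)" by metis
  obtain z where "equilibrium h 0 z" "birkhoff z" "width \<omega> z"
    by (rule equilibria_cluster[OF sequentially_bot x tendsto_const pq(3)])
  moreover have "\<not> (\<exists>p q. \<omega> = of_int p / of_int q)"
    using False by auto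
  ultimately show ?thesis unfolding admits_iff by blast
qed

text \<open>An equilibrium of tilt \<open>F\<close> is a supersolution for the smaller tilt, and an
  untilted equilibrium of the same spacing, pushed below it, is a subsolution; \<open>perron\<close>
  fills the gap.\<close>

lemma admits_downward:
  assumes "admits_birkhoff_equilibrium h F \<omega>" "0 \<le> F'" "F' \<le> F"
  shows "admits_birkhoff_equilibrium h F' \<omega>"
proof -
  obtain x where x: "equilibrium h F x" "birkhoff x" "width \<omega> x"
    "\<And>p q. q > 0 \<and> coprime p q \<and> \<omega> = of_int p / of_int q \<Longrightarrow> of_type p q x"
    using assms(1) unfolding admits_iff by blast
  obtain y where y: "equilibrium h 0 y" "width \<omega> y"
    using admits_0[of \<omega>] unfolding admits_iff by blast
  \<comment> \<open>Each of \<open>x\<close> and \<open>y\<close> stays within 1 of a line of slope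
    \<open>\<omega>\<close>, which accounts for the 2; the other terms compare these lines at site
    0.\<close>
  define m where "m = \<lceil>2 + \<bar>y 0\<bar> + \<bar>x 0\<bar>\<rceil>"
  have m: "2 + \<bar>y 0\<bar> + \<bar>x 0\<bar> \<le> of_int m" unfolding m_def by (rule le_of_int_ceiling)
  have below: "translate 0 (- m) y \<le> x"
    unfolding le_fun_def translate_def
  proof
    fix n
    show "y (n - 0) + of_int (- m) \<le> x n"
      using widthD[OF x(3), of n 0] widthD[OF y(2), of n 0] m by simp
  qed
  have "force h (translate 0 (- m) y) n \<le> F'" "F' \<le> force h x n" for n
    using x(1) y(1) assms(2,3) by (simp_all add: equilibrium_iff force_translate)
  from perron[OF x(2) this below] obtain z where z: "translate 0 (- m) y \<le> z" "z \<le> x"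
    "equilibrium h F' z" "birkhoff z" "\<And>a b. translate a b x = x \<Longrightarrow> translate a b z = z" by blast
  have "width \<omega> z"
  proof (rule birkhoff_bounded_width[OF z(4)])
    fix n
    show "\<bar>z n - of_int n * \<omega>\<bar> \<le> 1 + \<bar>x 0\<bar> + \<bar>y 0\<bar> + of_int \<bar>m\<bar>"
      using widthD[OF x(3), of n 0] widthD[OF y(2), of n 0] le_funD[OF z(1), of n] le_funD[OF z(2), of n]
      by (simp add: translate_def)
  qed
  then show ?thesis unfolding admits_iff using z(3-5) x(4) unfolding of_type_def by blast
qed

lemma admits_bounded:
  obtains B where "\<And>F. admits_birkhoff_equilibrium h F \<omega> \<Longrightarrow> F \<le> B"
proof -
  obtain B where B: "\<And>x y. \<bar>y - x\<bar> \<le> \<bar>\<omega>\<bar> + 1 \<Longrightarrow> \<bar>D1 h x y\<bar> \<le> B" "\<And>x y. \<bar>y - x\<bar> \<le> \<bar>\<omega>\<bar> + 1 \<Longrightarrow> \<bar>D2 h x y\<bar> \<le> B"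
    by (rule strip_bound[of "\<bar>\<omega>\<bar> + 1"]) blast
  have "F \<le> 2 * B" if "admits_birkhoff_equilibrium h F \<omega>" for F
  proof -
    obtain x where x: "equilibrium h F x" "width \<omega> x"
      using \<open>admits_birkhoff_equilibrium h F \<omega>\<close> unfolding admits_iff by blast
    have "F = D2 h (x (- 1)) (x 0) + D1 h (x 0) (x 1)"
      using x(1) unfolding equilibrium_def by (auto dest: spec[of _ 0])
    then show ?thesis
      using B(2)[of "x 0" "x (- 1)"] B(1)[of "x 1" "x 0"] width_step[OF x(2), of 0] width_step[OF x(2), of "- 1"]
      by simp
  qed
  then show ?thesis by (rule that)
qed

lemma admits_limit:
  assumes "\<And>k::nat. admits_birkhoff_equilibrium h (f k) \<omega>" "f \<longlonglongrightarrow> F"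
  shows "admits_birkhoff_equilibrium h F \<omega>"
proof -
  have "\<exists>x. equilibrium h (f k) x \<and> birkhoff x \<and> width \<omega> x \<and>
      (\<forall>p q. q > 0 \<and> coprime p q \<and> \<omega> = of_int p / of_int q \<longrightarrow> of_type p q x)" for k
    using assms(1) unfolding admits_iff .
  then obtain x where x: "\<And>k. equilibrium h (f k) (x k)" "\<And>k. birkhoff (x k)" "\<And>k. width \<omega> (x k)"
    "\<And>k p q. q > 0 \<and> coprime p q \<and> \<omega> = of_int p / of_int q \<Longrightarrow> of_type p q (x k)" by metis
  obtain G z m where G: "G \<noteq> bot" "\<And>n. ((\<lambda>k. translate 0 (m k) (x k) n) \<longlongrightarrow> z n) G"
    "equilibrium h F z" "birkhoff z" "width \<omega> z"
    by (rule equilibria_cluster[OF sequentially_bot x(1-3) assms(2) tendsto_const]) blast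
  have "of_type p q z" if "q > 0 \<and> coprime p q \<and> \<omega> = of_int p / of_int q" for p q
    by (rule of_type_limit[OF G(1,2)]) (simp add: of_type_translate x(4)[OF that])
  then show ?thesis unfolding admits_iff using G by blast
qed

text \<open>The nonnegative admissible tilts form a compact interval starting at 0. Its right end is
  the unique number required by the definite description in \<open>depinning_force\<close>.\<close>

lemma depinning_force:
  shows depinning_force_nonneg: "0 \<le> depinning_force h \<omega>"
    and admits_iff_le: "0 \<le> F \<Longrightarrow> admits_birkhoff_equilibrium h F \<omega> \<longleftrightarrow> F \<le> depinning_force h \<omega>"
proof -
  define S where "S = {F. 0 \<le> F \<and> admits_birkhoff_equilibrium h F \<omega>}"
  define s where "s = Sup S"
  have S0: "0 \<in> S" using admits_0 by (simp add: S_def)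
  obtain B where B: "\<And>F. admits_birkhoff_equilibrium h F \<omega> \<Longrightarrow> F \<le> B" by (rule admits_bounded[of \<omega>]) blast
  have bdd: "bdd_above S" by (rule bdd_aboveI[of _ B]) (simp add: S_def B)
  have s0: "0 \<le> s" unfolding s_def by (rule cSup_upper[OF S0 bdd])
  have "\<exists>F. admits_birkhoff_equilibrium h F \<omega> \<and> \<bar>F - s\<bar> \<le> 1 / (real k + 1)" for k
  proof -
    obtain F where F: "F \<in> S" "s - 1 / (real k + 1) < F"
      using less_cSupD[of S "s - 1 / (real k + 1)"] S0 unfolding s_def by auto
    have "F \<le> s" unfolding s_def by (rule cSup_upper[OF F(1) bdd])
    then show ?thesis using F unfolding S_def by (intro exI[of _ F]) auto
  qed
  then obtain f where f: "\<And>k::nat. admits_birkhoff_equilibrium h (f k) \<omega>" "\<And>k. \<bar>f k - s\<bar> \<le> 1 / (real k + 1)"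
    by metis
  have "(\<lambda>k. f k - s) \<longlonglongrightarrow> 0"
    by (rule Lim_null_comparison[OF _ inverse_Suc_tendsto]) (simp add: f(2))
  then have "f \<longlonglongrightarrow> s" by (simp add: LIM_zero_iff)
  from admits_limit[OF f(1) this] have s: "admits_birkhoff_equilibrium h s \<omega>" .
  have above: "\<not> admits_birkhoff_equilibrium h F \<omega>" if "F > s" for F
  proof
    assume "admits_birkhoff_equilibrium h F \<omega>"
    then have "F \<in> S" using that s0 by (simp add: S_def)
    from cSup_upper[OF this bdd] that show False by (simp add: s_def)
  qed
  have "depinning_force h \<omega> = s"
    unfolding depinning_force_def
  proof (rule the_equality)
    show "0 \<le> s \<and> (\<forall>F. 0 \<le> F \<and> F \<le> s \<longrightarrow> admits_birkhoff_equilibrium h F \<omega>) \<and>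
      (\<forall>F>s. \<not> admits_birkhoff_equilibrium h F \<omega>)"
      using s0 above admits_downward[OF s] by blast
  next
    fix t assume t: "0 \<le> t \<and> (\<forall>F. 0 \<le> F \<and> F \<le> t \<longrightarrow> admits_birkhoff_equilibrium h F \<omega>) \<and>
      (\<forall>F>t. \<not> admits_birkhoff_equilibrium h F \<omega>)"
    then have "admits_birkhoff_equilibrium h t \<omega>" by blast
    then have "t \<le> s" using above not_le by blast
    moreover have "s \<le> t" using t s not_le by blast
    ultimately show "t = s" by simp
  qed
  then show "0 \<le> depinning_force h \<omega>"
    and "0 \<le> F \<Longrightarrow> admits_birkhoff_equilibrium h F \<omega> \<longleftrightarrow> F \<le> depinning_force h \<omega>"
    using s0 admits_downward[OF s] above not_le by auto
qed

end

section \<open>Continuous families of equilibria\<close>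

text \<open>Otherwise the Birkhoff order would limit the growth to \<open>p\<close> per
  \<open>q\<close> sites, which falls behind the larger spacing.\<close>

lemma width_advancing:
  assumes "birkhoff x" "width \<omega> x" "q > 0" "of_int p / of_int q < \<omega>"
  shows "translate q p x \<le> x"
proof (rule ccontr)
  assume "\<not> translate q p x \<le> x"
  then have le: "x \<le> translate q p x" using iffD1[OF birkhoff_iff assms(1)] by blast
  have up: "x (int k * q) \<le> x 0 + real k * of_int p" for k
  proof (induction k)
    case (Suc k)
    have "x (int (Suc k) * q) \<le> x (int k * q) + of_int p"
      using le_funD[OF le, of "int (Suc k) * q"] by (simp add: translate_def algebra_simps)
    with Suc show ?case by (simp add: algebra_simps)
  qed simp
  have pos: "of_int q * \<omega> - of_int p > 0" using assms(3,4) by (simp add: field_simps)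
  obtain k :: nat where "1 < real k * (of_int q * \<omega> - of_int p)"
    using reals_Archimedean3[OF pos] by blast
  moreover have "real k * (of_int q * \<omega> - of_int p) \<le> 1"
    using up[of k] widthD[OF assms(2), of "int k * q" 0] by (simp add: algebra_simps)
  ultimately show False by simp
qed

text \<open>The iterated translates increase, and \<open>width\<close> with slope exactly
  \<open>p / q\<close> keeps them within 1 of \<open>y\<close>. The limit is invariant under the
  translation, hence periodic.\<close>

lemma translate_iterates_limit:
  assumes "translate q p y \<le> y" "width (of_int p / of_int q) y" "q > 0"
  obtains z where "\<And>n. (\<lambda>j. translate (- int j * q) (- int j * p) y n) \<longlonglongrightarrow> z n" "of_type p q z"
proof -
  define Y where "Y = (\<lambda>j::nat. translate (- int j * q) (- int j * p) y)"
  have Suc: "Y (Suc j) = translate (- q) (- p) (Y j)" for j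
    by (simp add: Y_def algebra_simps)
  have le: "Y j \<le> Y (Suc j)" for j
  proof -
    have "translate (- (q + int j * q)) (- (p + int j * p)) (translate q p y) \<le> translate (- (q + int j * q)) (- (p + int j * p)) y"
      by (rule translate_mono[OF assms(1)])
    then show ?thesis by (simp add: Y_def algebra_simps)
  qed
  have bound: "Y j n \<le> y n + 1" for j n
    using widthD[OF assms(2), of "n + int j * q" n] assms(3) by (simp add: Y_def translate_def)
  have "\<exists>l. (\<lambda>j. Y j n) \<longlonglongrightarrow> l" for n
  proof -
    have "incseq (\<lambda>j. Y j n)" by (intro incseq_SucI le_funD[OF le])
    from incseq_convergent[OF this, of "y n + 1"] bound show ?thesis by blast
  qed
  then obtain z where z: "\<And>n. (\<lambda>j. Y j n) \<longlonglongrightarrow> z n" by metis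
  have "z (n + q) = z n + of_int p" for n
  proof -
    have "(\<lambda>j. Y (Suc j) n + of_int p) \<longlonglongrightarrow> z n + of_int p"
      by (intro tendsto_intros LIMSEQ_Suc z)
    moreover have "Y (Suc j) n + of_int p = Y j (n + q)" for j
      unfolding Suc by (simp add: translate_def)
    ultimately show ?thesis using LIMSEQ_unique[OF z[of "n + q"]] by simp
  qed
  then have "of_type p q z" by (simp add: of_type_iff)
  with z show ?thesis unfolding Y_def by (rule that)
qed

text \<open>The lifted circle: \<open>t\<close> runs along it and \<open>d\<close> is its degree.
  The members may cross each other; what is known about their growth is \<open>advancing\<close> and
  the one-sided bound \<open>upper\<close>.\<close>

locale equilibrium_family = twist +
  fixes p q d :: int and x :: "real \<Rightarrow> configuration"
  assumes q_pos: "q > 0" and d_pos: "d > 0"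
    and cont: "\<And>n. continuous_on UNIV (\<lambda>t. x t n)"
    and shift: "\<And>t n. x (t + 1) n = x t n + of_int d"
    and equil: "\<And>t. equilibrium h 0 (x t)"
    and advancing: "\<And>t n. x t n + of_int p \<le> x t (n + q)"
    and upper: "\<exists>B. \<forall>t\<in>{0..1}. \<forall>n\<ge>0. x t n \<le> B + of_int n * (of_int p / of_int q)"
begin

lemma shift_int: "x (t + of_int k) n = x t n + of_int (k * d)"
proof (induction k rule: int_induct[of _ 0])
  case (step1 k)
  then show ?case using shift[of "t + of_int k" n] by (simp add: algebra_simps)
next
  case (step2 k)
  then show ?case using shift[of "t + of_int (k - 1)" n] by (simp add: algebra_simps)
qed simp

lemma reduce: obtains s where "s \<in> {0..1}" "\<And>n. x t n = x s n + of_int (\<lfloor>t\<rfloor> * d)"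
proof
  show "t - of_int \<lfloor>t\<rfloor> \<in> {0..1}" using floor_correct[of t] by simp linarith
  show "x t n = x (t - of_int \<lfloor>t\<rfloor>) n + of_int (\<lfloor>t\<rfloor> * d)" for n
    using shift_int[of "t - of_int \<lfloor>t\<rfloor>" "\<lfloor>t\<rfloor>" n] by simp
qed

lemma bounded_unit:
  obtains M where "\<And>s. s \<in> {0..1} \<Longrightarrow> \<bar>x s n\<bar> \<le> M"
proof -
  have "bounded ((\<lambda>s. x s n) ` {0..1})"
    by (intro compact_imp_bounded compact_continuous_image continuous_on_subset[OF cont]) auto
  then obtain M where "\<forall>s\<in>{0..1}. \<bar>x s n\<bar> \<le> M" unfolding bounded_iff by auto
  then show ?thesis using that by blast
qed

lemma tends_down: obtains a where "\<And>s. s \<le> a \<Longrightarrow> x s n < v"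
proof -
  obtain M where M: "\<And>s. s \<in> {0..1} \<Longrightarrow> \<bar>x s n\<bar> \<le> M" using bounded_unit by blast
  have "x s n < v" if "s \<le> - \<bar>v - M\<bar> - 1" for s
  proof -
    obtain r where r: "r \<in> {0..1}" "x s n = x r n + of_int (\<lfloor>s\<rfloor> * d)" by (rule reduce[of s]) blast
    have fl: "of_int \<lfloor>s\<rfloor> \<le> s" by linarith
    have "\<lfloor>s\<rfloor> \<le> 0" using that by linarith
    then have "\<lfloor>s\<rfloor> * d \<le> \<lfloor>s\<rfloor> * 1" using d_pos by (intro mult_left_mono_neg) auto
    then have "real_of_int (\<lfloor>s\<rfloor> * d) \<le> of_int \<lfloor>s\<rfloor>" by (simp only: of_int_le_iff mult_1_right)
    then show ?thesis using r(2) M[OF r(1)] that fl by linarith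
  qed
  then show ?thesis by (rule that)
qed

lemma tends_up: obtains a where "\<And>s. s \<ge> a \<Longrightarrow> v < x s n"
proof -
  obtain M where M: "\<And>s. s \<in> {0..1} \<Longrightarrow> \<bar>x s n\<bar> \<le> M" using bounded_unit by blast
  have "v < x s n" if "s \<ge> \<bar>v\<bar> + \<bar>M\<bar> + 2" for s
  proof -
    obtain r where r: "r \<in> {0..1}" "x s n = x r n + of_int (\<lfloor>s\<rfloor> * d)" by (rule reduce[of s]) blast
    have fl: "of_int \<lfloor>s\<rfloor> \<ge> s - 1" by linarith
    have "\<lfloor>s\<rfloor> \<ge> 0" using that by linarith
    then have "\<lfloor>s\<rfloor> * d \<ge> \<lfloor>s\<rfloor> * 1" using d_pos by (intro mult_left_mono) auto
    then have "real_of_int (\<lfloor>s\<rfloor> * d) \<ge> of_int \<lfloor>s\<rfloor>" by (simp only: of_int_le_iff mult_1_right)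
    then show ?thesis using r(2) M[OF r(1)] that fl by linarith
  qed
  then show ?thesis by (rule that)
qed

lemma upper_bound:
  obtains C where "\<And>s n. s \<le> t \<Longrightarrow> n \<ge> 0 \<Longrightarrow> x s n \<le> C + of_int n * (of_int p / of_int q)"
proof -
  obtain B where B: "\<And>t n. t \<in> {0..1} \<Longrightarrow> n \<ge> 0 \<Longrightarrow> x t n \<le> B + of_int n * (of_int p / of_int q)"
    using upper by blast
  have "x s n \<le> (B + of_int (\<lfloor>t\<rfloor> * d)) + of_int n * (of_int p / of_int q)" if "s \<le> t" "n \<ge> 0" for s n
  proof -
    obtain r where r: "r \<in> {0..1}" "x s n = x r n + of_int (\<lfloor>s\<rfloor> * d)" by (rule reduce[of s]) blast
    have "\<lfloor>s\<rfloor> * d \<le> \<lfloor>t\<rfloor> * d" using that d_pos by (intro mult_right_mono floor_mono) auto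
    then have "real_of_int (\<lfloor>s\<rfloor> * d) \<le> of_int (\<lfloor>t\<rfloor> * d)" by (simp only: of_int_le_iff)
    then show ?thesis using r(2) B[OF r(1) that(2)] by linarith
  qed
  then show ?thesis by (rule that)
qed

text \<open>As \<open>x t n\<close> may fail to be monotone in \<open>t\<close>, it can take the
  value \<open>v\<close> several times. The first time comes with an upper bound on all earlier
  members.\<close>

lemma first_hit:
  obtains t where "x t n = v" "\<And>s. s \<le> t \<Longrightarrow> x s n \<le> v"
proof -
  define S where "S = {s. v \<le> x s n}"
  obtain a where a: "\<And>s. s \<le> a \<Longrightarrow> x s n < v" using tends_down by blast
  obtain b where b: "\<And>s. s \<ge> b \<Longrightarrow> v < x s n" using tends_up by blast
  have ne: "S \<noteq> {}" using b[of b] by (auto simp: S_def intro: less_imp_le)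
  have bdd: "bdd_below S"
  proof (rule bdd_belowI[of _ a])
    fix s assume "s \<in> S"
    then have "\<not> x s n < v" by (simp add: S_def)
    then show "a \<le> s" using a[of s] by (cases "s \<le> a") auto
  qed
  have closed: "closed S"
    unfolding S_def by (intro closed_Collect_le continuous_on_const cont)
  define t where "t = Inf S"
  have tS: "v \<le> x t n"
    using closed_contains_Inf[OF ne bdd closed] by (simp add: t_def S_def)
  have before: "x s n < v" if "s < t" for s
  proof (rule ccontr)
    assume "\<not> ?thesis"
    then have "s \<in> S" by (simp add: S_def)
    from cInf_lower[OF this bdd] that show False by (simp add: t_def)
  qed
  have "((\<lambda>s. x s n) \<longlongrightarrow> x t n) (at_left t)"
    using cont[of n] by (auto simp: continuous_on_def intro: tendsto_within_subset)
  moreover have "\<forall>\<^sub>F s in at_left t. x s n \<le> v"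
    unfolding eventually_at_filter by (auto intro!: always_eventually less_imp_le before)
  ultimately have "x t n \<le> v" by (rule tendsto_upperbound) simp
  then have "x t n = v" using tS by simp
  moreover have "x s n \<le> v" if "s \<le> t" for s
    using before[of s] \<open>x t n = v\<close> that by (cases "s = t") auto
  ultimately show ?thesis by (rule that)
qed

text \<open>\<open>crosses y\<close> says that the first member of the family reaching \<open>y\<close> at site \<open>n\<close> moves up with
  \<open>n\<close>: in the phase cylinder, \<open>y\<close> stays above the curve formed by the family.\<close>

definition crosses :: "configuration \<Rightarrow> bool" where
  "crosses y \<longleftrightarrow> (\<exists>t. \<forall>n. x (t n) n = y n \<and> (\<forall>s\<le>t n. x s n \<le> y n) \<and> t n \<le> t (n + 1))"

text \<open>If the first-hit parameter drops once, it drops at every later site: otherwise a member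
  with force 0 would touch \<open>y\<close>, of force \<open>\<delta>\<close>, from below, against
  the comparison principle. But then \<open>y\<close> would be bounded to the right by early members
  of the family, which grow at rate \<open>p / q\<close> only.\<close>

lemma faster_crosses:
  assumes "equilibrium h \<delta> y" "\<delta> > 0" "width \<omega> y" "of_int p / of_int q < \<omega>"
  shows "crosses y"
proof -
  have "\<exists>t. x t n = y n \<and> (\<forall>s\<le>t. x s n \<le> y n)" for n
    using first_hit[of n "y n"] by blast
  then obtain t where t: "\<And>n. x (t n) n = y n" "\<And>n s. s \<le> t n \<Longrightarrow> x s n \<le> y n" by metis
  have step: "t (m + 1 + 1) < t (m + 1)" if "t (m + 1) < t m" for m
  proof (rule ccontr)
    assume "\<not> ?thesis"
    then have "x (t (m + 1)) (m + 1 + 1) \<le> y (m + 1 + 1)" using t(2) by simp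
    moreover have "x (t (m + 1)) m \<le> y m" using t(2) that by simp
    ultimately have "force h y (m + 1) \<le> force h (x (t (m + 1))) (m + 1)"
      by (intro force_antimono t(1)) (simp_all only: add_diff_cancel_right')
    then show False using assms(1,2) equil by (simp add: equilibrium_iff)
  qed
  have "t n \<le> t (n + 1)" for n
  proof (rule ccontr)
    assume "\<not> ?thesis"
    then have less: "t (n + 1) < t n" by simp
    have dec: "t (n + int k + 1) < t (n + int k) \<and> t (n + int k) \<le> t n" for k
    proof (induction k)
      case 0 then show ?case using less by simp
    next
      case (Suc k)
      then show ?case using step[of "n + int k"] by (simp add: algebra_simps)
    qed
    obtain C where C: "\<And>s m. s \<le> t n \<Longrightarrow> m \<ge> 0 \<Longrightarrow> x s m \<le> C + of_int m * (of_int p / of_int q)"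
      by (rule upper_bound[of "t n"]) blast
    define \<eta> where "\<eta> = \<omega> - of_int p / of_int q"
    have \<eta>: "\<eta> > 0" using assms(4) by (simp add: \<eta>_def)
    have bound: "of_int m * \<eta> \<le> C + of_int n * \<omega> + 1 - y n" if "m \<ge> 0" "m \<ge> n" for m
    proof -
      have "y m = x (t m) m" by (simp add: t(1))
      also have "\<dots> \<le> C + of_int m * (of_int p / of_int q)"
        using C[OF _ that(1), of "t m"] dec[of "nat (m - n)"] that(2) by simp
      finally show ?thesis
        using widthD[OF assms(3), of m n] by (simp add: \<eta>_def algebra_simps)
    qed
    define V where "V = C + of_int n * \<omega> + 1 - y n"
    obtain k :: nat where k: "\<bar>V\<bar> < real k * \<eta>"
      using reals_Archimedean3[OF \<eta>] by blast
    have "real k * \<eta> \<le> real (k + nat \<bar>n\<bar>) * \<eta>" using \<eta> by (intro mult_right_mono) auto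
    moreover have "real (k + nat \<bar>n\<bar>) * \<eta> \<le> V"
      using bound[of "int (k + nat \<bar>n\<bar>)"] by (simp add: V_def)
    ultimately show False using k by linarith
  qed
  then show ?thesis unfolding crosses_def using t by blast
qed

text \<open>The hitting parameters are bounded at each site and cluster. The limit parameters need
  not be first hits, but the weak inequality for all earlier members, by which
  \<open>crosses\<close> expresses this, is closed.\<close>

lemma crosses_limit:
  assumes G: "G \<noteq> bot" "\<And>n. ((\<lambda>k. X k n) \<longlongrightarrow> y n) G" and "\<And>k. crosses (X k)"
  shows "crosses y"
proof -
  have "\<exists>t. \<forall>n. x (t n) n = X k n \<and> (\<forall>s\<le>t n. x s n \<le> X k n) \<and> t n \<le> t (n + 1)" for k
    using assms(3)[of k] unfolding crosses_def .
  then obtain t where t: "\<And>k n. x (t k n) n = X k n" "\<And>k n s. s \<le> t k n \<Longrightarrow> x s n \<le> X k n"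
    "\<And>k n. t k n \<le> t k (n + 1)" by metis
  have "\<exists>B. \<forall>\<^sub>F k in G. \<bar>t k n\<bar> \<le> B" for n
  proof -
    obtain a where a: "\<And>s. s \<le> a \<Longrightarrow> x s n < - \<bar>y n\<bar> - 1" using tends_down by blast
    obtain b where b: "\<And>s. s \<ge> b \<Longrightarrow> \<bar>y n\<bar> + 1 < x s n" using tends_up by blast
    have "\<forall>\<^sub>F k in G. \<bar>X k n - y n\<bar> < 1"
      using tendstoD[OF G(2)[of n], of 1] by (simp add: dist_real_def)
    then have "\<forall>\<^sub>F k in G. \<bar>t k n\<bar> \<le> \<bar>a\<bar> + \<bar>b\<bar>"
    proof eventually_elim
      case (elim k)
      have "\<not> t k n \<le> a" "\<not> b \<le> t k n"
        using a[of "t k n"] b[of "t k n"] elim t(1)[of k n] by linarith+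
      then show ?case by linarith
    qed
    then show ?thesis by blast
  qed
  then obtain H u where H: "H \<le> G" "H \<noteq> bot" "\<And>n. ((\<lambda>k. t k n) \<longlongrightarrow> u n) H"
    using pointwise_cluster[OF G(1), of t] by metis
  have lim: "((\<lambda>k. X k n) \<longlongrightarrow> y n) H" for n by (rule tendsto_mono[OF H(1) G(2)])
  have eq: "x (u n) n = y n" for n
  proof -
    have "((\<lambda>k. x (t k n) n) \<longlongrightarrow> x (u n) n) H"
      using continuous_on_tendsto_compose[OF cont[of n] H(3)[of n]] by simp
    then show ?thesis using tendsto_unique[OF H(2) _ lim[of n]] by (simp add: t(1))
  qed
  have "x s n \<le> y n" if "s \<le> u n" for s n
  proof (cases "s = u n")
    case False
    then have "\<forall>\<^sub>F k in H. s < t k n" using that by (intro order_tendstoD(1)[OF H(3)]) simp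
    then have "\<forall>\<^sub>F k in H. x s n \<le> X k n" by (rule eventually_mono) (rule t(2), simp)
    then show ?thesis by (rule tendsto_lowerbound[OF lim _ H(2)])
  qed (simp add: eq)
  moreover have "u n \<le> u (n + 1)" for n
    by (rule tendsto_le[OF H(2) H(3) H(3)]) (rule always_eventually, rule allI, rule t(3))
  ultimately show ?thesis unfolding crosses_def using eq by blast
qed

text \<open>The member through \<open>z 0\<close> stays below \<open>z\<close> to the right of 0,
  and by \<open>advancing\<close> it is back at \<open>z\<close> at site \<open>q\<close>. The
  contact is exploited there and not at 0 because both neighbours of \<open>q\<close> lie in the
  controlled half-line.\<close>

lemma periodic_not_crosses:
  assumes "equilibrium h \<delta> z" "\<delta> > 0" "of_type p q z" "crosses z"
  shows False
proof -
  obtain t where t: "\<And>n. x (t n) n = z n" "\<And>n s. s \<le> t n \<Longrightarrow> x s n \<le> z n" "\<And>n. t n \<le> t (n + 1)"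
    using assms(4) unfolding crosses_def by metis
  have "t 0 \<le> t (int n)" for n
  proof (induction n)
    case (Suc n)
    then show ?case using t(3)[of "int n"] by (simp add: add.commute)
  qed simp
  then have "t 0 \<le> t n" if "n \<ge> 0" for n using that by (metis int_nat_eq)
  then have le: "x (t 0) n \<le> z n" if "n \<ge> 0" for n using that by (intro t(2))
  have "z q = z 0 + of_int p" using assms(3)[unfolded of_type_iff, rule_format, of 0] by simp
  also have "\<dots> \<le> x (t 0) q" using advancing[of "t 0" 0] t(1)[of 0] by simp
  finally have "x (t 0) q = z q" using le[of q] q_pos by simp
  then have "force h z q \<le> force h (x (t 0)) q"
    using q_pos by (intro force_antimono le) auto
  then show False using assms(1,2) equil by (simp add: equilibrium_iff)
qed

theorem depinning_force_tendsto: "(depinning_force h \<longlongrightarrow> 0) (at_right (of_int p / of_int q))"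
proof (rule ccontr)
  let ?\<omega> = "of_int p / of_int q :: real"
  assume "\<not> ?thesis"
  then obtain \<delta> where \<delta>: "\<delta> > 0" "\<not> (\<forall>\<^sub>F \<omega> in at_right ?\<omega>. dist (depinning_force h \<omega>) 0 < \<delta>)"
    unfolding tendsto_iff by blast
  have "\<exists>\<omega>. ?\<omega> < \<omega> \<and> \<omega> < ?\<omega> + 1 / (real k + 1) \<and> \<delta> \<le> depinning_force h \<omega>" for k
  proof (rule ccontr)
    assume *: "\<not> ?thesis"
    have "dist (depinning_force h \<omega>) 0 < \<delta>" if "?\<omega> < \<omega>" "\<omega> < ?\<omega> + 1 / (real k + 1)" for \<omega>
      using * that depinning_force_nonneg[of \<omega>] by (force simp: dist_real_def not_le)
    then have "\<forall>\<^sub>F \<omega> in at_right ?\<omega>. dist (depinning_force h \<omega>) 0 < \<delta>"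
      unfolding eventually_at_right_field by (intro exI[of _ "?\<omega> + 1 / (real k + 1)"]) simp
    with \<delta>(2) show False by contradiction
  qed
  then obtain w where w: "\<And>k::nat. ?\<omega> < w k" "\<And>k. w k < ?\<omega> + 1 / (real k + 1)" "\<And>k. \<delta> \<le> depinning_force h (w k)"
    by metis
  have lim1: "(\<lambda>k. ?\<omega> + 1 / (real k + 1)) \<longlonglongrightarrow> ?\<omega>"
    using tendsto_add[OF tendsto_const inverse_Suc_tendsto, of ?\<omega>] by simp
  have wlim: "w \<longlonglongrightarrow> ?\<omega>"
    by (rule real_tendsto_sandwich[OF _ _ tendsto_const lim1])
      (auto intro!: always_eventually less_imp_le w(1,2))
  have "\<exists>y. equilibrium h \<delta> y \<and> birkhoff y \<and> width (w k) y" for k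
    using admits_iff_le[of \<delta> "w k"] w(3)[of k] \<delta>(1) unfolding admits_iff by auto
  then obtain Y where Y: "\<And>k. equilibrium h \<delta> (Y k)" "\<And>k. birkhoff (Y k)" "\<And>k. width (w k) (Y k)" by metis
  obtain G y m where G: "G \<noteq> bot" "\<And>n. ((\<lambda>k. translate 0 (m k) (Y k) n) \<longlongrightarrow> y n) G"
    "equilibrium h \<delta> y" "birkhoff y" "width ?\<omega> y"
    by (rule equilibria_cluster[OF sequentially_bot Y tendsto_const wlim]) blast
  have advk: "translate q p (translate 0 (m k) (Y k)) \<le> translate 0 (m k) (Y k)" for k
    by (rule width_advancing[OF birkhoff_translate[OF Y(2)] width_translate[OF Y(3)] q_pos w(1)])
  have "translate q p y n \<le> y n" for n
    by (rule tendsto_le[OF G(1) G(2)[of n] translate_tendsto[of "\<lambda>k. translate 0 (m k) (Y k)", OF G(2)]])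
      (rule always_eventually, rule allI, rule le_funD[OF advk])
  then have adv: "translate q p y \<le> y" by (simp add: le_fun_def)
  \<comment> \<open>The limit \<open>y\<close> has spacing \<open>p / q\<close> and is advancing,
    but only the limit of its translates is periodic.\<close>
  obtain z where z: "\<And>n. (\<lambda>j. translate (- int j * q) (- int j * p) y n) \<longlonglongrightarrow> z n" "of_type p q z"
    by (rule translate_iterates_limit[OF adv G(5) q_pos]) blast
  \<comment> \<open>The translation is applied to the approximants, for which
    \<open>faster_crosses\<close> holds, and only then is the limit taken.\<close>
  have "crosses (translate (- int j * q) (- int j * p) y)" for j
  proof (rule crosses_limit[OF G(1) translate_tendsto[of "\<lambda>k. translate 0 (m k) (Y k)", OF G(2)]])
    fix k
    show "crosses (translate (- int j * q) (- int j * p) (translate 0 (m k) (Y k)))"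
      by (rule faster_crosses[OF _ \<delta>(1) _ w(1)[of k]])
        (rule equilibrium_translate width_translate Y)+
  qed
  then have "crosses z" by (rule crosses_limit[of sequentially "\<lambda>j. translate (- int j * q) (- int j * p) y", OF _ z(1), rotated]) simp
  moreover have "equilibrium h \<delta> z"
    by (rule equilibrium_limit[of sequentially "\<lambda>j. translate (- int j * q) (- int j * p) y", OF _ z(1) _ tendsto_const]) (simp_all add: equilibrium_translate[OF G(3)])
  ultimately show False using periodic_not_crosses[OF _ \<delta>(1) z(2)] by blast
qed

end

section \<open>Lifting invariant circles\<close>

lemma cis_2pi_eq_iff: "cis (2 * pi * x) = cis (2 * pi * y) \<longleftrightarrow> (\<exists>m::int. x = y + of_int m)"
proof -
  have "cis (2 * pi * x) = cis (2 * pi * y) \<longleftrightarrow>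
      (\<exists>m::int. \<i> * complex_of_real (2 * pi * x) = \<i> * complex_of_real (2 * pi * y) + (of_int (2 * m) * pi) * \<i>)"
    unfolding cis_conv_exp by (rule exp_eq)
  also have "\<dots> \<longleftrightarrow> (\<exists>m::int. 2 * pi * x = 2 * pi * y + of_int (2 * m) * pi)"
    by (intro arg_cong[of _ _ Ex] ext) (simp add: complex_eq_iff)
  also have "\<dots> \<longleftrightarrow> (\<exists>m::int. x = y + of_int m)"
  proof (intro arg_cong[of _ _ Ex] ext)
    fix m :: int
    have "2 * pi * y + of_int (2 * m) * pi = 2 * pi * (y + of_int m)" by (simp add: algebra_simps)
    then show "(2 * pi * x = 2 * pi * y + of_int (2 * m) * pi) = (x = y + of_int m)"
      using pi_gt_zero by (metis mult_cancel_left mult_eq_0_iff pi_neq_zero zero_neq_numeral)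
  qed
  finally show ?thesis .
qed

lemma cyl_proj_eq_iff: "cyl_proj x u = cyl_proj y v \<longleftrightarrow> (\<exists>m::int. x = y + of_int m) \<and> u = v"
  by (simp add: cyl_proj_def cis_2pi_eq_iff)

lemma cyl_proj_continuous: "continuous_on S (\<lambda>z. cyl_proj (fst z) (snd z))"
  unfolding cyl_proj_def cis_conv_exp by (intro continuous_intros)

lemma cyl_proj_in_cylinder: "cyl_proj x u \<in> cylinder"
  by (simp add: cyl_proj_def cylinder_def)

text \<open>A logarithm along the contractible interval gives the angle, counted in turns. Degree 0
  would make the lift a loop in the plane, whose contraction projects to one of
  \<open>\<gamma>\<close>; a negative degree is made positive by reversing the path.\<close>

lemma lift_cylinder_loop:
  assumes "path \<gamma>" "path_image \<gamma> \<subseteq> cylinder" "pathfinish \<gamma> = pathstart \<gamma>"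
    and "\<not> (\<exists>a. homotopic_loops cylinder \<gamma> (linepath a a))"
  obtains \<theta> u :: "real \<Rightarrow> real" and d :: int where "continuous_on {0..1} \<theta>" "continuous_on {0..1} u"
    "\<And>t. t \<in> {0..1} \<Longrightarrow> cyl_proj (\<theta> t) (u t) \<in> path_image \<gamma>"
    "\<theta> 1 = \<theta> 0 + of_int d" "d > 0" "u 1 = u 0"
proof -
  have cont: "continuous_on {0..1} \<gamma>" using assms(1) by (simp add: path_def)
  have mem: "\<gamma> t \<in> cylinder" if "t \<in> {0..1}" for t
    using assms(2) that by (auto simp: path_image_def)
  then have norm: "norm (fst (\<gamma> t)) = 1" if "t \<in> {0..1}" for t
    using that by (force simp: cylinder_def mem_Times_iff)
  have "continuous_on {0..1} (\<lambda>t. fst (\<gamma> t))" by (intro continuous_intros cont)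
  moreover have "contractible {0..1::real}" by (rule convex_imp_contractible) simp
  moreover have "fst (\<gamma> t) \<noteq> 0" if "t \<in> {0..1}" for t using norm[OF that] by auto
  ultimately obtain g where g: "continuous_on {0..1} g" "\<And>t. t \<in> {0..1} \<Longrightarrow> fst (\<gamma> t) = exp (g t)"
    using continuous_logarithm_on_contractible[of "{0..1}" "\<lambda>t. fst (\<gamma> t)"] by blast
  define \<theta> where "\<theta> = (\<lambda>t. Im (g t) / (2 * pi))"
  define u where "u = (\<lambda>t. snd (\<gamma> t))"
  have \<theta>: "continuous_on {0..1} \<theta>" unfolding \<theta>_def by (intro continuous_intros g) simp
  have u: "continuous_on {0..1} u" unfolding u_def by (intro continuous_intros cont)
  have lift: "cyl_proj (\<theta> t) (u t) = \<gamma> t" if t: "t \<in> {0..1}" for t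
  proof -
    have "Re (g t) = 0" using norm[OF t] g(2)[OF t] by (simp add: norm_exp_eq_Re)
    then have "fst (\<gamma> t) = cis (2 * pi * \<theta> t)"
      unfolding g(2)[OF t] by (subst exp_eq_polar) (simp add: \<theta>_def)
    then show ?thesis by (simp add: cyl_proj_def u_def prod_eq_iff)
  qed
  have ends: "\<gamma> 1 = \<gamma> 0" using assms(3) by (simp add: pathfinish_def pathstart_def)
  then have "cyl_proj (\<theta> 1) (u 1) = cyl_proj (\<theta> 0) (u 0)" using lift[of 0] lift[of 1] by simp
  then obtain m :: int where m: "\<theta> 1 = \<theta> 0 + of_int m" "u 1 = u 0" unfolding cyl_proj_eq_iff by blast
  have "m \<noteq> 0"
  proof
    assume "m = 0"
    define \<delta> where "\<delta> = (\<lambda>t. (\<theta> t, u t))"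
    have "path \<delta>" unfolding path_def \<delta>_def by (intro continuous_intros \<theta> u)
    moreover have loop: "pathfinish \<delta> = pathstart \<delta>"
      using m \<open>m = 0\<close> by (simp add: \<delta>_def pathfinish_def pathstart_def)
    moreover have "simply_connected (UNIV :: (real \<times> real) set)"
      by (rule convex_imp_simply_connected) simp
    ultimately have "homotopic_loops UNIV \<delta> (linepath 0 0)"
      unfolding simply_connected_eq_contractible_loop_any by blast
    from homotopic_loops_continuous_image[OF this cyl_proj_continuous, of cylinder]
    have hom: "homotopic_loops cylinder ((\<lambda>z. cyl_proj (fst z) (snd z)) \<circ> \<delta>) ((\<lambda>z. cyl_proj (fst z) (snd z)) \<circ> linepath 0 0)"
      using cyl_proj_in_cylinder by auto
    have "(\<lambda>z. cyl_proj (fst z) (snd z)) \<circ> linepath 0 (0 :: real \<times> real) = linepath (cyl_proj 0 0) (cyl_proj 0 0)"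
    proof
      fix t :: real
      have "linepath a a t = a" for a :: "'x::real_normed_vector"
        by (simp add: linepath_def algebra_simps flip: scaleR_add_left)
      then show "((\<lambda>z. cyl_proj (fst z) (snd z)) \<circ> linepath 0 (0 :: real \<times> real)) t = linepath (cyl_proj 0 0) (cyl_proj 0 0) t"
        by simp
    qed
    moreover have "homotopic_loops cylinder \<gamma> ((\<lambda>z. cyl_proj (fst z) (snd z)) \<circ> \<delta>)"
      by (rule homotopic_loops_eq[OF assms(1-3)]) (simp add: \<delta>_def lift)
    ultimately have "homotopic_loops cylinder \<gamma> (linepath (cyl_proj 0 0) (cyl_proj 0 0))"
      using hom homotopic_loops_trans by metis
    with assms(4) show False by blast
  qed
  have image: "cyl_proj (\<theta> t) (u t) \<in> path_image \<gamma>" if "t \<in> {0..1}" for t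
    using lift[OF that] that by (simp add: path_image_def)
  show ?thesis
  proof (cases "m > 0")
    case True
    show ?thesis by (rule that[OF \<theta> u image m(1) True m(2)])
  next
    case False
    have rev: "continuous_on {0..1::real} (\<lambda>t. 1 - t)" "(\<lambda>t. 1 - t) ` {0..1} \<subseteq> {0..1::real}"
      by (auto intro!: continuous_intros)
    show ?thesis
    proof (rule that[of "\<lambda>t. \<theta> (1 - t)" "\<lambda>t. u (1 - t)" "- m"])
      show "continuous_on {0..1} (\<lambda>t. \<theta> (1 - t))" "continuous_on {0..1} (\<lambda>t. u (1 - t))"
        using continuous_on_compose2[OF \<theta> rev] continuous_on_compose2[OF u rev] by blast+
      show "cyl_proj (\<theta> (1 - t)) (u (1 - t)) \<in> path_image \<gamma>" if "t \<in> {0..1}" for t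
        using image[of "1 - t"] that by simp
    qed (use m False \<open>m \<noteq> 0\<close> in auto)
  qed
qed

text \<open>At the integers the jump of the floor is compensated by \<open>f 1 = f 0 + d\<close>, so
  the pieces over closed unit intervals can be glued.\<close>

lemma continuous_periodic_extension:
  fixes f :: "real \<Rightarrow> real"
  assumes "continuous_on {0..1} f" "f 1 = f 0 + d"
  shows "continuous_on UNIV (\<lambda>t. f (t - of_int \<lfloor>t\<rfloor>) + of_int \<lfloor>t\<rfloor> * d)"
proof -
  let ?F = "\<lambda>t. f (t - of_int \<lfloor>t\<rfloor>) + of_int \<lfloor>t\<rfloor> * d"
  have piece: "continuous_on {of_int m..of_int m + 1} ?F" for m :: int
  proof -
    have sub: "(\<lambda>t. t - of_int m) ` {of_int m..of_int m + 1} \<subseteq> {0..1::real}" by auto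
    have "continuous_on {of_int m..of_int m + 1} (\<lambda>t. f (t - of_int m) + of_int m * d)"
      by (intro continuous_intros continuous_on_compose2[OF assms(1) _ sub])
    moreover have "f (t - of_int m) + of_int m * d = ?F t" if "t \<in> {of_int m..of_int m + 1}" for t
    proof (cases "t = of_int m + 1")
      case True
      then show ?thesis using assms(2) by (simp add: algebra_simps)
    next
      case False
      then have "\<lfloor>t\<rfloor> = m" using that by (simp add: floor_unique)
      then show ?thesis by simp
    qed
    ultimately show ?thesis by (rule continuous_on_eq)
  qed
  have "isCont ?F t" for t
  proof -
    let ?m = "\<lfloor>t\<rfloor>"
    have "continuous_on ({of_int (?m - 1)..of_int (?m - 1) + 1} \<union> {of_int ?m..of_int ?m + 1}) ?F"
      by (intro continuous_on_closed_Un piece) auto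
    then have "continuous_on {of_int ?m - 1<..<of_int ?m + 1} ?F"
      by (rule continuous_on_subset) auto
    moreover have "t \<in> {of_int ?m - 1<..<of_int ?m + 1}"
      using floor_correct[of t] unfolding greaterThanLessThan_iff by linarith
    ultimately show ?thesis by (simp add: continuous_on_eq_continuous_at)
  qed
  then show ?thesis by (simp add: continuous_at_imp_continuous_on)
qed

text \<open>The second conjunct controls the growth. It is a disjunction because members of
  \<open>periodic_equilibria\<close> are not assumed to be Birkhoff: a periodic \<open>y\<close> may
  violate \<open>width\<close>, but its distance to a line is bounded by periodicity.\<close>

definition advances :: "int \<Rightarrow> int \<Rightarrow> configuration \<Rightarrow> bool" where
  "advances p q y \<longleftrightarrow> (\<forall>n. y n + of_int p \<le> y (n + q)) \<and> (of_type p q y \<or> width (of_int p / of_int q) y)"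

lemma advances_translate: "advances p q y \<Longrightarrow> advances p q (translate a b y)"
  unfolding advances_def
proof (intro conjI allI)
  fix n
  assume y: "(\<forall>n. y n + of_int p \<le> y (n + q)) \<and> (of_type p q y \<or> width (of_int p / of_int q) y)"
  then have "y (n - a) + of_int p \<le> y (n - a + q)" by blast
  then show "translate a b y n + of_int p \<le> translate a b y (n + q)"
    by (simp add: translate_def algebra_simps)
  show "of_type p q (translate a b y) \<or> width (of_int p / of_int q) (translate a b y)"
    using y of_type_translate width_translate by blast
qed

lemma advances_upper:
  assumes "advances p q y" "q > 0" "n \<ge> 0"
  shows "y n \<le> (\<Sum>j\<in>{0..<q}. \<bar>y j\<bar>) + \<bar>of_int p\<bar> + 1 + of_int n * (of_int p / of_int q)"
proof (cases "of_type p q y")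
  case True
  from of_type_distance[OF this assms(2), of n] show ?thesis by linarith
next
  case False
  then have "width (of_int p / of_int q) y" using assms(1) by (simp add: advances_def)
  from widthD[OF this, of n 0]
  have "y n \<le> y 0 + 1 + of_int n * (of_int p / of_int q)" by simp
  moreover have "\<bar>y 0\<bar> \<le> (\<Sum>r\<in>{0..<q}. \<bar>y r\<bar>)"
    using assms(2) by (intro member_le_sum[of 0 "{0..<q}" "\<lambda>r. \<bar>y r\<bar>"]) auto
  ultimately show ?thesis by linarith
qed

section \<open>Equilibria as solutions of a second-order recursion\<close>

context twist
begin

text \<open>The twist condition makes each derivative injective in the other argument, with an
  inverse of Lipschitz constant \<open>1 / c\<close>; so the equilibrium equation can be solved for
  the next and for the previous site.\<close>

lemma D1_expand: "c * \<bar>y' - y\<bar> \<le> \<bar>D1 h x y' - D1 h x y\<bar>"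
  using D1_twist[of y y' x] D1_twist[of y' y x] by (cases "y \<le> y'") (auto simp: algebra_simps abs_if)

lemma D2_expand: "c * \<bar>x' - x\<bar> \<le> \<bar>D2 h x' y - D2 h x y\<bar>"
  using D2_twist[of x x' y] D2_twist[of x' x y] by (cases "x \<le> x'") (auto simp: algebra_simps abs_if)

lemma expand_tendsto:
  assumes "\<And>k. c * \<bar>g k - g0\<bar> \<le> \<bar>A k - B k\<bar>" "(A \<longlongrightarrow> l) G" "(B \<longlongrightarrow> l) G"
  shows "(g \<longlongrightarrow> g0) G"
proof -
  have "((\<lambda>k. \<bar>A k - B k\<bar> / c) \<longlongrightarrow> \<bar>l - l\<bar> / c) G"
    using c_pos by (intro tendsto_intros assms) simp
  then have lim: "((\<lambda>k. \<bar>A k - B k\<bar> / c) \<longlongrightarrow> 0) G" by simp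
  have "norm (g k - g0) \<le> \<bar>A k - B k\<bar> / c" for k
    using assms(1)[of k] c_pos by (simp add: field_simps)
  then have "((\<lambda>k. g k - g0) \<longlongrightarrow> 0) G"
    by (intro Lim_null_comparison[OF _ lim] always_eventually allI)
  then show ?thesis by (simp add: LIM_zero_iff)
qed

lemma D1_inverse_tendsto:
  assumes "(f \<longlongrightarrow> f0) G" "((\<lambda>k. D1 h (f k) (g k)) \<longlongrightarrow> D1 h f0 g0) G"
  shows "(g \<longlongrightarrow> g0) G"
  by (rule expand_tendsto[OF D1_expand assms(2) D1_tendsto[OF assms(1) tendsto_const]])

lemma D2_inverse_tendsto:
  assumes "(f \<longlongrightarrow> f0) G" "((\<lambda>k. D2 h (g k) (f k)) \<longlongrightarrow> D2 h g0 f0) G"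
  shows "(g \<longlongrightarrow> g0) G"
  by (rule expand_tendsto[OF D2_expand assms(2) D2_tendsto[OF tendsto_const assms(1)]])

lemma D1_inj: "D1 h x y = D1 h x y' \<Longrightarrow> y = y'"
  using D1_expand[of y y' x] c_pos by (simp add: mult_le_0_iff)

lemma D2_inj: "D2 h x y = D2 h x' y \<Longrightarrow> x = x'"
  using D2_expand[of x x' y] c_pos by (simp add: mult_le_0_iff)

lemma equilibrium_next:
  "equilibrium h F x \<Longrightarrow> D1 h (x (n + 1)) (x (n + 1 + 1)) = F - D2 h (x n) (x (n + 1))"
  unfolding equilibrium_def by (drule spec[of _ "n + 1"]) simp

lemma equilibrium_prev:
  "equilibrium h F x \<Longrightarrow> D2 h (x (n - 1)) (x n) = F - D1 h (x n) (x (n + 1))"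
  unfolding equilibrium_def by (drule spec[of _ n]) simp

text \<open>Position and momentum at site 0 are the initial data of a recursion that runs in both
  directions.\<close>

lemma equilibrium_unique:
  assumes "equilibrium h F x" "equilibrium h F y" "x 0 = y 0" "D1 h (x 0) (x 1) = D1 h (y 0) (y 1)"
  shows "x = y"
proof
  fix n
  have "x n = y n \<and> x (n + 1) = y (n + 1)"
  proof (induction n rule: int_induct[of _ 0])
    case base
    then show ?case using assms(3,4) D1_inj[of "x 0" "x 1" "y 1"] by simp
  next
    case (step1 i)
    then have "D1 h (x (i + 1)) (x (i + 1 + 1)) = D1 h (x (i + 1)) (y (i + 1 + 1))"
      using equilibrium_next[OF assms(1), of i] equilibrium_next[OF assms(2), of i] by simp
    from D1_inj[OF this] step1 show ?case by simp
  next
    case (step2 i)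
    then have "D2 h (x (i - 1)) (x i) = D2 h (y (i - 1)) (x i)"
      using equilibrium_prev[OF assms(1), of i] equilibrium_prev[OF assms(2), of i] by simp
    from D2_inj[OF this] step2 show ?case by simp
  qed
  then show "x n = y n" by simp
qed

lemma equilibria_continuous:
  assumes "\<And>t. t \<in> S \<Longrightarrow> equilibrium h F (X t)" "continuous_on S (\<lambda>t. X t 0)"
    "continuous_on S (\<lambda>t. D1 h (X t 0) (X t 1))"
  shows "continuous_on S (\<lambda>t. X t n)"
proof -
  have "continuous_on S (\<lambda>t. X t n) \<and> continuous_on S (\<lambda>t. X t (n + 1))"
  proof (induction n rule: int_induct[of _ 0])
    case base
    have "continuous_on S (\<lambda>t. X t 1)"
      unfolding continuous_on_def
    proof
      fix s assume "s \<in> S"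
      with assms(2,3) have "((\<lambda>t. X t 0) \<longlongrightarrow> X s 0) (at s within S)"
        "((\<lambda>t. D1 h (X t 0) (X t 1)) \<longlongrightarrow> D1 h (X s 0) (X s 1)) (at s within S)"
        by (simp_all add: continuous_on_def)
      then show "((\<lambda>t. X t 1) \<longlongrightarrow> X s 1) (at s within S)" by (rule D1_inverse_tendsto)
    qed
    then show ?case using assms(2) by simp
  next
    case (step1 i)
    have "continuous_on S (\<lambda>t. X t (i + 1 + 1))"
      unfolding continuous_on_def
    proof
      fix s assume s: "s \<in> S"
      with step1 have lim: "((\<lambda>t. X t i) \<longlongrightarrow> X s i) (at s within S)"
        "((\<lambda>t. X t (i + 1)) \<longlongrightarrow> X s (i + 1)) (at s within S)"
        by (simp_all add: continuous_on_def)
      have "((\<lambda>t. F - D2 h (X t i) (X t (i + 1))) \<longlongrightarrow> F - D2 h (X s i) (X s (i + 1))) (at s within S)"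
        by (intro tendsto_intros D2_tendsto lim)
      moreover have "\<forall>\<^sub>F t in at s within S. F - D2 h (X t i) (X t (i + 1)) = D1 h (X t (i + 1)) (X t (i + 1 + 1))"
        unfolding eventually_at_filter by (intro always_eventually allI impI equilibrium_next[OF assms(1), symmetric])
      ultimately have "((\<lambda>t. D1 h (X t (i + 1)) (X t (i + 1 + 1))) \<longlongrightarrow> D1 h (X s (i + 1)) (X s (i + 1 + 1))) (at s within S)"
        unfolding equilibrium_next[OF assms(1)[OF s]] by (rule Lim_transform_eventually)
      with lim(2) show "((\<lambda>t. X t (i + 1 + 1)) \<longlongrightarrow> X s (i + 1 + 1)) (at s within S)" by (rule D1_inverse_tendsto)
    qed
    then show ?case using step1 by simp
  next
    case (step2 i)
    have "continuous_on S (\<lambda>t. X t (i - 1))"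
      unfolding continuous_on_def
    proof
      fix s assume s: "s \<in> S"
      with step2 have lim: "((\<lambda>t. X t i) \<longlongrightarrow> X s i) (at s within S)"
        "((\<lambda>t. X t (i + 1)) \<longlongrightarrow> X s (i + 1)) (at s within S)"
        by (simp_all add: continuous_on_def)
      have "((\<lambda>t. F - D1 h (X t i) (X t (i + 1))) \<longlongrightarrow> F - D1 h (X s i) (X s (i + 1))) (at s within S)"
        by (intro tendsto_intros D1_tendsto lim)
      moreover have "\<forall>\<^sub>F t in at s within S. F - D1 h (X t i) (X t (i + 1)) = D2 h (X t (i - 1)) (X t i)"
        unfolding eventually_at_filter by (intro always_eventually allI impI equilibrium_prev[OF assms(1), symmetric])
      ultimately have "((\<lambda>t. D2 h (X t (i - 1)) (X t i)) \<longlongrightarrow> D2 h (X s (i - 1)) (X s i)) (at s within S)"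
        unfolding equilibrium_prev[OF assms(1)[OF s]] by (rule Lim_transform_eventually)
      with lim(1) show "((\<lambda>t. X t (i - 1)) \<longlongrightarrow> X s (i - 1)) (at s within S)" by (rule D2_inverse_tendsto)
    qed
    then show ?case using step2 by simp
  qed
  then show ?thesis ..
qed

text \<open>Every point of the lifted circle lies on the orbit of a member of \<open>S\<close>, and
  a translation brings it to site 0. The selection is arbitrary, yet position and momentum determine
  the equilibrium, so the selected family is continuous and closes up after one turn.
  \<open>R\<close> is a parameter so that both orientations can use the lemma.\<close>

lemma circle_family:
  assumes circle: "rotational_invariant_circle h C" and C: "C = (\<Union>y\<in>S. orbit_of h y)"
    and S: "\<And>y. y \<in> S \<Longrightarrow> equilibrium h 0 y" "\<And>y. y \<in> S \<Longrightarrow> R y"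
    and R: "\<And>y a b. R y \<Longrightarrow> R (translate a b y)"
  obtains x :: "real \<Rightarrow> configuration" and d :: int where "d > 0" "\<And>n. continuous_on UNIV (\<lambda>t. x t n)"
    "\<And>t n. x (t + 1) n = x t n + of_int d" "\<And>t. equilibrium h 0 (x t)" "\<And>t. R (x t)"
proof -
  obtain \<gamma> where \<gamma>: "simple_path \<gamma>" "pathfinish \<gamma> = pathstart \<gamma>" "path_image \<gamma> = C" "C \<subseteq> cylinder"
    "\<not> (\<exists>a. homotopic_loops cylinder \<gamma> (linepath a a))"
    using circle unfolding rotational_invariant_circle_def by blast
  obtain \<theta> u :: "real \<Rightarrow> real" and d :: int where lift: "continuous_on {0..1} \<theta>" "continuous_on {0..1} u"
    "\<And>t. t \<in> {0..1} \<Longrightarrow> cyl_proj (\<theta> t) (u t) \<in> path_image \<gamma>"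
    "\<theta> 1 = \<theta> 0 + of_int d" "d > 0" "u 1 = u 0"
    by (rule lift_cylinder_loop[OF simple_path_imp_path[OF \<gamma>(1)] _ \<gamma>(2) \<gamma>(5)]) (use \<gamma>(3,4) in blast)+
  have "\<exists>z. equilibrium h 0 z \<and> R z \<and> z 0 = \<theta> t \<and> - D1 h (z 0) (z 1) = u t" if t: "t \<in> {0..1}" for t
  proof -
    obtain y n where y: "y \<in> S" "cyl_proj (\<theta> t) (u t) = cyl_proj (y n) (- D1 h (y n) (y (n + 1)))"
      using lift(3)[OF t] unfolding \<gamma>(3) C orbit_of_def by blast
    then obtain m :: int where m: "\<theta> t = y n + of_int m" "u t = - D1 h (y n) (y (n + 1))"
      unfolding cyl_proj_eq_iff by blast
    let ?z = "translate (- n) m y"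
    have "?z 0 = y n + of_int m" "?z 1 = y (n + 1) + of_int m"
      by (simp_all add: translate_def add.commute)
    then show ?thesis
      using equilibrium_translate[OF S(1)[OF y(1)]] R[OF S(2)[OF y(1)]] m
      by (intro exI[of _ ?z]) (simp add: D1_periodic)
  qed
  then obtain X where X: "\<And>t. t \<in> {0..1} \<Longrightarrow> equilibrium h 0 (X t)" "\<And>t. t \<in> {0..1} \<Longrightarrow> R (X t)"
    "\<And>t. t \<in> {0..1} \<Longrightarrow> X t 0 = \<theta> t" "\<And>t. t \<in> {0..1} \<Longrightarrow> - D1 h (X t 0) (X t 1) = u t"
    by metis
  have c0: "continuous_on {0..1} (\<lambda>t. X t 0)"
    using lift(1) by (rule continuous_on_eq) (simp add: X(3))
  have c1: "continuous_on {0..1} (\<lambda>t. D1 h (X t 0) (X t 1))"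
    using continuous_on_minus[OF lift(2)] by (rule continuous_on_eq) (simp add: X(4)[symmetric])
  have cont: "continuous_on {0..1} (\<lambda>t. X t n)" for n
    by (rule equilibria_continuous[OF _ c0 c1]) (rule X(1))
  have X1: "X 1 = translate 0 d (X 0)"
  proof (rule equilibrium_unique)
    show "equilibrium h 0 (X 1)" "equilibrium h 0 (translate 0 d (X 0))"
      using X(1)[of 1] equilibrium_translate[OF X(1)[of 0]] by simp_all
    show "X 1 0 = translate 0 d (X 0) 0" using X(3)[of 0] X(3)[of 1] lift(4) by (simp add: translate_def)
    have "D1 h (X 1 0) (X 1 1) = D1 h (X 0 0) (X 0 1)"
      using X(4)[of 0] X(4)[of 1] lift(6) by simp
    then show "D1 h (X 1 0) (X 1 1) = D1 h (translate 0 d (X 0) 0) (translate 0 d (X 0) 1)"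
      by (simp add: translate_def D1_periodic)
  qed
  define x where "x = (\<lambda>t. translate 0 (\<lfloor>t\<rfloor> * d) (X (t - of_int \<lfloor>t\<rfloor>)))"
  have fr: "t - of_int \<lfloor>t\<rfloor> \<in> {0..1}" for t :: real using floor_correct[of t] by simp linarith
  show ?thesis
  proof (rule that[OF lift(5)])
    show "continuous_on UNIV (\<lambda>t. x t n)" for n
      using continuous_periodic_extension[OF cont[of n], of "of_int d"] X1
      by (simp add: x_def translate_def)
    show "x (t + 1) n = x t n + of_int d" for t n
      by (simp add: x_def translate_def algebra_simps)
    show "equilibrium h 0 (x t)" for t
      unfolding x_def by (rule equilibrium_translate[OF X(1)[OF fr]])
    show "R (x t)" for t
      unfolding x_def by (rule R[OF X(2)[OF fr]])
  qed
qed

lemma family_depinning: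
  fixes x :: "real \<Rightarrow> configuration"
  assumes "q > 0" "d > 0" "\<And>n. continuous_on UNIV (\<lambda>t. x t n)" "\<And>t n. x (t + 1) n = x t n + of_int d"
    "\<And>t. equilibrium h 0 (x t)" "\<And>t. advances p q (x t)"
  shows "(depinning_force h \<longlongrightarrow> 0) (at_right (of_int p / of_int q))"
proof -
  have "continuous_on {0..1} (\<lambda>t. \<Sum>j\<in>{0..<q}. \<bar>x t j\<bar>)"
    by (intro continuous_intros continuous_on_subset[OF assms(3)]) auto
  then have "bounded ((\<lambda>t. \<Sum>j\<in>{0..<q}. \<bar>x t j\<bar>) ` {0..1})"
    by (intro compact_imp_bounded compact_continuous_image) auto
  then obtain M where "\<forall>t\<in>{0..1}. \<bar>\<Sum>j\<in>{0..<q}. \<bar>x t j\<bar>\<bar> \<le> M"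
    unfolding bounded_iff by auto
  then have M: "\<And>t. t \<in> {0..1} \<Longrightarrow> \<bar>\<Sum>j\<in>{0..<q}. \<bar>x t j\<bar>\<bar> \<le> M" by blast
  have "x t n \<le> (M + \<bar>of_int p\<bar> + 1) + of_int n * (of_int p / of_int q)" if "t \<in> {0..1}" "n \<ge> 0" for t n
    using advances_upper[OF assms(6) assms(1) that(2), of t] M[OF that(1)] by linarith
  then have upper: "\<exists>B. \<forall>t\<in>{0..1}. \<forall>n\<ge>0. x t n \<le> B + of_int n * (of_int p / of_int q)" by blast
  interpret equilibrium_family h c p q d x
    by unfold_locales (use assms upper in \<open>simp_all add: advances_def\<close>)
  show ?thesis by (rule depinning_force_tendsto)
qed

end

section \<open>Families of sliding configurations\<close>

text \<open>The upper limit, written as the infimum of all eventual upper bounds. It is applied to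
  eventually bounded sequences, for which this set is nonempty and bounded below.\<close>

definition lsup :: "(nat \<Rightarrow> real) \<Rightarrow> real" where
  "lsup f = Inf {v. \<forall>\<^sub>F j in sequentially. f j \<le> v}"

lemma lsup_bounds:
  fixes f :: "nat \<Rightarrow> real"
  assumes "\<forall>\<^sub>F j in sequentially. \<bar>f j\<bar> \<le> B"
  shows "B \<in> {v. \<forall>\<^sub>F j in sequentially. f j \<le> v}" "bdd_below {v. \<forall>\<^sub>F j in sequentially. f j \<le> v}"
proof -
  show "B \<in> {v. \<forall>\<^sub>F j in sequentially. f j \<le> v}"
    by (rule CollectI, rule eventually_mono[OF assms]) (rule abs_le_D1)
  show "bdd_below {v. \<forall>\<^sub>F j in sequentially. f j \<le> v}"
  proof (rule bdd_belowI[of _ "- B"])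
    fix v assume "v \<in> {v. \<forall>\<^sub>F j in sequentially. f j \<le> v}"
    then have "\<forall>\<^sub>F j in sequentially. f j \<le> v" by simp
    with assms have "\<forall>\<^sub>F j in sequentially. - B \<le> v" by eventually_elim linarith
    then show "- B \<le> v" by simp
  qed
qed

lemma lsup_less:
  assumes "\<forall>\<^sub>F j in sequentially. \<bar>f j\<bar> \<le> B" "lsup f < v"
  shows "\<forall>\<^sub>F j in sequentially. f j < v"
proof -
  obtain u where u: "\<forall>\<^sub>F j in sequentially. f j \<le> u" "u < v"
    using cInf_lessD[of "{v. \<forall>\<^sub>F j in sequentially. f j \<le> v}" v] lsup_bounds(1)[OF assms(1)] assms(2)
    unfolding lsup_def by blast
  show ?thesis by (rule eventually_mono[OF u(1)]) (use u(2) in linarith)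
qed

lemma less_lsup:
  assumes "\<forall>\<^sub>F j in sequentially. \<bar>f j\<bar> \<le> B" "v < lsup f"
  shows "\<not> (\<forall>\<^sub>F j in sequentially. f j \<le> v)"
proof
  assume "\<forall>\<^sub>F j in sequentially. f j \<le> v"
  then have "lsup f \<le> v" unfolding lsup_def by (intro cInf_lower lsup_bounds(2)[OF assms(1)]) simp
  with assms(2) show False by simp
qed

lemma lsup_mono:
  assumes "\<forall>\<^sub>F j in sequentially. \<bar>f j\<bar> \<le> B" "\<forall>\<^sub>F j in sequentially. \<bar>g j\<bar> \<le> B'"
    "\<forall>\<^sub>F j in sequentially. f j \<le> g j + e"
  shows "lsup f \<le> lsup g + e"
proof -
  have "lsup f - e \<le> lsup g"
    unfolding lsup_def[of g]
  proof (rule cInf_greatest)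
    show "{v. \<forall>\<^sub>F j in sequentially. g j \<le> v} \<noteq> {}" using lsup_bounds(1)[OF assms(2)] by blast
    fix v assume "v \<in> {v. \<forall>\<^sub>F j in sequentially. g j \<le> v}"
    then have "\<forall>\<^sub>F j in sequentially. g j \<le> v" by simp
    with assms(3) have "\<forall>\<^sub>F j in sequentially. f j \<le> v + e" by eventually_elim simp
    then have "lsup f \<le> v + e" unfolding lsup_def by (intro cInf_lower lsup_bounds(2)[OF assms(1)]) simp
    then show "lsup f - e \<le> v" by simp
  qed
  then show ?thesis by simp
qed

lemma lsup_shift:
  assumes "\<forall>\<^sub>F j in sequentially. \<bar>f j\<bar> \<le> B" "\<forall>\<^sub>F j in sequentially. \<bar>g j\<bar> \<le> B'"
    "\<forall>\<^sub>F j in sequentially. f j = g j + e"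
  shows "lsup f = lsup g + e"
proof (rule antisym)
  show "lsup f \<le> lsup g + e"
    by (rule lsup_mono[OF assms(1,2)]) (rule eventually_mono[OF assms(3)], simp)
  have "lsup g \<le> lsup f + (- e)"
    by (rule lsup_mono[OF assms(2,1)]) (rule eventually_mono[OF assms(3)], simp)
  then show "lsup g + e \<le> lsup f" by simp
qed

lemma lsup_Suc: "lsup (\<lambda>j. f (Suc j)) = lsup f"
  unfolding lsup_def eventually_sequentially_Suc[of "\<lambda>j. f j \<le> v" for v] ..

section \<open>Ordered periodic configurations parametrised by their mean\<close>

context bezout_type
begin

text \<open>This is \<open>q\<close> times the average over a period; with this normalisation the
  generator raises it by exactly 1.\<close>

definition mean :: "configuration \<Rightarrow> real" where
  "mean x = (\<Sum>n\<in>{0..<q}. x n)"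

lemma mean_translate:
  assumes "of_type p q x"
  shows "mean (translate a b x) = mean x + of_int (b * q - a * p)"
proof -
  have "(\<Sum>n\<in>{0..<q}. x (n + k)) = mean x + of_int (k * p)" for k
  proof (induction k rule: int_induct[of _ 0])
    case base then show ?case by (simp add: mean_def)
  next
    case (step1 k)
    have "(\<Sum>n\<in>{0..<q}. x (n + 1 + k)) = (\<Sum>n\<in>{0..<q}. x (n + k)) + of_int p"
    proof (rule sum_period_shift[OF q_pos, where f = "\<lambda>n. x (n + k)"])
      fix n
      show "x (n + q + k) = x (n + k) + of_int p"
        using assms[unfolded of_type_iff, rule_format, of "n + k"] by (simp add: algebra_simps)
    qed
    with step1 show ?case by (simp add: algebra_simps)
  next
    case (step2 k)
    have "(\<Sum>n\<in>{0..<q}. x (n + 1 + (k - 1))) = (\<Sum>n\<in>{0..<q}. x (n + (k - 1))) + of_int p"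
    proof (rule sum_period_shift[OF q_pos, where f = "\<lambda>n. x (n + (k - 1))"])
      fix n
      show "x (n + q + (k - 1)) = x (n + (k - 1)) + of_int p"
        using assms[unfolded of_type_iff, rule_format, of "n + (k - 1)"] by (simp add: algebra_simps)
    qed
    with step2 show ?case by (simp add: algebra_simps)
  qed
  from this[of "- a"] show ?thesis
    using q_pos by (simp add: mean_def translate_def sum.distrib)
qed

text \<open>All sites of an ordered pair differ in the same direction, so one site differs by at
  most the sum. A chain parametrised by \<open>mean\<close> is thus Lipschitz with constant 1 at
  every site.\<close>

lemma mean_diff:
  assumes "of_type p q x" "of_type p q y" "x \<le> y"
  shows "y n - x n \<le> mean y - mean x"
proof -
  let ?r = "n mod q"
  have "y n - x n = y ?r - x ?r"
    unfolding of_type_residue[OF assms(1), of n] of_type_residue[OF assms(2), of n] by simp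
  also have "\<dots> \<le> (\<Sum>r\<in>{0..<q}. y r - x r)"
    using q_pos le_funD[OF assms(3)] by (intro member_le_sum) auto
  finally show ?thesis by (simp add: mean_def sum_subtractf)
qed

lemma mean_mono: "x \<le> y \<Longrightarrow> mean x \<le> mean y"
  unfolding mean_def by (rule sum_mono) (rule le_funD)

lemma mean_tendsto:
  assumes "\<And>n. ((\<lambda>k. X k n) \<longlongrightarrow> x n) G"
  shows "((\<lambda>k. mean (X k)) \<longlongrightarrow> mean x) G"
  unfolding mean_def by (intro tendsto_sum assms)

lemma mean_bound:
  obtains K where "\<And>x. rising x \<Longrightarrow> \<bar>x n\<bar> \<le> \<bar>mean x\<bar> + K"
proof -
  define K where "K = (\<Sum>m\<in>{0..<q}. of_int \<bar>m - n\<bar> * \<bar>of_int p / of_int q\<bar> + (1::real))"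
  have "\<bar>x n\<bar> \<le> \<bar>mean x\<bar> + K" if "rising x" for x
  proof -
    have "\<bar>\<Sum>m\<in>{0..<q}. x m - x n\<bar> \<le> K"
      unfolding K_def by (intro order_trans[OF sum_abs] sum_mono width_bound rising_width that)
    moreover have "(\<Sum>m\<in>{0..<q}. x m - x n) = mean x - of_int q * x n"
      using q_pos by (simp add: mean_def sum_subtractf)
    moreover have "1 * \<bar>x n\<bar> \<le> of_int q * \<bar>x n\<bar>" using q_pos by (intro mult_right_mono) auto
    moreover have "of_int q * \<bar>x n\<bar> = \<bar>of_int q * x n\<bar>" using q_pos by (simp add: abs_mult)
    ultimately show ?thesis by linarith
  qed
  then show ?thesis by (rule that)
qed

end

locale sliding = twist_type +
  fixes F :: real
  assumes F_nonneg: "0 \<le> F" and unpinned: "\<And>x. rising x \<Longrightarrow> \<not> equilibrium h F x"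
begin

definition subsol :: "configuration \<Rightarrow> bool" where
  "subsol x \<longleftrightarrow> rising x \<and> (\<forall>n. force h x n \<le> F)"

lemma subsol_limit:
  assumes "G \<noteq> bot" "\<And>n. ((\<lambda>k. X k n) \<longlongrightarrow> x n) G" "\<And>k. subsol (X k)"
  shows "subsol x"
  unfolding subsol_def
proof (intro conjI allI)
  show "rising x" by (rule rising_limit[OF assms(1,2)]) (use assms(3) in \<open>simp add: subsol_def\<close>)
  show "force h x n \<le> F" for n
    by (rule tendsto_upperbound[OF force_tendsto[OF assms(2)] _ assms(1)]) (use assms(3) in \<open>simp add: subsol_def\<close>)
qed

text \<open>Maximal chains of subsolutions whose means form an interval starting at a fixed one: as no
  equilibrium stops \<open>flow\<close>, such a chain can always be prolonged.\<close>

lemma sliding_path: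
  obtains X \<mu>0 where "\<And>\<mu>. \<mu> \<ge> \<mu>0 \<Longrightarrow> subsol (X \<mu>)" "\<And>\<mu>. \<mu> \<ge> \<mu>0 \<Longrightarrow> mean (X \<mu>) = \<mu>"
    "\<And>\<mu> \<nu>. \<mu>0 \<le> \<mu> \<Longrightarrow> \<mu> \<le> \<nu> \<Longrightarrow> X \<mu> \<le> X \<nu>"
proof -
  obtain x0 where x0: "rising x0" "equilibrium h 0 x0" by (rule rising_equilibrium)
  then have S0: "subsol x0" using F_nonneg by (simp add: subsol_def equilibrium_iff)
  \<comment> \<open>Connectedness of the set of means excludes gaps, so a chain with unbounded means
    has a member for every mean from \<open>mean x0\<close> on.\<close>
  define \<A> where "\<A> = {A. (\<forall>x\<in>A. subsol x \<and> x0 \<le> x) \<and> x0 \<in> A \<and>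
    (\<forall>x\<in>A. \<forall>y\<in>A. x \<le> y \<or> y \<le> x) \<and> connected (mean ` A)}"
  have "{x0} \<in> \<A>" using S0 by (simp add: \<A>_def)
  then have "\<A> \<noteq> {}" by blast
  moreover have "\<Union>\<C> \<in> \<A>" if "\<C> \<noteq> {}" "subset.chain \<A> \<C>" for \<C>
  proof -
    have sub: "\<C> \<subseteq> \<A>" and ch: "\<And>X Y. X \<in> \<C> \<Longrightarrow> Y \<in> \<C> \<Longrightarrow> X \<subseteq> Y \<or> Y \<subseteq> X"
      using that(2) by (auto simp: subset_chain_def)
    have "connected (\<Union>((`) mean ` \<C>))"
    proof (rule connected_Union)
      show "connected A" if "A \<in> (`) mean ` \<C>" for A using that sub by (auto simp: \<A>_def)
      have "mean x0 \<in> \<Inter>((`) mean ` \<C>)" using sub by (auto simp: \<A>_def)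
      then show "\<Inter>((`) mean ` \<C>) \<noteq> {}" by blast
    qed
    then have "connected (mean ` \<Union>\<C>)" by (simp add: image_Union)
    moreover have "x \<le> y \<or> y \<le> x" if xy: "x \<in> \<Union>\<C>" "y \<in> \<Union>\<C>" for x y
    proof -
      obtain A B where "A \<in> \<C>" "x \<in> A" "B \<in> \<C>" "y \<in> B" using xy by blast
      then obtain D where "D \<in> \<C>" "x \<in> D" "y \<in> D" using ch[of A B] by blast
      then show ?thesis using sub by (auto simp: \<A>_def)
    qed
    moreover have "x0 \<in> \<Union>\<C>" using sub that(1) by (auto simp: \<A>_def)
    moreover have "subsol x \<and> x0 \<le> x" if "x \<in> \<Union>\<C>" for x using sub that by (auto simp: \<A>_def)
    ultimately show ?thesis unfolding \<A>_def by blast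
  qed
  ultimately obtain A where A: "A \<in> \<A>" and max: "\<And>X. X \<in> \<A> \<Longrightarrow> A \<subseteq> X \<Longrightarrow> X = A"
    using subset_Zorn_nonempty[of \<A>] by blast
  have subA: "\<And>x. x \<in> A \<Longrightarrow> subsol x" "\<And>x. x \<in> A \<Longrightarrow> x0 \<le> x" "x0 \<in> A"
    and chA: "\<And>x y. x \<in> A \<Longrightarrow> y \<in> A \<Longrightarrow> x \<le> y \<or> y \<le> x" and conA: "connected (mean ` A)"
    using A by (auto simp: \<A>_def)
  have ty: "of_type p q x" if "subsol x" for x using that by (simp add: subsol_def rising_def)
  have "\<not> bdd_above (mean ` A)"
  proof
    assume bdd: "bdd_above (mean ` A)"
    define B where "B = Sup (mean ` A)"
    have mB: "mean x \<le> B" if "x \<in> A" for x unfolding B_def using that by (intro cSup_upper bdd) auto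
    have ne: "mean ` A \<noteq> {}" using subA(3) by blast
    \<comment> \<open>The supremum of a maximal chain with bounded means. By
      \<open>mean_diff\<close> it is a uniform limit of members, hence a subsolution of mean
      \<open>B\<close>; it can be added to the chain and so belongs to it.\<close>
    define s where "s = (\<lambda>n. SUP x\<in>A. x n)"
    have bddn: "bdd_above ((\<lambda>x. x n) ` A)" for n
    proof (rule bdd_aboveI2)
      fix x assume x: "x \<in> A"
      show "x n \<le> x0 n + (B - mean x0)"
        using mean_diff[OF ty[OF S0] ty[OF subA(1)[OF x]] subA(2)[OF x], of n] mB[OF x] by simp
    qed
    have le_s: "x \<le> s" if "x \<in> A" for x
      unfolding le_fun_def s_def using that by (auto intro!: cSUP_upper bddn)
    have s_le: "s n \<le> x n + e" if x: "x \<in> A" "B - e < mean x" for x e n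
      unfolding s_def
    proof (rule cSUP_least)
      fix y assume y: "y \<in> A"
      show "y n \<le> x n + e"
        using chA[OF x(1) y]
      proof
        assume "x \<le> y"
        then show ?thesis using mean_diff[OF ty[OF subA(1)[OF x(1)]] ty[OF subA(1)[OF y]], of n] mB[OF y] x(2) by simp
      next
        assume "y \<le> x"
        then show ?thesis using le_funD[of y x n] mB[OF x(1)] x(2) by simp
      qed
    qed (use subA(3) in blast)
    have "\<exists>x\<in>A. B - 1 / (real k + 1) < mean x" for k
      using less_cSupD[OF ne, of "B - 1 / (real k + 1)"] unfolding B_def by auto
    then obtain Z where Z: "\<And>k::nat. Z k \<in> A" "\<And>k. B - 1 / (real k + 1) < mean (Z k)" by metis
    have limZ: "(\<lambda>k. Z k n) \<longlonglongrightarrow> s n" for n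
    proof -
      have "norm (Z k n - s n) \<le> 1 / (real k + 1)" for k
        using s_le[OF Z(1,2)[of k], of n] le_funD[OF le_s[OF Z(1)[of k]], of n] by simp
      then have "(\<lambda>k. Z k n - s n) \<longlonglongrightarrow> 0" by (intro Lim_null_comparison[OF _ inverse_Suc_tendsto] always_eventually allI)
      then show ?thesis by (simp add: LIM_zero_iff)
    qed
    have s: "subsol s" by (rule subsol_limit[of sequentially Z, OF _ limZ]) (simp_all add: subA(1) Z(1))
    have "(\<lambda>k. mean (Z k) - B) \<longlonglongrightarrow> 0"
    proof (rule Lim_null_comparison[OF _ inverse_Suc_tendsto], rule always_eventually, rule allI)
      fix k show "norm (mean (Z k) - B) \<le> 1 / (real k + 1)" using Z(2)[of k] mB[OF Z(1)[of k]] by simp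
    qed
    then have "(\<lambda>k. mean (Z k)) \<longlonglongrightarrow> B" by (simp add: LIM_zero_iff)
    then have ms: "mean s = B" using LIMSEQ_unique[OF mean_tendsto[OF limZ]] by simp
    have "connected (insert B (mean ` A))"
      by (rule connected_intermediate_closure[OF conA])
        (use closure_contains_Sup[OF ne bdd] closure_subset[of "mean ` A"] in \<open>auto simp: B_def\<close>)
    then have "insert s A \<in> \<A>"
      unfolding \<A>_def using subA chA s le_s ms by (auto intro: order_trans)
    from max[OF this] have sA: "s \<in> A" by blast
    have V: "0 \<le> F - force h s n" for n using s by (simp add: subsol_def)
    obtain n where n: "0 < F - force h s n"
    proof (rule ccontr)
      assume "\<not> thesis"
      then have "F - force h s n \<le> 0" for n using that by (meson not_le)
      then have "force h s n = F" for n using V[of n] by (simp add: antisym)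
      then have "equilibrium h F s" by (simp add: equilibrium_iff)
      then show False using unpinned s by (simp add: subsol_def)
    qed
    have "\<forall>\<^sub>F \<theta> in at_right 0. subsol (flow h F \<theta> s)"
      using flow_rising[of s F] flow_subsolution[OF ty[OF s], of F] s unfolding subsol_def by (simp add: eventually_conj)
    then obtain b where b: "b > 0" "\<And>\<theta>. 0 < \<theta> \<Longrightarrow> \<theta> < b \<Longrightarrow> subsol (flow h F \<theta> s)"
      unfolding eventually_at_right_field by blast
    \<comment> \<open>The Euler steps from \<open>s\<close> form a continuous ordered segment of
      subsolutions starting at \<open>s\<close>. The segment is proper because some site of
      \<open>s\<close> has force below \<open>F\<close>.\<close>
    define T where "T = (\<lambda>\<theta>. flow h F \<theta> s) ` {0..b/2}"
    have flow0: "flow h F 0 s = s" by (simp add: flow_def)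
    have subT: "subsol x" if xT: "x \<in> T" for x
    proof -
      obtain \<theta> where \<theta>: "\<theta> \<in> {0..b/2}" "x = flow h F \<theta> s" using xT by (auto simp: T_def)
      show ?thesis using b s flow0 \<theta> by (cases "\<theta> = 0") auto
    qed
    have flow_mono: "flow h F \<theta> s \<le> flow h F \<theta>' s" if "\<theta> \<le> \<theta>'" for \<theta> \<theta>'
      unfolding le_fun_def flow_def using that V by (auto intro!: mult_right_mono)
    have sT: "s \<le> x" if "x \<in> T" for x using that flow_mono[of 0] flow0 by (auto simp: T_def)
    have chT: "x \<le> y \<or> y \<le> x" if "x \<in> T" "y \<in> T" for x y
    proof -
      obtain \<theta> \<theta>' where "x = flow h F \<theta> s" "y = flow h F \<theta>' s" using \<open>x \<in> T\<close> \<open>y \<in> T\<close> by (auto simp: T_def)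
      then show ?thesis using flow_mono[of \<theta> \<theta>'] flow_mono[of \<theta>' \<theta>] by (cases "\<theta> \<le> \<theta>'") auto
    qed
    have "mean ` T = (\<lambda>\<theta>. mean (flow h F \<theta> s)) ` {0..b/2}" by (simp add: T_def image_image)
    moreover have "connected \<dots>"
      unfolding mean_def flow_def by (intro connected_continuous_image continuous_intros) auto
    ultimately have "connected (mean ` T)" by simp
    moreover have "s \<in> T" using b(1) flow0 by (auto simp: T_def image_iff intro: bexI[of _ 0])
    ultimately have "connected (mean ` A \<union> mean ` T)" using conA sA by (intro connected_Un) auto
    then have "connected (mean ` (A \<union> T))" by (simp add: image_Un)
    moreover have "x \<le> y \<or> y \<le> x" if "x \<in> A \<union> T" "y \<in> A \<union> T" for x y
      using that chA[of x y] chT[of x y] order_trans[OF le_s sT, of x y] order_trans[OF le_s sT, of y x] by blast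
    moreover have "subsol x \<and> x0 \<le> x" if "x \<in> A \<union> T" for x
      using that subA(1,2)[of x] subT[of x] order_trans[OF le_s[OF subA(3)] sT, of x] by blast
    ultimately have "A \<union> T \<in> \<A>" unfolding \<A>_def using subA(3) by blast
    from max[OF this] have "flow h F (b / 2) s \<in> A" using b(1) by (auto simp: T_def)
    from le_funD[OF le_s[OF this], of n] have "b / 2 * (F - force h s n) \<le> 0" by (simp add: flow_def)
    moreover have "0 < b / 2 * (F - force h s n)" by (rule mult_pos_pos) (use b(1) n in auto)
    ultimately show False by simp
  qed
  have "\<exists>x\<in>A. mean x = \<mu>" if "\<mu> \<ge> mean x0" for \<mu>
  proof -
    obtain y where y: "y \<in> A" "\<mu> < mean y"
      using \<open>\<not> bdd_above (mean ` A)\<close> by (auto simp: bdd_above_def not_le)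
    have "\<mu> \<in> mean ` A"
      by (rule connectedD_interval[OF conA, of "mean x0" "mean y"]) (use y subA(3) that in auto)
    then show ?thesis by blast
  qed
  then obtain X where X: "\<And>\<mu>. \<mu> \<ge> mean x0 \<Longrightarrow> X \<mu> \<in> A" "\<And>\<mu>. \<mu> \<ge> mean x0 \<Longrightarrow> mean (X \<mu>) = \<mu>" by metis
  show ?thesis
  proof (rule that[of "mean x0" X])
    show "subsol (X \<mu>)" "mean (X \<mu>) = \<mu>" if "\<mu> \<ge> mean x0" for \<mu> using X[OF that] subA(1) by auto
    show "X \<mu> \<le> X \<nu>" if \<mu>\<nu>: "mean x0 \<le> \<mu>" "\<mu> \<le> \<nu>" for \<mu> \<nu>
    proof -
      have \<nu>: "mean x0 \<le> \<nu>" using \<mu>\<nu> by simp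
      show ?thesis using chA[OF X(1)[OF \<mu>\<nu>(1)] X(1)[OF \<nu>]]
      proof
        assume "X \<nu> \<le> X \<mu>"
        from mean_mono[OF this] have "\<nu> \<le> \<mu>" using X(2)[OF \<mu>\<nu>(1)] X(2)[OF \<nu>] by simp
        then show ?thesis using \<mu>\<nu> by simp
      qed
    qed
  qed
qed

text \<open>The upper limit of the path along its own translates by \<open>(j \<alpha>, j \<beta>)\<close> is invariant under all
  translations.\<close>

lemma sliding_family:
  obtains w :: "real \<Rightarrow> configuration" where "\<And>\<tau>. rising (w \<tau>)" "\<And>\<tau> n. force h (w \<tau>) n \<le> F"
    "\<And>\<tau> \<tau>'. \<tau> \<le> \<tau>' \<Longrightarrow> w \<tau> \<le> w \<tau>'" "\<And>\<tau> \<tau>' n. \<tau> \<le> \<tau>' \<Longrightarrow> w \<tau>' n \<le> w \<tau> n + (\<tau>' - \<tau>)"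
    "\<And>a b \<tau>. translate a b (w \<tau>) = w (\<tau> + of_int (b * q - a * p))"
proof -
  obtain X \<mu>0 where X: "\<And>\<mu>. \<mu> \<ge> \<mu>0 \<Longrightarrow> subsol (X \<mu>)" "\<And>\<mu>. \<mu> \<ge> \<mu>0 \<Longrightarrow> mean (X \<mu>) = \<mu>"
    "\<And>\<mu> \<nu>. \<mu>0 \<le> \<mu> \<Longrightarrow> \<mu> \<le> \<nu> \<Longrightarrow> X \<mu> \<le> X \<nu>" by (rule sliding_path) blast
  \<comment> \<open>Going up by \<open>j\<close> in the mean and back by \<open>j\<close> generators
    leaves the mean at \<open>\<tau>\<close>. As \<open>j\<close> grows, the starting point of the
    path recedes to minus infinity, so that every real \<open>\<tau>\<close> is eventually
    allowed.\<close>
  define Y where "Y = (\<lambda>j::nat. \<lambda>\<tau>. translate (- int j * \<alpha>) (- int j * \<beta>) (X (\<tau> + real j)))"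
  have Y: "subsol (Y j \<tau>)" "mean (Y j \<tau>) = \<tau>" if "\<tau> + real j \<ge> \<mu>0" for j \<tau>
  proof -
    have S: "subsol (X (\<tau> + real j))" using X(1) that .
    then show "subsol (Y j \<tau>)"
      unfolding Y_def subsol_def by (simp add: rising_translate force_translate)
    have "of_type p q (X (\<tau> + real j))" using S by (simp add: subsol_def rising_def)
    then have "mean (Y j \<tau>) = \<tau> + real j + of_int (- int j * \<beta> * q - - int j * \<alpha> * p)"
      unfolding Y_def by (simp only: mean_translate X(2)[OF that])
    also have "- int j * \<beta> * q - - int j * \<alpha> * p = - int j * (\<beta> * q - \<alpha> * p)" by (simp add: algebra_simps)
    finally show "mean (Y j \<tau>) = \<tau>" by (simp add: bezout)
  qed
  have ev: "\<forall>\<^sub>F j in sequentially. \<tau> + real j \<ge> \<mu>0" for \<tau>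
    using eventually_ge_at_top[of "nat \<lceil>\<mu>0 - \<tau>\<rceil>"] by (rule eventually_mono) linarith
  have evS: "\<forall>\<^sub>F j in sequentially. subsol (Y j \<tau>) \<and> mean (Y j \<tau>) = \<tau>" for \<tau>
    using ev[of \<tau>] by (rule eventually_mono) (use Y in blast)
  have bd: "\<exists>B. \<forall>\<^sub>F j in sequentially. \<bar>Y j \<tau> n\<bar> \<le> B" for \<tau> n
  proof -
    obtain K where K: "\<And>x. rising x \<Longrightarrow> \<bar>x n\<bar> \<le> \<bar>mean x\<bar> + K" by (rule mean_bound[of n]) blast
    have "\<forall>\<^sub>F j in sequentially. \<bar>Y j \<tau> n\<bar> \<le> \<bar>\<tau>\<bar> + K"
      using evS[of \<tau>]
    proof eventually_elim
      case (elim j)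
      then show ?case using K[of "Y j \<tau>"] by (simp add: subsol_def)
    qed
    then show ?thesis by blast
  qed
  then obtain B where B: "\<And>\<tau> n. \<forall>\<^sub>F j in sequentially. \<bar>Y j \<tau> n\<bar> \<le> B \<tau> n" by metis
  define w where "w = (\<lambda>\<tau> n. lsup (\<lambda>j. Y j \<tau> n))"
  have mono: "w \<tau> \<le> w \<tau>'" if "\<tau> \<le> \<tau>'" for \<tau> \<tau>'
    unfolding le_fun_def
  proof
    fix n
    have "\<forall>\<^sub>F j in sequentially. Y j \<tau> n \<le> Y j \<tau>' n + 0"
      using ev[of \<tau>]
    proof eventually_elim
      case (elim j)
      then have "Y j \<tau> \<le> Y j \<tau>'" unfolding Y_def using X(3)[of "\<tau> + real j" "\<tau>' + real j"] that by simp
      then show ?case using le_funD by simp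
    qed
    from lsup_mono[OF B B this] show "w \<tau> n \<le> w \<tau>' n" by (simp add: w_def)
  qed
  have lip: "w \<tau>' n \<le> w \<tau> n + (\<tau>' - \<tau>)" if "\<tau> \<le> \<tau>'" for \<tau> \<tau>' n
  proof -
    have "\<forall>\<^sub>F j in sequentially. Y j \<tau>' n \<le> Y j \<tau> n + (\<tau>' - \<tau>)"
      using ev[of \<tau>] evS[of \<tau>] evS[of \<tau>']
    proof eventually_elim
      case (elim j)
      have "Y j \<tau> \<le> Y j \<tau>'" unfolding Y_def using X(3)[OF elim(1), of "\<tau>' + real j"] that by simp
      then show ?case using mean_diff[of "Y j \<tau>" "Y j \<tau>'" n] elim by (simp add: subsol_def rising_def)
    qed
    from lsup_mono[OF B B this] show ?thesis by (simp add: w_def)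
  qed
  have wty: "of_type p q (w \<tau>)" for \<tau>
    unfolding of_type_iff
  proof
    fix n
    have "\<forall>\<^sub>F j in sequentially. Y j \<tau> (n + q) = Y j \<tau> n + of_int p"
      using evS[of \<tau>] by (rule eventually_mono) (simp add: subsol_def rising_def of_type_iff)
    from lsup_shift[OF B B this] show "w \<tau> (n + q) = w \<tau> n + of_int p" by (simp add: w_def)
  qed
  \<comment> \<open>Up to the generator, the terms for \<open>\<tau> + 1\<close> are those for
    \<open>\<tau>\<close> with \<open>j\<close> advanced by one, and an upper limit ignores this
    shift.\<close>
  have gen: "translate \<alpha> \<beta> (w \<tau>) = w (\<tau> + 1)" for \<tau>
  proof
    fix n
    have eq: "Y j (\<tau> + 1) n = Y (Suc j) \<tau> (n - \<alpha>) + of_int \<beta>" for j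
      by (simp add: Y_def translate_def algebra_simps)
    have "w (\<tau> + 1) n = lsup (\<lambda>j. Y (Suc j) \<tau> (n - \<alpha>)) + of_int \<beta>"
      unfolding w_def
    proof (rule lsup_shift[OF B])
      show "\<forall>\<^sub>F j in sequentially. \<bar>Y (Suc j) \<tau> (n - \<alpha>)\<bar> \<le> B \<tau> (n - \<alpha>)"
        using B[of \<tau> "n - \<alpha>"] by (simp only: eventually_sequentially_Suc[of "\<lambda>j. \<bar>Y j \<tau> (n - \<alpha>)\<bar> \<le> B \<tau> (n - \<alpha>)"])
    qed (simp add: eq)
    also have "lsup (\<lambda>j. Y (Suc j) \<tau> (n - \<alpha>)) = w \<tau> (n - \<alpha>)"
      unfolding w_def by (rule lsup_Suc)
    finally show "translate \<alpha> \<beta> (w \<tau>) n = w (\<tau> + 1) n" by (simp add: translate_def)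
  qed
  have wris: "rising (w \<tau>)" for \<tau>
    unfolding rising_def gen using wty mono[of \<tau> "\<tau> + 1"] by simp
  have force: "force h (w \<tau>) n \<le> F" for \<tau> n
  proof (rule force_le_approx)
    fix k :: nat
    let ?e = "1 / (real k + 1)"
    have e: "?e > 0" by simp
    have up: "\<forall>\<^sub>F j in sequentially. Y j \<tau> m < w \<tau> m + ?e" for m
      by (rule lsup_less[OF B]) (use e in \<open>simp add: w_def\<close>)
    have nle: "\<not> (\<forall>\<^sub>F j in sequentially. Y j \<tau> n \<le> w \<tau> n - ?e)"
      by (rule less_lsup[OF B]) (use e in \<open>simp add: w_def\<close>)
    \<comment> \<open>One index must be nearly maximal at \<open>n\<close> and not much above
      \<open>w\<close> at the neighbours. The former happens for infinitely many \<open>j\<close>,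
      the latter for all large \<open>j\<close>.\<close>
    have all: "\<forall>\<^sub>F j in sequentially. Y j \<tau> n < w \<tau> n + ?e \<and> Y j \<tau> (n - 1) < w \<tau> (n - 1) + ?e \<and>
        Y j \<tau> (n + 1) < w \<tau> (n + 1) + ?e \<and> subsol (Y j \<tau>)"
      using up[of n] up[of "n - 1"] up[of "n + 1"] evS[of \<tau>] by eventually_elim blast
    obtain j where j: "Y j \<tau> n < w \<tau> n + ?e" "Y j \<tau> (n - 1) < w \<tau> (n - 1) + ?e"
      "Y j \<tau> (n + 1) < w \<tau> (n + 1) + ?e" "subsol (Y j \<tau>)" "\<not> Y j \<tau> n \<le> w \<tau> n - ?e"
    proof (rule ccontr)
      assume "\<not> thesis"
      with that have *: "\<And>j. Y j \<tau> n < w \<tau> n + ?e \<and> Y j \<tau> (n - 1) < w \<tau> (n - 1) + ?e \<and>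
        Y j \<tau> (n + 1) < w \<tau> (n + 1) + ?e \<and> subsol (Y j \<tau>) \<Longrightarrow> Y j \<tau> n \<le> w \<tau> n - ?e" by blast
      from eventually_mono[OF all this] nle show False by contradiction
    qed
    have "force h (Y j \<tau>) n \<le> F \<and> \<bar>Y j \<tau> n - w \<tau> n\<bar> \<le> ?e \<and>
        Y j \<tau> (n - 1) \<le> w \<tau> (n - 1) + ?e \<and> Y j \<tau> (n + 1) \<le> w \<tau> (n + 1) + ?e"
      using j unfolding subsol_def by (auto simp: abs_le_iff)
    then show "\<exists>y. force h y n \<le> F \<and> \<bar>y n - w \<tau> n\<bar> \<le> ?e \<and>
        y (n - 1) \<le> w \<tau> (n - 1) + ?e \<and> y (n + 1) \<le> w \<tau> (n + 1) + ?e" by blast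
  qed
  have pow: "translate (k * \<alpha>) (k * \<beta>) (w \<tau>) = w (\<tau> + of_int k)" for k \<tau>
  proof (induction k rule: int_induct[of _ 0])
    case (step1 k)
    have "translate ((k + 1) * \<alpha>) ((k + 1) * \<beta>) (w \<tau>) = translate \<alpha> \<beta> (translate (k * \<alpha>) (k * \<beta>) (w \<tau>))"
      by (simp add: algebra_simps)
    then show ?case unfolding step1(2) gen by (simp add: add.assoc)
  next
    case (step2 k)
    have "translate ((k - 1) * \<alpha>) ((k - 1) * \<beta>) (w \<tau>) = translate (- \<alpha>) (- \<beta>) (translate (k * \<alpha>) (k * \<beta>) (w \<tau>))"
      by (simp add: algebra_simps)
    also have "\<dots> = translate (- \<alpha>) (- \<beta>) (translate \<alpha> \<beta> (w (\<tau> + of_int k - 1)))"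
      unfolding step2(2) gen by simp
    finally show ?case by (simp add: add_diff_eq)
  qed simp
  have "translate a b (w \<tau>) = w (\<tau> + of_int (b * q - a * p))" for a b \<tau>
    unfolding translate_generator[OF wty, of a b] by (rule pow)
  with wris force mono lip show ?thesis by (rule that)
qed

end

context twist
begin

text \<open>The parametrisation by the mean is dropped here: translation by \<open>(0, 1)\<close>
  advances it by the period \<open>q\<close>, which is unbounded along the approximation to
  come.\<close>

lemma sliding_family_exists:
  assumes "q > 0" "coprime p q" "0 \<le> F" "\<not> admits_birkhoff_equilibrium h F (of_int p / of_int q)"
  obtains w :: "real \<Rightarrow> configuration" where "\<And>\<tau>. birkhoff (w \<tau>)" "\<And>\<tau>. width (of_int p / of_int q) (w \<tau>)"
    "\<And>\<tau> n. force h (w \<tau>) n \<le> F" "\<And>\<tau> \<tau>'. \<tau> \<le> \<tau>' \<Longrightarrow> w \<tau> \<le> w \<tau>'"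
    "\<And>n. continuous_on UNIV (\<lambda>\<tau>. w \<tau> n)" "\<And>a b \<tau>. \<exists>\<tau>'. translate a b (w \<tau>) = w \<tau>'"
proof -
  obtain \<alpha> \<beta> where "bezout_type p q \<alpha> \<beta>" using bezout_type_exists[OF assms(1,2)] .
  then interpret bezout_type p q \<alpha> \<beta> .
  interpret twist_type h c p q \<alpha> \<beta> by unfold_locales
  have unpinned: "\<not> equilibrium h F x" if "rising x" for x
  proof
    assume eq: "equilibrium h F x"
    have "of_type p q x" using that by (simp add: rising_def)
    then have "of_type p' q' x" if "q' > 0 \<and> coprime p' q' \<and> (of_int p / of_int q :: real) = of_int p' / of_int q'" for p' q'
      using lowest_terms_unique[of q p q' p'] assms(1,2) that by simp
    then have "admits_birkhoff_equilibrium h F (of_int p / of_int q)"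
      unfolding admits_iff using eq rising_birkhoff[OF that] rising_width[OF that] by blast
    with assms(4) show False by contradiction
  qed
  interpret sliding h c p q \<alpha> \<beta> F by unfold_locales (use assms(3) unpinned in auto)
  obtain w :: "real \<Rightarrow> configuration" where w: "\<And>\<tau>. rising (w \<tau>)" "\<And>\<tau> n. force h (w \<tau>) n \<le> F"
    "\<And>\<tau> \<tau>'. \<tau> \<le> \<tau>' \<Longrightarrow> w \<tau> \<le> w \<tau>'" "\<And>\<tau> \<tau>' n. \<tau> \<le> \<tau>' \<Longrightarrow> w \<tau>' n \<le> w \<tau> n + (\<tau>' - \<tau>)"
    "\<And>a b \<tau>. translate a b (w \<tau>) = w (\<tau> + of_int (b * q - a * p))" by (rule sliding_family) blast
  have "dist (w \<tau>' n) (w \<tau> n) \<le> dist \<tau>' \<tau>" for \<tau> \<tau>' n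
    using w(4)[of \<tau> \<tau>' n] w(4)[of \<tau>' \<tau> n] le_funD[OF w(3), of \<tau> \<tau>' n] le_funD[OF w(3), of \<tau>' \<tau> n]
    by (cases "\<tau> \<le> \<tau>'") (auto simp: dist_real_def)
  then have "continuous_on UNIV (\<lambda>\<tau>. w \<tau> n)" for n
    unfolding continuous_on_iff by (meson order.strict_trans1)
  moreover have "\<exists>\<tau>'. translate a b (w \<tau>) = w \<tau>'" for a b \<tau> using w(5) by blast
  ultimately show ?thesis using that[of w] rising_birkhoff[OF w(1)] rising_width[OF w(1)] w(2,3) by blast
qed

end

section \<open>The limit of vanishing tilt\<close>

definition weight_sum :: "nat \<Rightarrow> real" where
  "weight_sum k = (\<Sum>n\<in>{- int k..int k}. (1/2) ^ nat \<bar>n\<bar>)"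

definition window_mean :: "nat \<Rightarrow> configuration \<Rightarrow> real" where
  "window_mean k x = (\<Sum>n\<in>{- int k..int k}. (1/2) ^ nat \<bar>n\<bar> * x n) / weight_sum k"

text \<open>The full two-sided geometric series has sum 3; this is the 3 in the Lipschitz constants
  below.\<close>

lemma weight_sum_le: "weight_sum k \<le> 3"
proof -
  have "weight_sum k + 2 * (1/2) ^ k = 3"
  proof (induction k)
    case 0 then show ?case by (simp add: weight_sum_def)
  next
    case (Suc k)
    have set: "{- int (Suc k)..int (Suc k)} = insert (int k + 1) (insert (- (int k + 1)) {- int k..int k})" by auto
    have "nat \<bar>int k + 1\<bar> = Suc k" "nat \<bar>- (int k + 1)\<bar> = Suc k" by simp_all
    then have "weight_sum (Suc k) = weight_sum k + 2 * (1/2) ^ Suc k"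
      unfolding weight_sum_def set by (subst sum.insert, simp, simp, subst sum.insert) auto
    then show ?case using Suc by simp
  qed
  moreover have "0 \<le> 2 * (1/2 :: real) ^ k" by simp
  ultimately show ?thesis by linarith
qed

lemma weight_sum_pos: "weight_sum k > 0"
  unfolding weight_sum_def by (rule sum_pos) auto

lemma window_mean_mono: "x \<le> y \<Longrightarrow> window_mean k x \<le> window_mean k y"
  unfolding window_mean_def using weight_sum_pos[of k]
  by (intro divide_right_mono sum_mono mult_left_mono) (auto simp: le_fun_def)

text \<open>Site \<open>n\<close> carries at least the fraction
  \<open>(1/2) ^ nat \<bar>n\<bar> / 3\<close> of the total weight, and all sites of an ordered pair
  differ in the same direction.\<close>

lemma window_mean_diff:
  assumes "x \<le> y" "\<bar>n\<bar> \<le> int k"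
  shows "y n - x n \<le> 3 * 2 ^ nat \<bar>n\<bar> * (window_mean k y - window_mean k x)"
proof -
  have nn: "0 \<le> y m - x m" for m using le_funD[OF assms(1), of m] by simp
  have "(1/2) ^ nat \<bar>n\<bar> * (y n - x n) \<le> (\<Sum>m\<in>{- int k..int k}. (1/2) ^ nat \<bar>m\<bar> * (y m - x m))"
    using assms(2) nn by (intro member_le_sum[of n "{- int k..int k}" "\<lambda>m. (1/2) ^ nat \<bar>m\<bar> * (y m - x m)"]) auto
  also have "\<dots> = weight_sum k * (window_mean k y - window_mean k x)"
    using weight_sum_pos[of k] unfolding window_mean_def
    by (simp add: right_diff_distrib sum_subtractf)
  also have "\<dots> \<le> 3 * (window_mean k y - window_mean k x)"
    using window_mean_mono[OF assms(1), of k] by (intro mult_right_mono weight_sum_le) simp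
  finally have "2 ^ nat \<bar>n\<bar> * ((1/2) ^ nat \<bar>n\<bar> * (y n - x n)) \<le> 2 ^ nat \<bar>n\<bar> * (3 * (window_mean k y - window_mean k x))"
    by (intro mult_left_mono) auto
  moreover have "(2::real) ^ nat \<bar>n\<bar> * (1/2) ^ nat \<bar>n\<bar> = 1"
    by (simp flip: power_mult_distrib)
  then have "2 ^ nat \<bar>n\<bar> * ((1/2) ^ nat \<bar>n\<bar> * (y n - x n)) = y n - x n"
    by (simp only: mult.assoc[symmetric] mult_1_left)
  ultimately show ?thesis by (simp only: mult_ac)
qed

lemma window_mean_diff_abs:
  assumes "x \<le> y \<or> y \<le> x" "\<bar>n\<bar> \<le> int k"
  shows "\<bar>y n - x n\<bar> \<le> 3 * 2 ^ nat \<bar>n\<bar> * \<bar>window_mean k y - window_mean k x\<bar>"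
  using assms(1)
proof
  assume "x \<le> y"
  then show ?thesis
    using window_mean_diff[OF _ assms(2)] window_mean_mono[of x y k] le_funD[of x y n] by simp
next
  assume "y \<le> x"
  then show ?thesis
    using window_mean_diff[OF _ assms(2), of y x] window_mean_mono[of y x k] le_funD[of y x n]
    by (simp add: abs_minus_commute)
qed

lemma window_mean_translate: "window_mean k (translate 0 b x) = window_mean k x + of_int b"
proof -
  have "(\<Sum>n\<in>{- int k..int k}. (1/2) ^ nat \<bar>n\<bar> * (x n + of_int b)) =
      (\<Sum>n\<in>{- int k..int k}. (1/2) ^ nat \<bar>n\<bar> * x n) + of_int b * weight_sum k"
    unfolding weight_sum_def sum_distrib_left sum.distrib[symmetric]
    by (rule sum.cong) (simp_all add: algebra_simps)
  then show ?thesis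
    using weight_sum_pos[of k] by (simp add: window_mean_def translate_def add_divide_distrib)
qed

text \<open>The weights \<open>(1/2) ^ \<bar>n\<bar>\<close> give a parametrisation whose Lipschitz constants at every site are
  uniform along the approximating sequence.\<close>

locale ordered_family = twist +
  fixes \<omega> :: real and x :: "real \<Rightarrow> configuration"
  assumes mono: "\<And>r r'. r \<le> r' \<Longrightarrow> x r \<le> x r'"
    and lip: "\<And>r r' n. r \<le> r' \<Longrightarrow> x r' n \<le> x r n + 3 * 2 ^ nat \<bar>n\<bar> * (r' - r)"
    and unit: "\<And>r n. x (r + 1) n = x r n + 1"
    and birk: "\<And>r. birkhoff (x r)"
    and wid: "\<And>r. width \<omega> (x r)"
    and sub: "\<And>r n. force h (x r) n \<le> 0"
    and comparable: "\<And>a b r r'. translate a b (x r) \<le> x r' \<or> x r' \<le> translate a b (x r)"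

context twist
begin

text \<open>Each approximating family is reparametrised by its window mean, counted from a member
  that is in the unit interval at site 0; then a cluster point is taken over all pairs of parameter
  and site at once. The windows grow with \<open>k\<close>, so every site is eventually governed by
  them.\<close>

lemma ordered_family_limit:
  fixes w :: "nat \<Rightarrow> real \<Rightarrow> configuration"
  assumes "q > 0" and birk: "\<And>k \<tau>. birkhoff (w k \<tau>)" and wid: "\<And>k \<tau>. width (\<omega> k) (w k \<tau>)"
    and frc: "\<And>k \<tau> n. force h (w k \<tau>) n \<le> F k" and mono: "\<And>k \<tau> \<tau>'. \<tau> \<le> \<tau>' \<Longrightarrow> w k \<tau> \<le> w k \<tau>'"
    and cont: "\<And>k n. continuous_on UNIV (\<lambda>\<tau>. w k \<tau> n)"
    and trans: "\<And>k a b \<tau>. \<exists>\<tau>'. translate a b (w k \<tau>) = w k \<tau>'"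
    and F: "F \<longlonglongrightarrow> 0" and \<omega>: "\<omega> \<longlonglongrightarrow> of_int p / of_int q" "\<And>k. of_int p / of_int q < \<omega> k"
  obtains x where "ordered_family h c (of_int p / of_int q) x" "\<And>r. translate q p (x r) \<le> x r"
proof -
  have cmp: "w k \<tau> \<le> w k \<tau>' \<or> w k \<tau>' \<le> w k \<tau>" for k \<tau> \<tau>'
    using mono[of \<tau> \<tau>' k] mono[of \<tau>' \<tau> k] by linarith
  have "\<exists>\<sigma>. 0 \<le> w k \<sigma> 0 \<and> w k \<sigma> 0 \<le> 1" for k
  proof -
    obtain \<sigma> where \<sigma>: "translate 0 (- \<lfloor>w k 0 0\<rfloor>) (w k 0) = w k \<sigma>" using trans by blast
    have "translate 0 (- \<lfloor>w k 0 0\<rfloor>) (w k 0) 0 = w k 0 0 - of_int \<lfloor>w k 0 0\<rfloor>" by (simp add: translate_def)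
    then have "w k \<sigma> 0 = w k 0 0 - of_int \<lfloor>w k 0 0\<rfloor>" by (simp add: \<sigma>)
    then show ?thesis using floor_correct[of "w k 0 0"] by (intro exI[of _ \<sigma>]) linarith
  qed
  then obtain \<sigma> where \<sigma>: "\<And>k. 0 \<le> w k (\<sigma> k) 0 \<and> w k (\<sigma> k) 0 \<le> 1" by metis
  define \<rho> where "\<rho> = (\<lambda>k \<tau>. window_mean k (w k \<tau>) - window_mean k (w k (\<sigma> k)))"
  have \<rho>_mono: "\<rho> k \<tau> \<le> \<rho> k \<tau>'" if "\<tau> \<le> \<tau>'" for k \<tau> \<tau>'
    unfolding \<rho>_def using window_mean_mono[OF mono[OF that]] by simp
  have "\<exists>\<tau>. \<rho> k \<tau> = r" for k r
  proof -
    have "continuous_on UNIV (\<rho> k)"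
      unfolding \<rho>_def window_mean_def using weight_sum_pos[of k] by (intro continuous_intros cont) auto
    then have con: "connected (range (\<rho> k))" by (rule connected_continuous_image) simp
    \<comment> \<open>Integer translates of the base member realise all integer parameters;
      continuity in \<open>\<tau>\<close> fills in the rest.\<close>
    have mem: "of_int m \<in> range (\<rho> k)" for m
    proof -
      obtain \<tau> where "translate 0 m (w k (\<sigma> k)) = w k \<tau>" using trans by blast
      then have "\<rho> k \<tau> = of_int m"
        using window_mean_translate[of k m "w k (\<sigma> k)"] by (simp add: \<rho>_def)
      then show ?thesis by (rule range_eqI[OF sym])
    qed
    have "r \<in> range (\<rho> k)"
      by (rule connectedD_interval[OF con mem[of "\<lfloor>r\<rfloor>"] mem[of "\<lceil>r\<rceil>"]]) linarith+
    then show ?thesis by blast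
  qed
  then obtain T where T: "\<And>k r. \<rho> k (T k r) = r" by metis
  define z where "z = (\<lambda>k r. w k (T k r))"
  have z_mono: "z k r \<le> z k r'" if "r \<le> r'" for k r r'
  proof (cases "r = r'")
    case False
    then have "\<not> T k r' \<le> T k r" using \<rho>_mono[of "T k r'" "T k r" k] that by (auto simp: T)
    then show ?thesis unfolding z_def by (intro mono) simp
  qed simp
  have window: "\<bar>w k \<tau>' n - w k \<tau> n\<bar> \<le> 3 * 2 ^ nat \<bar>n\<bar> * \<bar>\<rho> k \<tau>' - \<rho> k \<tau>\<bar>" if "\<bar>n\<bar> \<le> int k" for k \<tau> \<tau>' n
    using window_mean_diff_abs[of "w k \<tau>" "w k \<tau>'" n k, OF cmp that] by (simp add: \<rho>_def)
  have evw: "\<forall>\<^sub>F k in sequentially. \<bar>n\<bar> \<le> int k" for n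
    using eventually_ge_at_top[of "nat \<bar>n\<bar>"] by (rule eventually_mono) linarith
  define Z where "Z = (\<lambda>k i. z k (fst i) (snd i))"
  have bd: "\<exists>B. \<forall>\<^sub>F k in sequentially. \<bar>Z k i\<bar> \<le> B" for i
  proof -
    obtain r n where i: "i = (r, n)" by (cases i)
    let ?\<omega> = "\<bar>of_int p / of_int q\<bar> + 1 :: real"
    have "\<forall>\<^sub>F k in sequentially. \<bar>\<omega> k\<bar> < ?\<omega>"
      by (rule order_tendstoD(2)[OF tendsto_rabs[OF \<omega>(1)]]) simp
    with evw[of n] have "\<forall>\<^sub>F k in sequentially. \<bar>z k r n\<bar> \<le> 3 * 2 ^ nat \<bar>n\<bar> * \<bar>r\<bar> + (of_int \<bar>n\<bar> * ?\<omega> + 2)"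
    proof eventually_elim
      case (elim k)
      have "\<bar>z k r n - w k (\<sigma> k) n\<bar> \<le> 3 * 2 ^ nat \<bar>n\<bar> * \<bar>\<rho> k (T k r) - \<rho> k (\<sigma> k)\<bar>"
        unfolding z_def by (rule window[OF elim(1)])
      then have 1: "\<bar>z k r n - w k (\<sigma> k) n\<bar> \<le> 3 * 2 ^ nat \<bar>n\<bar> * \<bar>r\<bar>"
        unfolding T by (simp add: \<rho>_def)
      have "\<bar>w k (\<sigma> k) n - w k (\<sigma> k) 0\<bar> \<le> of_int \<bar>n\<bar> * \<bar>\<omega> k\<bar> + 1"
        using width_bound[OF wid[of k "\<sigma> k"], of n 0] by simp
      moreover have "of_int \<bar>n\<bar> * \<bar>\<omega> k\<bar> \<le> of_int \<bar>n\<bar> * ?\<omega>"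
        using elim(2) by (intro mult_left_mono) auto
      ultimately show ?case using 1 \<sigma>[of k] by linarith
    qed
    then show ?thesis unfolding i Z_def fst_conv snd_conv by blast
  qed
  obtain G l where G: "G \<le> sequentially" "G \<noteq> bot" "\<And>i. ((\<lambda>k. Z k i) \<longlongrightarrow> l i) G"
    by (rule pointwise_cluster[of sequentially Z, OF sequentially_bot bd]) blast
  define x where "x = (\<lambda>r n. l (r, n))"
  have lim: "((\<lambda>k. z k r n) \<longlongrightarrow> x r n) G" for r n
    using G(3)[of "(r, n)"] by (simp add: x_def Z_def)
  have ev: "\<forall>\<^sub>F k in G. \<bar>n\<bar> \<le> int k" for n using filter_leD[OF G(1) evw] .
  have "ordered_family h c (of_int p / of_int q) x"
  proof (intro ordered_family.intro ordered_family_axioms.intro twist_axioms)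
    show "x r \<le> x r'" if "r \<le> r'" for r r'
      unfolding le_fun_def
      by (rule allI, rule tendsto_le[OF G(2) lim lim]) (rule always_eventually, rule allI, rule le_funD[OF z_mono[OF that]])
    show "x r' n \<le> x r n + 3 * 2 ^ nat \<bar>n\<bar> * (r' - r)" if "r \<le> r'" for r r' n
    proof (rule tendsto_le[OF G(2) tendsto_add[OF lim tendsto_const] lim])
      show "\<forall>\<^sub>F k in G. z k r' n \<le> z k r n + 3 * 2 ^ nat \<bar>n\<bar> * (r' - r)"
        using ev[of n]
      proof eventually_elim
        case (elim k)
        have "\<bar>z k r' n - z k r n\<bar> \<le> 3 * 2 ^ nat \<bar>n\<bar> * \<bar>\<rho> k (T k r') - \<rho> k (T k r)\<bar>"
          unfolding z_def by (rule window[OF elim])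
        then show ?case using that by (simp add: T)
      qed
    qed
    show "x (r + 1) n = x r n + 1" for r n
    proof -
      have "\<forall>\<^sub>F k in G. z k (r + 1) n = z k r n + 1"
        using ev[of n]
      proof eventually_elim
        case (elim k)
        obtain \<tau> where \<tau>: "translate 0 1 (z k r) = w k \<tau>" using trans unfolding z_def by blast
        \<comment> \<open>Members with the same parameter agree on the window, so it is enough to
          compute the parameter of the translate.\<close>
        have "\<rho> k \<tau> = r + 1"
          using T[of k r] window_mean_translate[of k 1 "z k r", unfolded \<tau>] unfolding \<rho>_def z_def by simp
        then have "\<bar>w k \<tau> n - w k (T k (r + 1)) n\<bar> \<le> 0"
          using window[OF elim, of \<tau> "T k (r + 1)"] by (simp add: T)
        moreover have "w k \<tau> n = z k r n + 1" unfolding \<tau>[symmetric] by (simp add: translate_def)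
        ultimately show ?case by (simp add: z_def)
      qed
      then have "((\<lambda>k. z k r n + 1) \<longlongrightarrow> x (r + 1) n) G"
        by (rule Lim_transform_eventually[OF lim])
      then show ?thesis using tendsto_unique[OF G(2) _ tendsto_add[OF lim tendsto_const]] by blast
    qed
    show "birkhoff (x r)" for r
      by (rule birkhoff_limit[OF G(2) lim]) (simp add: z_def birk)
    show "width (of_int p / of_int q) (x r)" for r
      by (rule width_limit[OF G(2) lim _ tendsto_mono[OF G(1) \<omega>(1)]]) (simp add: z_def wid)
    show "force h (x r) n \<le> 0" for r n
      by (rule tendsto_le[OF G(2) tendsto_mono[OF G(1) F] force_tendsto[OF lim]]) (simp add: z_def frc)
    show "translate a b (x r) \<le> x r' \<or> x r' \<le> translate a b (x r)" for a b r r'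
    proof (rule comparable_limit[OF G(2) translate_tendsto[OF lim] lim], rule always_eventually, rule allI)
      fix k
      obtain \<tau> where "translate a b (z k r) = w k \<tau>" using trans unfolding z_def by blast
      then show "translate a b (z k r) \<le> z k r' \<or> z k r' \<le> translate a b (z k r)"
        using cmp[of k \<tau> "T k r'"] by (simp add: z_def)
    qed
  qed
  moreover have "translate q p (x r) \<le> x r" for r
    unfolding le_fun_def
  proof
    fix n
    show "translate q p (x r) n \<le> x r n"
    proof (rule tendsto_le[OF G(2) lim translate_tendsto[OF lim]], rule always_eventually, rule allI)
      fix k
      show "translate q p (z k r) n \<le> z k r n"
        unfolding z_def by (rule le_funD[OF width_advancing[OF birk wid \<open>q > 0\<close> \<omega>(2)]])
    qed
  qed
  ultimately show ?thesis by (rule that)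
qed

lemma ordered_family_exists:
  assumes "q > 0" "(depinning_force h \<longlongrightarrow> 0) (at_right (of_int p / of_int q))"
  obtains x where "ordered_family h c (of_int p / of_int q) x" "\<And>r. translate q p (x r) \<le> x r"
proof -
  define \<omega> where "\<omega> = (\<lambda>k::nat. of_int p / of_int q + 1 / (real k + 1) :: real)"
  have gt: "of_int p / of_int q < \<omega> k" for k by (simp add: \<omega>_def)
  have \<omega>: "\<omega> \<longlonglongrightarrow> of_int p / of_int q"
    unfolding \<omega>_def using tendsto_add[OF tendsto_const inverse_Suc_tendsto] by simp
  have "filterlim \<omega> (at_right (of_int p / of_int q)) sequentially"
    unfolding filterlim_at using \<omega> gt less_imp_neq[OF gt, symmetric] by simp
  then have lim: "(\<lambda>k. depinning_force h (\<omega> k)) \<longlonglongrightarrow> 0" by (rule filterlim_compose[OF assms(2)])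
  \<comment> \<open>The extra \<open>1 / (real k + 1)\<close> puts the tilt strictly above the
    depinning force, where sliding families exist.\<close>
  define F where "F = (\<lambda>k. depinning_force h (\<omega> k) + 1 / (real k + 1))"
  have F: "F \<longlonglongrightarrow> 0" unfolding F_def using tendsto_add[OF lim inverse_Suc_tendsto] by simp
  have F0: "0 \<le> F k" "depinning_force h (\<omega> k) < F k" for k
    using depinning_force_nonneg[of "\<omega> k"] by (simp_all add: F_def)
  have "\<exists>w :: real \<Rightarrow> configuration. (\<forall>\<tau>. birkhoff (w \<tau>)) \<and> (\<forall>\<tau>. width (\<omega> k) (w \<tau>)) \<and> (\<forall>\<tau> n. force h (w \<tau>) n \<le> F k) \<and>
      (\<forall>\<tau> \<tau>'. \<tau> \<le> \<tau>' \<longrightarrow> w \<tau> \<le> w \<tau>') \<and> (\<forall>n. continuous_on UNIV (\<lambda>\<tau>. w \<tau> n)) \<and>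
      (\<forall>a b \<tau>. \<exists>\<tau>'. translate a b (w \<tau>) = w \<tau>')" (is "\<exists>w :: real \<Rightarrow> configuration. ?P k w") for k
  proof -
    have "\<omega> k \<in> \<rat>" by (simp add: \<omega>_def)
    then obtain P Q where PQ: "Q > 0" "coprime P Q" "\<omega> k = of_int P / of_int Q" by (rule Rats_cases')
    have na: "\<not> admits_birkhoff_equilibrium h (F k) (of_int P / of_int Q)"
      using admits_iff_le[OF F0(1), of k "\<omega> k"] F0(2)[of k] PQ(3) by simp
    obtain w :: "real \<Rightarrow> configuration" where "\<And>\<tau>. birkhoff (w \<tau>)" "\<And>\<tau>. width (\<omega> k) (w \<tau>)"
      "\<And>\<tau> n. force h (w \<tau>) n \<le> F k" "\<And>\<tau> \<tau>'. \<tau> \<le> \<tau>' \<Longrightarrow> w \<tau> \<le> w \<tau>'"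
      "\<And>n. continuous_on UNIV (\<lambda>\<tau>. w \<tau> n)" "\<And>a b \<tau>. \<exists>\<tau>'. translate a b (w \<tau>) = w \<tau>'"
      unfolding PQ(3) by (rule sliding_family_exists[OF PQ(1,2) F0(1) na]) blast
    then show ?thesis by (intro exI[of _ w] conjI allI impI)
  qed
  then have "\<exists>w. \<forall>k. ?P k (w k)" by (rule choice[OF allI])
  then obtain w where w: "\<And>k. ?P k (w k)" by blast
  show ?thesis
    by (rule ordered_family_limit[of q w \<omega> F p, OF assms(1) _ _ _ _ _ _ F \<omega> gt]) (use w that in blast)+
qed

end

section \<open>Action balance\<close>

text \<open>For functions without derivatives: the set where \<open>f\<close> stays below the line
  of slope \<open>\<kappa>\<close> through its initial value is closed and can be continued to the
  right, and \<open>\<kappa>\<close> is arbitrary.\<close>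

lemma dini_nonincreasing:
  fixes f :: "real \<Rightarrow> real"
  assumes "a \<le> b" "continuous_on {a..b} f"
    and dini: "\<And>t \<kappa>. a \<le> t \<Longrightarrow> t < b \<Longrightarrow> \<kappa> > 0 \<Longrightarrow> \<forall>\<^sub>F s in at_right t. f s - f t \<le> \<kappa> * (s - t)"
  shows "f b \<le> f a"
proof -
  have main: "f b \<le> f a + \<kappa> * (b - a)" if \<kappa>: "\<kappa> > 0" for \<kappa>
  proof -
    define S where "S = {t \<in> {a..b}. f t \<le> f a + \<kappa> * (t - a)}"
    have aS: "a \<in> S" using assms(1) by (simp add: S_def)
    have bdd: "bdd_above S" by (rule bdd_aboveI[of _ b]) (simp add: S_def)
    have "closed S"
      unfolding S_def by (intro continuous_on_closed_Collect_le continuous_intros assms(2))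
    then have s: "Sup S \<in> S" using closed_contains_Sup[OF _ bdd] aS by blast
    define s where "s = Sup S"
    have s: "a \<le> s" "s \<le> b" "f s \<le> f a + \<kappa> * (s - a)" using s by (simp_all add: s_def S_def)
    have "s = b"
    proof (rule ccontr)
      assume "s \<noteq> b"
      then have "s < b" using s by simp
      from dini[OF s(1) this \<kappa>] have "\<forall>\<^sub>F t in at_right s. f t - f s \<le> \<kappa> * (t - s)" .
      moreover have "\<forall>\<^sub>F t in at_right s. t < b \<and> s < t"
        using \<open>s < b\<close> unfolding eventually_at_right_field by blast
      ultimately have "\<forall>\<^sub>F t in at_right s. f t - f s \<le> \<kappa> * (t - s) \<and> t < b \<and> s < t"
        by eventually_elim simp
      then obtain t where t: "f t - f s \<le> \<kappa> * (t - s)" "t < b" "s < t"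
        using eventually_happens[of _ "at_right s"] by auto
      have "f t \<le> f a + \<kappa> * (t - a)" using t(1) s(3) by (simp add: algebra_simps)
      then have "t \<in> S" using t s by (simp add: S_def)
      from cSup_upper[OF this bdd] t(3) show False by (simp add: s_def)
    qed
    then show ?thesis using s by simp
  qed
  have "f b \<le> f a + e" if "e > 0" for e
  proof -
    have "e / (b - a + 1) * (b - a) \<le> e" using assms(1) that by (simp add: field_simps)
    moreover have "e / (b - a + 1) > 0" using assms(1) that by simp
    ultimately show ?thesis using main[of "e / (b - a + 1)"] by linarith
  qed
  then show ?thesis by (rule field_le_epsilon)
qed

section \<open>Translation invariance of an ordered family and vanishing of its force\<close>

context ordered_family
begin

lemma unit_int: "x (r + of_int k) n = x r n + of_int k"
proof (induction k rule: int_induct[of _ 0])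
  case (step1 k)
  then show ?case using unit[of "r + of_int k" n] by (simp add: add.assoc)
next
  case (step2 k)
  then show ?case using unit[of "r + of_int (k - 1)" n] by simp
qed simp

lemma unit_translate: "x (r + of_int k) = translate 0 k (x r)"
  by (rule ext) (simp add: unit_int translate_def)

lemma continuous: "continuous_on UNIV (\<lambda>r. x r n)"
  unfolding continuous_on_iff
proof (intro ballI allI impI)
  fix r e :: real assume "e > 0"
  define L :: real where "L = 3 * 2 ^ nat \<bar>n\<bar>"
  have L: "L > 0" by (simp add: L_def)
  have "dist (x r' n) (x r n) < e" if "dist r' r < e / L" for r'
  proof -
    have "\<bar>x r' n - x r n\<bar> \<le> L * \<bar>r' - r\<bar>"
      using lip[of r r' n] lip[of r' r n] le_funD[OF mono, of r r' n] le_funD[OF mono, of r' r n]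
      unfolding L_def by (cases "r \<le> r'") auto
    also have "\<dots> < e" using that L by (simp add: dist_real_def field_simps)
    finally show ?thesis by (simp add: dist_real_def)
  qed
  then show "\<exists>d>0. \<forall>r'\<in>UNIV. dist r' r < d \<longrightarrow> dist (x r' n) (x r n) < e"
    using \<open>e > 0\<close> L by (intro exI[of _ "e / L"]) auto
qed

lemma continuous_tendsto: "((\<lambda>r. x r n) \<longlongrightarrow> x s n) (at s within S)"
  using continuous[of n] by (auto simp: continuous_on_def intro: tendsto_within_subset)

lemma reaches: "\<exists>r. x r n = v"
proof -
  have con: "connected (range (\<lambda>r. x r n))" by (rule connected_continuous_image[OF continuous]) simp
  have mem: "x 0 n + of_int k \<in> range (\<lambda>r. x r n)" for k
    using unit_int[of 0 k n] by (metis add_0 rangeI)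
  have "v \<in> range (\<lambda>r. x r n)"
    by (rule connectedD_interval[OF con mem[of "\<lfloor>v - x 0 n\<rfloor>"] mem[of "\<lceil>v - x 0 n\<rceil>"]]) linarith+
  then show ?thesis by blast
qed

text \<open>By \<open>comparable\<close> the translate \<open>y\<close> cuts the parameter line into
  members below and members above it, and by continuity it equals the member at the cut. The
  distance bound \<open>m\<close> shows that the cut is finite.\<close>

lemma invariant: "\<exists>r'. translate a b (x r) = x r'"
proof -
  define y where "y = translate a b (x r)"
  define m where "m = \<lceil>of_int \<bar>a\<bar> * \<bar>\<omega>\<bar> + 1 + \<bar>of_int b :: real\<bar>\<rceil>"
  have close: "\<bar>y n - x r n\<bar> \<le> of_int m" for n
  proof -
    have "\<bar>y n - x r n\<bar> \<le> of_int \<bar>a\<bar> * \<bar>\<omega>\<bar> + 1 + \<bar>of_int b\<bar>"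
      using width_bound[OF wid[of r], of "n - a" n] by (simp add: y_def translate_def)
    also have "\<dots> \<le> of_int m" unfolding m_def by (rule le_of_int_ceiling)
    finally show ?thesis .
  qed
  define A where "A = {s. x s \<le> y}"
  have "x (r + of_int (- m)) \<le> y"
    unfolding le_fun_def
  proof
    fix n
    show "x (r + of_int (- m)) n \<le> y n" using close[of n] unfolding unit_int by (simp add: abs_le_iff)
  qed
  then have ne: "A \<noteq> {}" by (auto simp: A_def)
  have ub: "s \<le> r + of_int (m + 1)" if "s \<in> A" for s
  proof (rule ccontr)
    assume "\<not> ?thesis"
    then have "x (r + of_int (m + 1)) \<le> x s" by (intro mono) simp
    moreover have "x s \<le> y" using that by (simp add: A_def)
    ultimately have "x (r + of_int (m + 1)) 0 \<le> y 0" by (meson le_funD order_trans)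
    then show False using close[of 0] unit_int[of r "m + 1" 0] by simp
  qed
  then have bdd: "bdd_above A" by (meson bdd_aboveI)
  define s where "s = Sup A"
  have before: "x u \<le> y" if us: "u < s" for u
  proof -
    obtain v where "v \<in> A" "u < v" using less_cSupD[OF ne, of u] us by (auto simp: s_def)
    then show ?thesis using mono[of u v] by (auto simp: A_def)
  qed
  have after: "y \<le> x u" if "s < u" for u
  proof -
    have "u \<notin> A" using cSup_upper[OF _ bdd, of u] that by (auto simp: s_def)
    then show ?thesis using comparable[of a b r u] by (auto simp: A_def y_def)
  qed
  have "y n = x s n" for n
  proof (rule antisym)
    have "\<forall>\<^sub>F u in at_right s. y n \<le> x u n"
      unfolding eventually_at_filter by (rule always_eventually) (use le_funD[OF after] in auto)
    then show "y n \<le> x s n" by (rule tendsto_lowerbound[OF continuous_tendsto]) simp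
    have "\<forall>\<^sub>F u in at_left s. x u n \<le> y n"
      unfolding eventually_at_filter by (rule always_eventually) (use le_funD[OF before] in auto)
    then show "x s n \<le> y n" by (rule tendsto_upperbound[OF continuous_tendsto]) simp
  qed
  then show ?thesis unfolding y_def by (intro exI[of _ s] ext)
qed

text \<open>Invariance carries the parameter interval from site 0 to site \<open>n\<close> with the
  same displacement and force bound. An integer shift places it within two turns, so all sites can
  be treated over the same parameter range.\<close>

lemma shifted_interval:
  assumes "\<alpha> < \<beta>" "\<beta> \<le> \<alpha> + 1" "x \<alpha> 0 < x \<beta> 0" "\<And>r. r \<in> {\<alpha>..\<beta>} \<Longrightarrow> force h (x r) 0 \<le> - \<epsilon>"
  shows "\<exists>a b. 0 \<le> a \<and> a < b \<and> b \<le> 2 \<and> x b n - x a n = x \<beta> 0 - x \<alpha> 0 \<and> (\<forall>r\<in>{a..b}. force h (x r) n \<le> - \<epsilon>)"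
proof -
  obtain s where s: "translate n 0 (x \<alpha>) = x s" using invariant by blast
  define m where "m = - \<lfloor>s\<rfloor>"
  define a where "a = s + of_int m"
  have a01: "0 \<le> a" "a < 1" unfolding a_def m_def using floor_correct[of s] by simp_all linarith
  have xa: "x a = translate n m (x \<alpha>)"
    unfolding a_def unit_translate s[symmetric] by simp
  obtain t where t: "translate n m (x \<beta>) = x t" using invariant by blast
  \<comment> \<open>Different parameters may give the same configuration, so \<open>t\<close> can
    overshoot. The minimum keeps \<open>b \<le> a + 1\<close> and still represents the
    translate.\<close>
  define b where "b = min t (a + 1)"
  have xb: "x b = translate n m (x \<beta>)"
  proof (cases "t \<le> a + 1")
    case True
    then show ?thesis using t by (simp add: b_def)
  next
    case False
    have "x (a + 1) = translate n (m + 1) (x \<alpha>)"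
      using unit_translate[of a 1] xa by (simp add: add.commute)
    also have "\<dots> = translate n m (x (\<alpha> + 1))"
      using unit_translate[of \<alpha> 1] by simp
    finally have "x t \<le> x (a + 1)"
      unfolding t[symmetric] using translate_mono[OF mono[OF assms(2)]] by simp
    moreover have "x (a + 1) \<le> x t" using False by (intro mono) simp
    ultimately show ?thesis using t False by (simp add: b_def)
  qed
  have diff: "x b n - x a n = x \<beta> 0 - x \<alpha> 0" by (simp add: xa xb translate_def)
  have ab: "a < b"
  proof (rule ccontr)
    assume "\<not> a < b"
    then have "x b n \<le> x a n" by (intro le_funD[OF mono]) simp
    with diff assms(3) show False by simp
  qed
  have "force h (x r) n \<le> - \<epsilon>" if r: "r \<in> {a..b}" for r
  proof -
    obtain u where u: "translate (- n) (- m) (x r) = x u" using invariant by blast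
    have "translate (- n) (- m) (x a) \<le> x u" "x u \<le> translate (- n) (- m) (x b)"
      unfolding u[symmetric] using r by (auto intro!: translate_mono mono)
    then have between: "x \<alpha> \<le> x u" "x u \<le> x \<beta>" by (simp_all add: xa xb)
    \<comment> \<open>Being between the two end members, \<open>x u\<close> can have
      \<open>u\<close> outside the interval only where the family is constant up to the nearer
      end.\<close>
    obtain v where v: "v \<in> {\<alpha>..\<beta>}" "x u = x v"
    proof (cases "u < \<alpha>")
      case True
      then have "x u = x \<alpha>" using mono[of u \<alpha>] between(1) by (simp add: order_antisym)
      then show ?thesis using that[of \<alpha>] assms(1) by simp
    next
      case notless: False
      show ?thesis
      proof (cases "\<beta> < u")
        case True
        then have "x u = x \<beta>" using mono[of \<beta> u] between(2) by (simp add: order_antisym)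
        then show ?thesis using that[of \<beta>] assms(1) by simp
      next
        case False
        then show ?thesis using that[of u] notless by simp
      qed
    qed
    have "force h (x r) n = force h (x u) 0"
      unfolding u[symmetric] by (simp add: force_translate)
    then show ?thesis using assms(4)[OF v(1)] v(2) by simp
  qed
  then show ?thesis using a01 ab diff by (intro exI[of _ a] exI[of _ b]) (auto simp: b_def)
qed

text \<open>The action of a window of \<open>N\<close> sites returns to its value after one turn of the family,
  whereas every site in its interior contributes the same loss; only the two ends can compensate.\<close>

lemma flux:
  assumes "\<alpha> < \<beta>" "\<beta> \<le> \<alpha> + 1" "\<epsilon> > 0" "\<And>r. r \<in> {\<alpha>..\<beta>} \<Longrightarrow> force h (x r) 0 \<le> - \<epsilon>"
  shows "x \<beta> 0 = x \<alpha> 0"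
proof (rule ccontr)
  assume "x \<beta> 0 \<noteq> x \<alpha> 0"
  moreover have "x \<alpha> 0 \<le> x \<beta> 0" using assms(1) by (intro le_funD[OF mono]) simp
  ultimately have less: "x \<alpha> 0 < x \<beta> 0" by simp
  define A where "A = x \<beta> 0 - x \<alpha> 0"
  have A: "A > 0" using less by (simp add: A_def)
  have "\<exists>a b. 0 \<le> a \<and> a < b \<and> b \<le> 2 \<and> x b n - x a n = A \<and> (\<forall>r\<in>{a..b}. force h (x r) n \<le> - \<epsilon>)" for n
    unfolding A_def by (rule shifted_interval[OF assms(1,2) less assms(4)])
  then obtain a b where ab: "\<And>n. 0 \<le> a n" "\<And>n. a n < b n" "\<And>n. b n \<le> 2" "\<And>n. x (b n) n - x (a n) n = A"
    "\<And>n r. r \<in> {a n..b n} \<Longrightarrow> force h (x r) n \<le> - \<epsilon>" by metis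
  obtain B where B: "\<And>u v. \<bar>v - u\<bar> \<le> \<bar>\<omega>\<bar> + 1 \<Longrightarrow> \<bar>D1 h u v\<bar> \<le> B" "\<And>u v. \<bar>v - u\<bar> \<le> \<bar>\<omega>\<bar> + 1 \<Longrightarrow> \<bar>D2 h u v\<bar> \<le> B"
    by (rule strip_bound[of "\<bar>\<omega>\<bar> + 1"]) blast
  have D1B: "\<bar>D1 h (x r n) (x r (n + 1))\<bar> \<le> B" and D2B: "\<bar>D2 h (x r n) (x r (n + 1))\<bar> \<le> B" for r n
    using B width_step[OF wid[of r], of n] by auto
  \<comment> \<open>The position at site \<open>n\<close>, cut off to the range it covers over
    \<open>{a n..b n}\<close>. It rises by \<open>A\<close> altogether and moves only for parameters
    in that interval, where the force is at most \<open>- \<epsilon>\<close>.\<close>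
  define clamp where "clamp = (\<lambda>n r. max (x (a n) n) (min (x r n) (x (b n) n)))"
  have ab_le: "x (a n) n \<le> x (b n) n" for n using ab(4)[of n] A by simp
  have main: "\<epsilon> * A * real N \<le> 4 * B" for N
  proof -
    \<comment> \<open>Built to be nonincreasing. The window has \<open>N + 1\<close> bonds and
      interior sites 1 to \<open>N\<close>: the \<open>B\<close> term absorbs the derivatives at the
      two outer sites, and the clamps use up the guaranteed loss at the interior ones.\<close>
    define \<Phi> where "\<Phi> = (\<lambda>r. (\<Sum>i<Suc N. h (x r (int i)) (x r (int i + 1))) - B * (x r 0 + x r (int N + 1))
      + \<epsilon> * (\<Sum>i<N. clamp (int i + 1) r))"
    have "\<Phi> 2 \<le> \<Phi> 0"
    proof (rule dini_nonincreasing[of 0 2 \<Phi>])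
      have "continuous_on {0..2} (\<lambda>r. h (x r m) (x r n))" for m n
        unfolding continuous_on_def by (intro ballI h_tendsto continuous_tendsto)
      moreover have c: "continuous_on {0..2} (\<lambda>r. x r n)" for n
        by (rule continuous_on_subset[OF continuous]) simp
      ultimately show "continuous_on {0..2} \<Phi>"
        unfolding \<Phi>_def clamp_def by (intro continuous_intros)
    next
      fix t \<kappa> :: real assume t: "0 \<le> t" "t < 2" and \<kappa>: "\<kappa> > 0"
      define D where "D = (\<lambda>n r. x r n - x t n)"
      define L where "L = (\<Sum>i<Suc N. 3 * 2 ^ nat \<bar>int i\<bar> + 3 * 2 ^ nat \<bar>int i + 1\<bar> :: real)"
      have L: "L \<ge> 0" unfolding L_def by (intro sum_nonneg) simp
      define \<kappa>' where "\<kappa>' = \<kappa> / (L + 1)"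
      have \<kappa>': "\<kappa>' > 0" using \<kappa> L by (simp add: \<kappa>'_def)
      have \<kappa>'L: "\<kappa>' * L \<le> \<kappa>" using \<kappa> L by (simp add: \<kappa>'_def field_simps)
      have gt: "\<forall>\<^sub>F r in at_right t. t < r" by (rule eventually_at_right_less)
      have ev0: "\<forall>\<^sub>F r in at_right t. \<bar>h (x r (int i)) (x r (int i + 1)) - h (x t (int i)) (x t (int i + 1))
          - D1 h (x t (int i)) (x t (int i + 1)) * (x r (int i) - x t (int i))
          - D2 h (x t (int i)) (x t (int i + 1)) * (x r (int i + 1) - x t (int i + 1))\<bar>
          \<le> \<kappa>' * (\<bar>x r (int i) - x t (int i)\<bar> + \<bar>x r (int i + 1) - x t (int i + 1)\<bar>)" for i
        by (rule h_expansion[OF continuous_tendsto continuous_tendsto \<kappa>'])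
      have ev1: "\<forall>\<^sub>F r in at_right t. \<forall>i\<in>{..<Suc N}. h (x r (int i)) (x r (int i + 1)) - h (x t (int i)) (x t (int i + 1))
          \<le> D1 h (x t (int i)) (x t (int i + 1)) * D (int i) r + D2 h (x t (int i)) (x t (int i + 1)) * D (int i + 1) r
            + \<kappa>' * (\<bar>D (int i) r\<bar> + \<bar>D (int i + 1) r\<bar>)"
      proof (intro eventually_ball_finite ballI finite_lessThan)
        fix i
        show "\<forall>\<^sub>F r in at_right t. h (x r (int i)) (x r (int i + 1)) - h (x t (int i)) (x t (int i + 1))
          \<le> D1 h (x t (int i)) (x t (int i + 1)) * D (int i) r + D2 h (x t (int i)) (x t (int i + 1)) * D (int i + 1) r
            + \<kappa>' * (\<bar>D (int i) r\<bar> + \<bar>D (int i + 1) r\<bar>)"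
          unfolding D_def using ev0[of i] by eventually_elim linarith
      qed
      have "\<forall>\<^sub>F r in at_right t. \<epsilon> * (clamp n r - clamp n t) + force h (x t) n * D n r \<le> 0" for n
      proof -
        have D0: "0 \<le> D n r" if "t < r" for r using le_funD[OF mono, of t r n] that by (simp add: D_def)
        have f0: "force h (x t) n * D n r \<le> 0" if "t < r" for r
          using mult_nonpos_nonneg[OF sub D0[OF that]] .
        consider "t < a n" | "b n \<le> t" | "t \<in> {a n..b n}" by fastforce
        then show ?thesis
        proof cases
          case 1
          then have "\<forall>\<^sub>F r in at_right t. r < a n"
            using eventually_at_right_field by blast
          with gt show ?thesis
          proof eventually_elim
            case (elim r)
            have "x r n \<le> x (a n) n" "x t n \<le> x (a n) n"
              using elim 1 by (auto intro!: le_funD[OF mono])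
            then have "clamp n r = clamp n t" by (simp add: clamp_def)
            then show ?case using f0[OF elim(1)] by simp
          qed
        next
          case 2
          from gt show ?thesis
          proof eventually_elim
            case (elim r)
            have "x (b n) n \<le> x r n" "x (b n) n \<le> x t n"
              using elim 2 by (auto intro!: le_funD[OF mono])
            then have "clamp n r = clamp n t" by (simp add: clamp_def)
            then show ?case using f0[OF elim(1)] by simp
          qed
        next
          case 3
          from gt show ?thesis
          proof eventually_elim
            case (elim r)
            have "clamp n r - clamp n t \<le> D n r"
              using D0[OF elim] unfolding clamp_def D_def by linarith
            then have "\<epsilon> * (clamp n r - clamp n t) \<le> \<epsilon> * D n r" using assms(3) by simp
            moreover have "force h (x t) n * D n r \<le> - \<epsilon> * D n r"
              by (rule mult_right_mono[OF ab(5)[OF 3] D0[OF elim]])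
            ultimately show ?case by simp
          qed
        qed
      qed
      then have ev2: "\<forall>\<^sub>F r in at_right t. \<forall>i\<in>{..<N}. \<epsilon> * (clamp (int i + 1) r - clamp (int i + 1) t) + force h (x t) (int i + 1) * D (int i + 1) r \<le> 0"
        by (intro eventually_ball_finite ballI) auto
      show "\<forall>\<^sub>F r in at_right t. \<Phi> r - \<Phi> t \<le> \<kappa> * (r - t)"
        using gt ev1 ev2
      proof eventually_elim
        case (elim r)
        have D0: "0 \<le> D n r" for n using le_funD[OF mono, of t r n] elim(1) by (simp add: D_def)
        have DL: "D n r \<le> 3 * 2 ^ nat \<bar>n\<bar> * (r - t)" for n
          using lip[of t r n] elim(1) by (simp add: D_def)
        let ?p = "\<lambda>i. D1 h (x t (int i)) (x t (int i + 1))" and ?q = "\<lambda>i. D2 h (x t (int i)) (x t (int i + 1))"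
        have "(\<Sum>i<Suc N. h (x r (int i)) (x r (int i + 1)) - h (x t (int i)) (x t (int i + 1)))
          \<le> (\<Sum>i<Suc N. (?p i * D (int i) r + ?q i * D (int i + 1) r) + \<kappa>' * (\<bar>D (int i) r\<bar> + \<bar>D (int i + 1) r\<bar>))"
          by (rule sum_mono) (rule bspec[OF elim(2)])
        also have "\<dots> = (\<Sum>i<Suc N. ?p i * D (int i) r + ?q i * D (int i + 1) r)
            + \<kappa>' * (\<Sum>i<Suc N. \<bar>D (int i) r\<bar> + \<bar>D (int i + 1) r\<bar>)"
          unfolding sum_distrib_left by (rule sum.distrib)
        also have "(\<Sum>i<Suc N. ?p i * D (int i) r + ?q i * D (int i + 1) r) =
            (\<Sum>i<Suc N. ?p i * D (int i) r) + (\<Sum>i<Suc N. ?q i * D (int i + 1) r)"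
          by (rule sum.distrib)
        also have "(\<Sum>i<Suc N. ?p i * D (int i) r) = ?p 0 * D 0 r + (\<Sum>i<N. ?p (Suc i) * D (int (Suc i)) r)"
          unfolding sum.lessThan_Suc_shift by simp
        also have "(\<Sum>i<Suc N. ?q i * D (int i + 1) r) = (\<Sum>i<N. ?q i * D (int i + 1) r) + ?q N * D (int N + 1) r"
          by simp
        also have "\<kappa>' * (\<Sum>i<Suc N. \<bar>D (int i) r\<bar> + \<bar>D (int i + 1) r\<bar>) \<le> \<kappa>' * (L * (r - t))"
        proof (rule mult_left_mono)
          show "(\<Sum>i<Suc N. \<bar>D (int i) r\<bar> + \<bar>D (int i + 1) r\<bar>) \<le> L * (r - t)"
            unfolding L_def sum_distrib_right
          proof (rule sum_mono)
            fix i
            show "\<bar>D (int i) r\<bar> + \<bar>D (int i + 1) r\<bar> \<le> (3 * 2 ^ nat \<bar>int i\<bar> + 3 * 2 ^ nat \<bar>int i + 1\<bar>) * (r - t)"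
              using D0[of "int i"] D0[of "int i + 1"] DL[of "int i"] DL[of "int i + 1"] by (simp only: distrib_right abs_of_nonneg)
          qed
        qed (use \<kappa>' in simp)
        also have "\<kappa>' * (L * (r - t)) \<le> \<kappa> * (r - t)"
          using mult_right_mono[OF \<kappa>'L, of "r - t"] elim(1) by (simp add: mult.assoc)
        finally have W: "(\<Sum>i<Suc N. h (x r (int i)) (x r (int i + 1)) - h (x t (int i)) (x t (int i + 1)))
          \<le> ?p 0 * D 0 r + ?q N * D (int N + 1) r + ((\<Sum>i<N. ?p (Suc i) * D (int (Suc i)) r) + (\<Sum>i<N. ?q i * D (int i + 1) r)) + \<kappa> * (r - t)"
          by simp
        have frc: "(\<Sum>i<N. ?p (Suc i) * D (int (Suc i)) r) + (\<Sum>i<N. ?q i * D (int i + 1) r) = (\<Sum>i<N. force h (x t) (int i + 1) * D (int i + 1) r)"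
          unfolding sum.distrib[symmetric] by (rule sum.cong) (simp_all add: force_def algebra_simps)
        have cl: "\<epsilon> * (\<Sum>i<N. clamp (int i + 1) r - clamp (int i + 1) t) + (\<Sum>i<N. force h (x t) (int i + 1) * D (int i + 1) r) \<le> 0"
          unfolding sum_distrib_left sum.distrib[symmetric] by (rule sum_nonpos) (rule bspec[OF elim(3)])
        have "?p 0 * D 0 r \<le> B * D 0 r" "?q N * D (int N + 1) r \<le> B * D (int N + 1) r"
          using D1B[of t 0] D2B[of t "int N"] D0 by (intro mult_right_mono; simp add: abs_le_iff)+
        then show ?case using W cl unfolding frc
          by (simp add: \<Phi>_def sum_subtractf D_def algebra_simps)
      qed
    qed simp
    \<comment> \<open>Two turns raise every position by 2: the action is unchanged, the two end
      terms contribute \<open>4 * B\<close> whatever \<open>N\<close> is, and each clamp contributes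
      \<open>A\<close>.\<close>
    moreover have "\<Phi> 2 = \<Phi> 0 - 4 * B + \<epsilon> * A * real N"
    proof -
      have u: "x 2 n = x 0 n + 2" for n using unit_int[of 0 2 n] by simp
      have per: "h (x 2 i) (x 2 (i + 1)) = h (x 0 i) (x 0 (i + 1))" for i
        using periodic_int[of "x 0 i" 2 "x 0 (i + 1)"] unfolding u by simp
      have ends: "x (b n) n \<le> x 2 n" "x 0 n \<le> x (a n) n" for n using ab by (auto intro!: le_funD[OF mono])
      have "clamp n 2 = x (b n) n" "clamp n 0 = x (a n) n" for n
        using ab_le[of n] ends[of n] by (simp_all add: clamp_def)
      then have cl: "clamp n 2 = clamp n 0 + A" for n using ab(4)[of n] by simp
      show ?thesis
        unfolding \<Phi>_def per cl sum.distrib by (simp add: u algebra_simps)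
    qed
    ultimately show ?thesis by simp
  qed
  obtain N :: nat where "4 * \<bar>B\<bar> < real N * (\<epsilon> * A)"
    using reals_Archimedean3[of "\<epsilon> * A"] assms(3) A by auto
  with main[of N] show False by (simp add: mult_ac)
qed

text \<open>Pass to the last parameter \<open>s\<close> with the same value at site 0: the
  neighbours rise at most, so the force there is still negative, and it remains so slightly beyond
  \<open>s\<close>. By \<open>flux\<close> the value at site 0 stays constant there, contradicting
  the choice of \<open>s\<close>.\<close>

lemma force_zero: "force h (x r) 0 = 0"
proof (rule ccontr)
  assume "force h (x r) 0 \<noteq> 0"
  then have neg: "force h (x r) 0 < 0" using sub[of r 0] by simp
  define D where "D = {s. x s 0 = x r 0}"
  have ne: "D \<noteq> {}" by (auto simp: D_def)
  have bdd: "bdd_above D"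
  proof (rule bdd_aboveI[of _ "r + 1"])
    fix s assume s: "s \<in> D"
    show "s \<le> r + 1"
    proof (rule ccontr)
      assume "\<not> s \<le> r + 1"
      then have "x (r + 1) 0 \<le> x s 0" by (intro le_funD[OF mono]) simp
      then show False using s unit[of r 0] by (simp add: D_def)
    qed
  qed
  have closed: "closed D"
    unfolding D_def by (intro closed_Collect_eq continuous continuous_on_const)
  define s where "s = Sup D"
  have s: "x s 0 = x r 0" using closed_contains_Sup[OF ne bdd closed] by (simp add: s_def D_def)
  have "r \<le> s" unfolding s_def by (rule cSup_upper[OF _ bdd]) (simp add: D_def)
  then have "force h (x s) 0 \<le> force h (x r) 0"
    by (intro force_antimono s[symmetric] le_funD[OF mono])
  then have negs: "force h (x s) 0 < force h (x s) 0 / 2" using neg by simp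
  have lim: "((\<lambda>u. force h (x u) 0) \<longlongrightarrow> force h (x s) 0) (at_right s)"
    by (rule force_tendsto) (rule continuous_tendsto)
  from order_tendstoD(2)[OF lim negs] obtain b where
    b: "b > s" "\<And>u. s < u \<Longrightarrow> u < b \<Longrightarrow> force h (x u) 0 < force h (x s) 0 / 2"
    unfolding eventually_at_right_field by blast
  define t where "t = min ((s + b) / 2) (s + 1)"
  have t: "s < t" "t \<le> s + 1" "t < b" using b(1) by (auto simp: t_def min_def field_simps)
  have "x t 0 = x s 0"
  proof (rule flux[OF t(1,2), of "- (force h (x s) 0 / 2)"])
    show "force h (x u) 0 \<le> - (- (force h (x s) 0 / 2))" if "u \<in> {s..t}" for u
      using b(2)[of u] negs that t(3) by (cases "u = s") auto
  qed (use negs in simp)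
  then have "t \<in> D" using s by (simp add: D_def)
  from cSup_upper[OF this bdd] t(1) show False by (simp add: s_def)
qed

lemma equilibrium_x: "equilibrium h 0 (x r)"
  unfolding equilibrium_iff
proof
  fix n
  obtain u where "translate (- n) 0 (x r) = x u" using invariant by blast
  then have "force h (x r) n = force h (x u) 0" by (metis add.left_neutral diff_minus_eq_add force_translate)
  then show "force h (x r) n = 0" using force_zero by simp
qed

end

text \<open>The lift of an invariant circle that is a graph over the base, parametrised by the
  position at site 0.\<close>

definition equilibrium_circle :: "(real \<Rightarrow> real \<Rightarrow> real) \<Rightarrow> real \<Rightarrow> (real \<Rightarrow> configuration) \<Rightarrow> bool" where
  "equilibrium_circle h \<omega> X \<longleftrightarrow> (\<forall>s. X s 0 = s) \<and> (\<forall>n. continuous_on UNIV (\<lambda>s. X s n)) \<and>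
    (\<forall>s t n. s < t \<longrightarrow> X s n < X t n) \<and> (\<forall>s. equilibrium h 0 (X s) \<and> birkhoff (X s) \<and> width \<omega> (X s)) \<and>
    (\<forall>a b s. \<exists>t. translate a b (X s) = X t)"

context twist
begin

text \<open>Distinct ordered equilibria never touch, so the value at site 0 identifies the member of
  the family. Continuity in this new parameter follows because a monotone function with full range
  is continuous.\<close>

lemma equilibrium_circle_exists:
  assumes "q > 0" "(depinning_force h \<longlongrightarrow> 0) (at_right (of_int p / of_int q))"
  obtains X where "equilibrium_circle h (of_int p / of_int q) X" "\<And>s. translate q p (X s) \<le> X s"
proof -
  obtain x where x: "ordered_family h c (of_int p / of_int q) x" and adv: "\<And>r. translate q p (x r) \<le> x r"
    by (rule ordered_family_exists[OF assms]) blast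
  interpret ordered_family h c "of_int p / of_int q" x by (rule x)
  have "\<exists>r. x r 0 = s" for s by (rule reaches)
  then obtain r where r: "\<And>s. x (r s) 0 = s" by metis
  define X where "X = (\<lambda>s. x (r s))"
  have strict: "X s n < X t n" if "s < t" for s t n
  proof -
    have "r s \<le> r t"
    proof (rule ccontr)
      assume "\<not> ?thesis"
      then have "x (r t) 0 \<le> x (r s) 0" by (intro le_funD[OF mono]) simp
      then show False using that by (simp add: r)
    qed
    moreover have "x (r s) \<noteq> x (r t)" using that r by (metis less_irrefl)
    ultimately show ?thesis
      unfolding X_def by (intro equilibria_strict[OF mono _ equilibrium_x equilibrium_x])
  qed
  have member: "x u = X (x u 0)" for u
  proof -
    have touch: "x (r (x u 0)) 0 = x u 0" by (rule r)
    show ?thesis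
    proof (cases "u \<le> r (x u 0)")
      case True
      show ?thesis unfolding X_def
        by (rule touching_equal[OF mono[OF True] touch[symmetric]])
          (use equilibrium_x in \<open>simp add: equilibrium_iff\<close>)
    next
      case False
      then have "r (x u 0) \<le> u" by simp
      from touching_equal[OF mono[OF this] touch] show ?thesis
        unfolding X_def using equilibrium_x by (simp add: equilibrium_iff)
    qed
  qed
  have "continuous_on UNIV (\<lambda>s. X s n)" for n
  proof (rule continuous_onI_mono)
    have "\<exists>s. v = X s n" for v
    proof -
      obtain u where "x u n = v" using reaches by blast
      then show ?thesis using member[of u] by metis
    qed
    then have "range (\<lambda>s. X s n) = UNIV" by auto
    then show "open (range (\<lambda>s. X s n))" by simp
    show "X s n \<le> X t n" if "s \<le> t" for s t
      using strict[of s t n] that by (cases "s = t") auto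
  qed
  moreover have "\<exists>t. translate a b (X s) = X t" for a b s
    using invariant[of a b "r s"] member unfolding X_def by metis
  moreover have "X s 0 = s" for s by (simp add: X_def r)
  ultimately have "equilibrium_circle h (of_int p / of_int q) X"
    unfolding equilibrium_circle_def using strict equilibrium_x birk wid by (simp add: X_def)
  then show ?thesis by (rule that) (simp add: X_def adv)
qed

end

section \<open>Projection to the cylinder\<close>

lemma integer_valued_constant:
  fixes f :: "real \<Rightarrow> real"
  assumes "continuous_on {0..1} f" "\<And>t. t \<in> {0..1} \<Longrightarrow> f t \<in> \<int>"
  shows "f 1 = f 0"
proof -
  have "f constant_on {0..1}"
  proof (rule continuous_discrete_range_constant[OF _ assms(1)])
    fix t :: real assume t: "t \<in> {0..1}"
    have "1 \<le> norm (f s - f t)" if "s \<in> {0..1} \<and> f s \<noteq> f t" for s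
      using that t Ints_nonzero_abs_ge1[of "f s - f t"] assms(2) by (simp add: Ints_diff)
    then show "\<exists>e>0. \<forall>s. s \<in> {0..1} \<and> f s \<noteq> f t \<longrightarrow> e \<le> norm (f s - f t)"
      by (intro exI[of _ 1]) simp
  qed simp
  then show ?thesis by (auto simp: constant_on_def)
qed

text \<open>Two angle functions of the same curve differ by a continuous integer-valued function,
  hence by a constant.\<close>

lemma logarithm_increment:
  fixes g :: "real \<Rightarrow> complex" and \<theta> :: "real \<Rightarrow> real"
  assumes "continuous_on {0..1} g" "continuous_on {0..1} \<theta>"
    "\<And>t. t \<in> {0..1} \<Longrightarrow> exp (g t) = cis (2 * pi * \<theta> t)"
  shows "Im (g 1) - Im (g 0) = 2 * pi * (\<theta> 1 - \<theta> 0)"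
proof -
  define f where "f = (\<lambda>t. Im (g t) / (2 * pi) - \<theta> t)"
  have "f 1 = f 0"
  proof (rule integer_valued_constant)
    show "continuous_on {0..1} f" unfolding f_def by (intro continuous_intros assms) simp
    show "f t \<in> \<int>" if t: "t \<in> {0..1}" for t
    proof -
      have "norm (exp (g t)) = 1" using assms(3)[OF t] by simp
      then have "Re (g t) = 0" by (simp add: norm_exp_eq_Re)
      then have "cis (2 * pi * (Im (g t) / (2 * pi))) = cis (2 * pi * \<theta> t)"
        using assms(3)[OF t] exp_eq_polar[of "g t"] by simp
      then obtain m :: int where "Im (g t) / (2 * pi) = \<theta> t + of_int m" unfolding cis_2pi_eq_iff by blast
      then show ?thesis by (simp add: f_def)
    qed
  qed
  then show ?thesis by (simp add: f_def field_simps)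
qed

text \<open>With a logarithm on the whole homotopy square, the winding number of each row is an
  integer depending continuously on the row. It is \<open>\<theta> 1 - \<theta> 0\<close> for the
  given loop and 0 for the constant one.\<close>

lemma essential_loop:
  fixes \<theta> u :: "real \<Rightarrow> real"
  assumes "continuous_on {0..1} \<theta>" "\<theta> 1 \<noteq> \<theta> 0"
  shows "\<not> homotopic_loops cylinder (\<lambda>t. cyl_proj (\<theta> t) (u t)) (linepath a a)"
proof
  assume "homotopic_loops cylinder (\<lambda>t. cyl_proj (\<theta> t) (u t)) (linepath a a)"
  then obtain k where k: "continuous_on ({0..1::real} \<times> {0..1::real}) k" "k \<in> {0..1} \<times> {0..1} \<rightarrow> cylinder"
    "\<And>t. t \<in> {0..1} \<Longrightarrow> k (0, t) = cyl_proj (\<theta> t) (u t)" "\<And>t. t \<in> {0..1} \<Longrightarrow> k (1, t) = linepath a a t"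
    "\<And>s. s \<in> {0..1} \<Longrightarrow> pathfinish (k \<circ> Pair s) = pathstart (k \<circ> Pair s)"
    unfolding homotopic_loops by blast
  have norm: "norm (fst (k z)) = 1" if "z \<in> {0..1} \<times> {0..1}" for z
    using k(2) that by (force simp: cylinder_def mem_Times_iff Pi_iff)
  have "continuous_on ({0..1} \<times> {0..1}) (\<lambda>z. fst (k z))" by (intro continuous_intros k)
  moreover have "contractible ({0..1::real} \<times> {0..1::real})"
    by (intro convex_imp_contractible convex_Times) auto
  moreover have "fst (k z) \<noteq> 0" if "z \<in> {0..1} \<times> {0..1}" for z using norm[OF that] by auto
  ultimately obtain g where g: "continuous_on ({0..1} \<times> {0..1}) g" "\<And>z. z \<in> {0..1} \<times> {0..1} \<Longrightarrow> fst (k z) = exp (g z)"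
    using continuous_logarithm_on_contractible[of "{0..1} \<times> {0..1}" "\<lambda>z. fst (k z)"] by blast
  have row: "continuous_on {0..1} (\<lambda>t. g (s, t))" if "s \<in> {0..1}" for s
    using that by (intro continuous_on_compose2[OF g(1)] continuous_intros) auto
  have col: "continuous_on {0..1} (\<lambda>s. g (s, t))" if "t \<in> {0..1}" for t
    using that by (intro continuous_on_compose2[OF g(1)] continuous_intros) auto
  have line: "linepath a a t = a" for t
    by (simp add: linepath_def algebra_simps flip: scaleR_add_left)
  have bottom: "Im (g (0, 1)) - Im (g (0, 0)) = 2 * pi * (\<theta> 1 - \<theta> 0)"
  proof (rule logarithm_increment[OF row assms(1)])
    show "exp (g (0, t)) = cis (2 * pi * \<theta> t)" if "t \<in> {0..1}" for t
      using g(2)[of "(0, t)"] k(3)[OF that] that by (simp add: cyl_proj_def)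
  qed simp
  have top: "Im (g (1, 1)) - Im (g (1, 0)) = 2 * pi * (Im (g (1, 0)) / (2 * pi) - Im (g (1, 0)) / (2 * pi))"
  proof (rule logarithm_increment[OF row])
    fix t :: real assume t: "t \<in> {0..1}"
    have "fst (k (1, 0)) = fst a" "fst (k (1, t)) = fst a" using k(4)[of 0] k(4)[OF t] by (simp_all add: line)
    then have eq: "exp (g (1, t)) = exp (g (1, 0))" using g(2)[of "(1, t)"] g(2)[of "(1, 0)"] t by simp
    have "norm (exp (g (1, 0))) = 1" using norm[of "(1, 0)"] g(2)[of "(1, 0)"] by simp
    then have "Re (g (1, 0)) = 0" by (simp add: norm_exp_eq_Re)
    then show "exp (g (1, t)) = cis (2 * pi * (Im (g (1, 0)) / (2 * pi)))"
      unfolding eq using exp_eq_polar[of "g (1, 0)"] by simp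
  qed auto
  define f where "f = (\<lambda>s. (Im (g (s, 1)) - Im (g (s, 0))) / (2 * pi))"
  have "f 1 = f 0"
  proof (rule integer_valued_constant)
    show "continuous_on {0..1} f" unfolding f_def by (intro continuous_intros col) auto
    show "f s \<in> \<int>" if s: "s \<in> {0..1}" for s
    proof -
      have "k (s, 1) = k (s, 0)" using k(5)[OF s] by (simp add: pathfinish_def pathstart_def)
      then have "exp (g (s, 1)) = exp (g (s, 0))" using g(2)[of "(s, 1)"] g(2)[of "(s, 0)"] s by simp
      then obtain n :: int where "g (s, 1) = g (s, 0) + (of_int (2 * n) * pi) * \<i>" unfolding exp_eq by blast
      then have "Im (g (s, 1)) - Im (g (s, 0)) = 2 * pi * of_int n" by simp
      then show ?thesis by (simp add: f_def)
    qed
  qed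
  then show False using bottom top assms(2) by (simp add: f_def)
qed

lemma progression_tendsto_at_top:
  fixes f :: "int \<Rightarrow> real"
  assumes "q > 0" "\<And>r. (\<lambda>j. f (r + int j * q)) \<longlonglongrightarrow> 0"
  shows "(f \<longlongrightarrow> 0) at_top"
  unfolding tendsto_iff
proof (intro allI impI)
  fix e :: real assume e: "e > 0"
  have "\<forall>\<^sub>F j in sequentially. \<forall>r\<in>{0..<q}. dist (f (r + int j * q)) 0 < e"
    by (intro eventually_ball_finite ballI tendstoD[OF assms(2) e]) auto
  then obtain J where J: "\<And>j r. j \<ge> J \<Longrightarrow> r \<in> {0..<q} \<Longrightarrow> dist (f (r + int j * q)) 0 < e"
    unfolding eventually_sequentially by blast
  have "dist (f n) 0 < e" if n: "n \<ge> int J * q" for n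
  proof -
    have "int J \<le> n div q" using zdiv_mono1[OF n assms(1)] assms(1) by simp
    then have "dist (f (n mod q + int (nat (n div q)) * q)) 0 < e"
      using assms(1) by (intro J) auto
    moreover have "int (nat (n div q)) = n div q" using \<open>int J \<le> n div q\<close> by simp
    ultimately show ?thesis by simp
  qed
  then show "\<forall>\<^sub>F n in at_top. dist (f n) 0 < e"
    unfolding eventually_at_top_linorder by blast
qed

lemma translate_iterates_down:
  assumes "translate q p y \<le> y" "width (of_int p / of_int q) y" "q > 0"
  obtains z where "\<And>n. (\<lambda>j. translate (int j * q) (int j * p) y n) \<longlonglongrightarrow> z n" "of_type p q z"
proof -
  \<comment> \<open>Reflecting both sites and values preserves the slope and the advancing
    inequality, and turns the decreasing iteration into the increasing one.\<close>
  define m where "m = (\<lambda>n. - y (- n))"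
  have m1: "translate q p m \<le> m"
    unfolding le_fun_def
  proof
    fix n
    show "translate q p m n \<le> m n"
      using le_funD[OF assms(1), of "- n + q"]
      by (simp add: m_def translate_def)
  qed
  have m2: "width (of_int p / of_int q) m"
    unfolding width_def
  proof (intro allI)
    fix i k :: int
    show "\<bar>m (i + k) - m i - of_int k * (of_int p / of_int q)\<bar> \<le> 1"
      using widthD[OF assms(2), of "- i" "- (i + k)"] by (simp add: m_def)
  qed
  obtain z where z: "\<And>n. (\<lambda>j. translate (- int j * q) (- int j * p) m n) \<longlonglongrightarrow> z n" "of_type p q z"
    by (rule translate_iterates_limit[OF m1 m2 assms(3)]) blast
  show ?thesis
  proof (rule that[of "\<lambda>n. - z (- n)"])
    fix n
    have "(\<lambda>j. - translate (- int j * q) (- int j * p) m (- n)) \<longlonglongrightarrow> - z (- n)"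
      by (intro tendsto_minus z)
    then show "(\<lambda>j. translate (int j * q) (int j * p) y n) \<longlonglongrightarrow> - z (- n)"
      by (simp add: translate_def m_def add.commute)
  next
    show "of_type p q (\<lambda>n. - z (- n))"
      unfolding of_type_iff
    proof
      fix n
      show "- z (- (n + q)) = - z (- n) + of_int p"
        using z(2)[unfolded of_type_iff, rule_format, of "- n - q"] by simp
    qed
  qed
qed

section \<open>From families of equilibria to invariant circles\<close>

context twist
begin

text \<open>The limits of the translates in the two directions are periodic equilibria above and
  below \<open>y\<close>. As they are periodic, convergence of the translates at each fixed site is
  convergence of \<open>y\<close> to them far to the right and far to the left.\<close>

lemma discommensuration_or_periodic:
  assumes y: "equilibrium h 0 y" "birkhoff y" "width (of_int p / of_int q) y" "translate q p y \<le> y" and "q > 0"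
  shows "of_type p q y \<or> y \<in> advancing_discommensurations h p q"
proof (rule disjCI)
  assume not: "y \<notin> advancing_discommensurations h p q"
  show "of_type p q y"
  proof (rule ccontr)
    assume nt: "\<not> of_type p q y"
    obtain xp where xp: "\<And>n. (\<lambda>j. translate (- int j * q) (- int j * p) y n) \<longlonglongrightarrow> xp n" "of_type p q xp"
      by (rule translate_iterates_limit[OF y(4,3) assms(5)]) blast
    obtain xm where xm: "\<And>n. (\<lambda>j. translate (int j * q) (int j * p) y n) \<longlonglongrightarrow> xm n" "of_type p q xm"
      by (rule translate_iterates_down[OF y(4,3) assms(5)]) blast
    have down: "translate (int j * q) (int j * p) y \<le> y" for j
    proof (induction j)
      case (Suc j)
      have "translate q p (translate (int j * q) (int j * p) y) \<le> translate q p y"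
        by (rule translate_mono[OF Suc])
      then show ?case using y(4) by (simp add: algebra_simps)
    qed simp
    have up: "y \<le> translate (- int j * q) (- int j * p) y" for j
      using translate_mono[OF down[of j], of "- int j * q" "- int j * p"] by simp
    have "y n \<le> xp n" for n
      by (rule LIMSEQ_le_const[OF xp(1)]) (use le_funD[OF up] in blast)
    moreover have "xm n \<le> y n" for n
      by (rule LIMSEQ_le_const2[OF xm(1)]) (use le_funD[OF down] in blast)
    moreover have "y \<noteq> xp" "xm \<noteq> y" using nt xp(2) xm(2) by auto
    ultimately have "xm < y" "y < xp" by (auto simp: less_le le_fun_def)
    moreover have "equilibrium h 0 xp" "birkhoff xp"
      by (rule equilibrium_limit[OF sequentially_bot xp(1) _ tendsto_const[of 0]], simp add: equilibrium_translate[OF y(1)])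
        (rule birkhoff_limit[OF sequentially_bot xp(1)], simp add: birkhoff_translate[OF y(2)])
    moreover have "equilibrium h 0 xm" "birkhoff xm"
      by (rule equilibrium_limit[OF sequentially_bot xm(1) _ tendsto_const[of 0]], simp add: equilibrium_translate[OF y(1)])
        (rule birkhoff_limit[OF sequentially_bot xm(1)], simp add: birkhoff_translate[OF y(2)])
    moreover have "((\<lambda>n. \<bar>y n - xp n\<bar>) \<longlongrightarrow> 0) at_top"
    proof (rule progression_tendsto_at_top[OF assms(5)])
      fix r
      have "(\<lambda>j. \<bar>translate (- int j * q) (- int j * p) y r - xp r\<bar>) \<longlonglongrightarrow> \<bar>xp r - xp r\<bar>"
        by (intro tendsto_intros xp(1))
      moreover have "y (r + int j * q) - xp (r + int j * q) = translate (- int j * q) (- int j * p) y r - xp r" for j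
        using of_type_multiple[OF xp(2), of r "int j"] by (simp add: translate_def)
      ultimately show "(\<lambda>j. \<bar>y (r + int j * q) - xp (r + int j * q)\<bar>) \<longlonglongrightarrow> 0" by simp
    qed
    moreover have "((\<lambda>n. \<bar>y n - xm n\<bar>) \<longlongrightarrow> 0) at_bot"
      unfolding at_bot_mirror filterlim_filtermap
    proof (rule progression_tendsto_at_top[OF assms(5)])
      fix r
      have "(\<lambda>j. \<bar>translate (int j * q) (int j * p) y (- r) - xm (- r)\<bar>) \<longlonglongrightarrow> \<bar>xm (- r) - xm (- r)\<bar>"
        by (intro tendsto_intros xm(1))
      moreover have "y (- (r + int j * q)) - xm (- (r + int j * q)) = translate (int j * q) (int j * p) y (- r) - xm (- r)" for j
        using of_type_multiple[OF xm(2), of "- r" "- int j"] by (simp add: translate_def algebra_simps)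
      ultimately show "(\<lambda>j. \<bar>y (- (r + int j * q)) - xm (- (r + int j * q))\<bar>) \<longlonglongrightarrow> 0" by simp
    qed
    ultimately have "y \<in> advancing_discommensurations h p q"
      unfolding advancing_discommensurations_def using xp(2) xm(2) y(1,2) by blast
    with not show False by contradiction
  qed
qed

text \<open>By continuity the limit of translates of a member is again a member. This supplies the
  nonempty periodic part required of a circle that also contains discommensurations.\<close>

lemma equilibrium_circle_periodic:
  assumes X: "equilibrium_circle h (of_int p / of_int q) X" and adv: "\<And>s. translate q p (X s) \<le> X s" and "q > 0"
  shows "\<exists>s. of_type p q (X s)"
proof -
  have X0: "\<And>s. X s 0 = s" and cont: "\<And>n. continuous_on UNIV (\<lambda>s. X s n)" and wid: "\<And>s. width (of_int p / of_int q) (X s)"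
    and inv: "\<And>a b s. \<exists>t. translate a b (X s) = X t"
    using X by (simp_all add: equilibrium_circle_def)
  obtain z where z: "\<And>n. (\<lambda>j. translate (- int j * q) (- int j * p) (X 0) n) \<longlonglongrightarrow> z n" "of_type p q z"
    by (rule translate_iterates_limit[OF adv[of 0] wid assms(3)]) blast
  have eq: "translate (- int j * q) (- int j * p) (X 0) = X (translate (- int j * q) (- int j * p) (X 0) 0)" for j
  proof -
    obtain t where t: "translate (- int j * q) (- int j * p) (X 0) = X t" using inv by blast
    show ?thesis unfolding t X0 ..
  qed
  have "X (z 0) n = z n" for n
  proof -
    have "(\<lambda>j. X (translate (- int j * q) (- int j * p) (X 0) 0) n) \<longlonglongrightarrow> X (z 0) n"
      using continuous_on_tendsto_compose[OF cont[of n] z(1)[of 0]] by simp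
    then show ?thesis unfolding eq[symmetric] by (rule LIMSEQ_unique[OF _ z(1)])
  qed
  then have "X (z 0) = z" by (rule ext)
  then show ?thesis using z(2) by metis
qed

text \<open>The momentum at site 0 is a continuous periodic function of the position, and its graph
  is the circle. Translation by one site preserves the family and realises the twist map on this
  graph.\<close>

lemma invariant_circle_of_equilibria:
  assumes X: "equilibrium_circle h \<omega> X"
  shows "rotational_invariant_circle h (\<Union>y\<in>range X. orbit_of h y)"
proof -
  have X0: "\<And>s. X s 0 = s" and cont: "\<And>n. continuous_on UNIV (\<lambda>s. X s n)"
    and eq: "\<And>s. equilibrium h 0 (X s)" and inv: "\<And>a b s. \<exists>t. translate a b (X s) = X t"
    using X by (simp_all add: equilibrium_circle_def)
  \<comment> \<open>The parameter of a translate is read off at site 0.\<close>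
  have trans: "translate a b (X s) = X (X s (- a) + of_int b)" for a b s
  proof -
    obtain t where t: "translate a b (X s) = X t" using inv by blast
    have "t = translate a b (X s) 0" unfolding t X0 ..
    then show ?thesis using t by (simp add: translate_def)
  qed
  have X1: "X (s + of_int m) n = X s n + of_int m" for s m n
    using trans[of 0 m s] by (simp add: X0 fun_eq_iff translate_def)
  define pt where "pt = (\<lambda>s. cyl_proj s (- D1 h s (X s 1)))"
  have pt_int: "pt (s + of_int m) = pt s" for s m
    unfolding pt_def cyl_proj_eq_iff X1 D1_periodic by simp
  have orbit: "cyl_proj (X s n) (- D1 h (X s n) (X s (n + 1))) = pt (X s n)" for s n
  proof -
    have "translate (- n) 0 (X s) = X (X s n)" using trans[of "- n" 0 s] by simp
    from fun_cong[OF this, of 1] have "X (X s n) 1 = X s (n + 1)" by (simp add: translate_def add.commute)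
    then show ?thesis by (simp add: pt_def)
  qed
  define C where "C = range pt"
  have union: "(\<Union>y\<in>range X. orbit_of h y) = C"
  proof
    show "(\<Union>y\<in>range X. orbit_of h y) \<subseteq> C" by (auto simp: orbit_of_def orbit C_def)
    have "pt s \<in> orbit_of h (X s)" for s
      unfolding orbit_of_def by (rule range_eqI[of _ _ 0]) (use orbit[of s 0] in \<open>simp add: X0\<close>)
    then show "C \<subseteq> (\<Union>y\<in>range X. orbit_of h y)" by (auto simp: C_def)
  qed
  have u: "continuous_on S (\<lambda>s. - D1 h s (X s 1))" for S
    unfolding continuous_on_def
    using cont[of 1] by (auto intro!: tendsto_minus D1_tendsto tendsto_ident_at simp: continuous_on_def intro: tendsto_within_subset)
  have "continuous_on {0..1} (\<lambda>s. (s, - D1 h s (X s 1)))" by (intro continuous_intros u)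
  from continuous_on_compose2[OF cyl_proj_continuous[of UNIV] this]
  have path: "path pt" by (simp add: path_def pt_def)
  have loop: "pathfinish pt = pathstart pt" using pt_int[of 0 1] by (simp add: pathfinish_def pathstart_def)
  have "loop_free pt"
    unfolding loop_free_def
  proof (intro ballI impI)
    fix s t :: real assume st: "s \<in> {0..1}" "t \<in> {0..1}" "pt s = pt t"
    then obtain m :: int where m: "s = t + of_int m" unfolding pt_def cyl_proj_eq_iff by blast
    have "\<bar>real_of_int m\<bar> \<le> 1" using m st by auto
    then have "m = 0 \<or> m = 1 \<or> m = - 1" by linarith
    then show "s = t \<or> s = 0 \<and> t = 1 \<or> s = 1 \<and> t = 0" using m st by auto
  qed
  then have simple: "simple_path pt" using path by (simp add: simple_path_def)
  have image: "path_image pt = C"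
  proof
    show "path_image pt \<subseteq> C" by (auto simp: path_image_def C_def)
    have "pt s \<in> pt ` {0..1}" for s
    proof -
      have "pt s = pt (s - of_int \<lfloor>s\<rfloor>)" using pt_int[of "s - of_int \<lfloor>s\<rfloor>" "\<lfloor>s\<rfloor>"] by simp
      moreover have "s - of_int \<lfloor>s\<rfloor> \<in> {0..1}" using floor_correct[of s] by simp linarith
      ultimately show ?thesis by (rule image_eqI)
    qed
    then show "C \<subseteq> path_image pt" by (auto simp: path_image_def C_def)
  qed
  have cyl: "C \<subseteq> cylinder" by (auto simp: C_def pt_def cyl_proj_in_cylinder)
  have essential: "\<not> (\<exists>a. homotopic_loops cylinder pt (linepath a a))"
    using essential_loop[of "\<lambda>s. s" "\<lambda>s. - D1 h s (X s 1)"] unfolding pt_def by simp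
  \<comment> \<open>For the uniqueness demanded by the definite description: another lift of the
    point differs by an integer, and \<open>D1_inj\<close> then fixes the next position up to the
    same integer.\<close>
  have step: "twist_map h (pt s) = pt (X s 1)" for s
    unfolding twist_map_def
  proof (rule the_equality)
    have "D2 h (X s 0) (X s 1) = - D1 h (X s 1) (X s (1 + 1))"
      using equilibrium_next[OF eq[of s], of 0] by simp
    then have img: "pt (X s 1) = cyl_proj (X s 1) (D2 h s (X s 1))" unfolding orbit[of s 1, symmetric] X0 by simp
    then show "\<exists>x p x' p'. pt s = cyl_proj x p \<and> pt (X s 1) = cyl_proj x' p' \<and> p = - D1 h x x' \<and> p' = D2 h x x'"
      unfolding pt_def by blast
    fix z' assume "\<exists>x p x' p'. pt s = cyl_proj x p \<and> z' = cyl_proj x' p' \<and> p = - D1 h x x' \<and> p' = D2 h x x'"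
    then obtain x x' where x: "pt s = cyl_proj x (- D1 h x x')" "z' = cyl_proj x' (D2 h x x')" by blast
    then obtain m :: int where m: "s = x + of_int m" "- D1 h s (X s 1) = - D1 h x x'"
      unfolding pt_def cyl_proj_eq_iff by blast
    have "D1 h s (x' + of_int m) = D1 h s (X s 1)" using m D1_periodic[of x m x'] by simp
    from D1_inj[OF this] have x': "X s 1 = x' + of_int m" by simp
    have "D2 h s (x' + of_int m) = D2 h x x'" unfolding m(1) by (rule D2_periodic)
    then show "z' = pt (X s 1)"
      unfolding img unfolding x(2) x' cyl_proj_eq_iff by (intro conjI exI[of _ "- m"]) simp_all
  qed
  have "twist_map h ` C = C"
  proof
    show "twist_map h ` C \<subseteq> C" by (auto simp: C_def step)
    have "pt s \<in> twist_map h ` C" for s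
    proof -
      have "translate (- 1) 0 (translate 1 0 (X s)) = X s" by simp
      then have "translate (- 1) 0 (X (X s (- 1))) = X s" unfolding trans[of 1 0 s] by simp
      then have "X (X (X s (- 1)) 1) = X s" unfolding trans by simp
      then have "X (X s (- 1)) 1 = s" using X0[of s] X0[of "X (X s (- 1)) 1"] by simp
      then have "pt s = twist_map h (pt (X s (- 1)))" by (simp add: step)
      then show ?thesis by (auto simp: C_def)
    qed
    then show "C \<subseteq> twist_map h ` C" by (auto simp: C_def)
  qed
  then show ?thesis
    unfolding rotational_invariant_circle_def union using simple loop image cyl essential by blast
qed

lemma circle_of_family:
  assumes "equilibrium_circle h \<omega> X" "\<And>s. of_type p q (X s) \<or> X s \<in> E" "\<exists>s. of_type p q (X s)"
  shows "\<exists>C. rotational_invariant_circle h C \<and>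
    ((\<exists>P \<subseteq> periodic_equilibria h p q. C = (\<Union>x\<in>P. orbit_of h x)) \<or>
     (\<exists>P \<subseteq> periodic_equilibria h p q. \<exists>Y \<subseteq> E. P \<noteq> {} \<and> Y \<noteq> {} \<and> C = (\<Union>x\<in>P \<union> Y. orbit_of h x)))"
proof -
  define P where "P = {y \<in> range X. of_type p q y}"
  define Y where "Y = range X - P"
  have PY: "P \<union> Y = range X" by (auto simp: P_def Y_def)
  have P: "P \<subseteq> periodic_equilibria h p q"
    using assms(1) by (auto simp: P_def periodic_equilibria_def equilibrium_circle_def)
  have Y: "Y \<subseteq> E" using assms(2) by (auto simp: Y_def P_def)
  have ne: "P \<noteq> {}" using assms(3) by (auto simp: P_def)
  have rot: "rotational_invariant_circle h (\<Union>x\<in>P \<union> Y. orbit_of h x)"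
    unfolding PY by (rule invariant_circle_of_equilibria[OF assms(1)])
  show ?thesis
  proof (rule exI[of _ "\<Union>x\<in>P \<union> Y. orbit_of h x"], rule conjI[OF rot], cases "Y = {}")
    case True
    then show "(\<exists>P'\<subseteq>periodic_equilibria h p q. (\<Union>x\<in>P \<union> Y. orbit_of h x) = (\<Union>x\<in>P'. orbit_of h x)) \<or>
      (\<exists>P'\<subseteq>periodic_equilibria h p q. \<exists>Y'\<subseteq>E. P' \<noteq> {} \<and> Y' \<noteq> {} \<and> (\<Union>x\<in>P \<union> Y. orbit_of h x) = (\<Union>x\<in>P' \<union> Y'. orbit_of h x))"
      by (intro disjI1 exI[of _ P]) (simp add: P)
  next
    case False
    then show "(\<exists>P'\<subseteq>periodic_equilibria h p q. (\<Union>x\<in>P \<union> Y. orbit_of h x) = (\<Union>x\<in>P'. orbit_of h x)) \<or>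
      (\<exists>P'\<subseteq>periodic_equilibria h p q. \<exists>Y'\<subseteq>E. P' \<noteq> {} \<and> Y' \<noteq> {} \<and> (\<Union>x\<in>P \<union> Y. orbit_of h x) = (\<Union>x\<in>P' \<union> Y'. orbit_of h x))"
      using P Y ne by (intro disjI2 exI[of _ P] conjI exI[of _ Y]) simp_all
  qed
qed

end

section \<open>Reversing the chain\<close>

text \<open>If \<open>y\<close> lay below its \<open>(q, p)\<close> translate, iteration would bound
  \<open>y - xm\<close> at each site by its values far to the left, which tend to 0; this
  contradicts \<open>xm < y\<close>. The Birkhoff property leaves only the opposite order.\<close>

lemma advancing_advances:
  assumes "y \<in> advancing_discommensurations h p q" "q > 0"
  shows "advances p q y"
proof -
  obtain xm xp where x: "xm < y" "y < xp" "birkhoff y" "of_type p q xm" "of_type p q xp"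
    "((\<lambda>n. \<bar>y n - xm n\<bar>) \<longlongrightarrow> 0) at_bot"
    using assms(1) unfolding advancing_discommensurations_def by blast
  have le: "xm n \<le> y n" "y n \<le> xp n" for n
    using x(1,2) by (auto simp: less_le intro: le_funD)
  have "translate q p y \<le> y"
  proof (rule ccontr)
    assume "\<not> translate q p y \<le> y"
    then have ge: "y \<le> translate q p y" using iffD1[OF birkhoff_iff x(3)] by blast
    have iter: "y \<le> translate (int j * q) (int j * p) y" for j
    proof (induction j)
      case (Suc j)
      have "translate q p y \<le> translate q p (translate (int j * q) (int j * p) y)"
        by (rule translate_mono[OF Suc])
      from order_trans[OF ge this] show ?case by (simp add: algebra_simps)
    qed simp
    have "y n \<le> xm n" for n
    proof -
      have "filterlim (\<lambda>j. n - int j * q) at_bot sequentially"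
        unfolding filterlim_at_bot
      proof
        fix Z :: int
        show "\<forall>\<^sub>F j in sequentially. n - int j * q \<le> Z"
          using eventually_ge_at_top[of "nat (\<bar>n\<bar> + \<bar>Z\<bar>)"]
        proof eventually_elim
          case (elim j)
          have "int j * 1 \<le> int j * q" using assms(2) by (intro mult_left_mono) auto
          then show ?case using elim by linarith
        qed
      qed
      from filterlim_compose[OF x(6) this]
      have lim: "(\<lambda>j. \<bar>y (n - int j * q) - xm (n - int j * q)\<bar>) \<longlonglongrightarrow> 0" .
      have "y n - xm n \<le> \<bar>y (n - int j * q) - xm (n - int j * q)\<bar>" for j
        using le_funD[OF iter[of j], of n] of_type_multiple[OF x(4), of n "- int j"] by (simp add: translate_def)
      then have "y n - xm n \<le> 0" by (intro LIMSEQ_le_const[OF lim]) blast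
      then show ?thesis by simp
    qed
    then have "y \<le> xm" by (simp add: le_fun_def)
    with x(1) show False by simp
  qed
  then have "y n + of_int p \<le> y (n + q)" for n
    using le_funD[of "translate q p y" y "n + q"] by (simp add: translate_def)
  moreover have "width (of_int p / of_int q) y"
  proof -
    let ?B = "\<lambda>z. (\<Sum>r\<in>{0..<q}. \<bar>z r\<bar>) + \<bar>of_int p :: real\<bar>"
    have "\<bar>y n - of_int n * (of_int p / of_int q)\<bar> \<le> max (?B xm) (?B xp)" for n
      using of_type_distance[OF x(4) assms(2), of n] of_type_distance[OF x(5) assms(2), of n] le[of n] by linarith
    then show ?thesis by (rule birkhoff_bounded_width[OF x(3)])
  qed
  ultimately show ?thesis by (simp add: advances_def)
qed

lemma of_type_advances: "of_type p q y \<Longrightarrow> advances p q y"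
  by (simp add: advances_def of_type_iff)

text \<open>Reversing the chain exchanges the two arguments of \<open>h\<close>, negates mean spacings, and exchanges
  advancing with retreating discommensurations.\<close>

definition reflect :: "configuration \<Rightarrow> configuration" where
  "reflect x = (\<lambda>n. x (- n))"

abbreviation (input) swap :: "(real \<Rightarrow> real \<Rightarrow> real) \<Rightarrow> real \<Rightarrow> real \<Rightarrow> real" where
  "swap h \<equiv> (\<lambda>x y. h y x)"

lemma reflect_reflect [simp]: "reflect (reflect x) = x"
  by (simp add: reflect_def)

lemma reflect_le_iff [simp]: "reflect x \<le> reflect y \<longleftrightarrow> x \<le> y"
proof
  assume le: "reflect x \<le> reflect y"
  show "x \<le> y"
    unfolding le_fun_def
  proof
    fix n
    show "x n \<le> y n" using le_funD[OF le, of "- n"] by (simp add: reflect_def)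
  qed
qed (simp add: le_fun_def reflect_def)

lemma reflect_less_iff [simp]: "reflect x < reflect y \<longleftrightarrow> x < y"
  unfolding less_le_not_le reflect_le_iff ..

lemma reflect_translate: "reflect (translate a b x) = translate (- a) b (reflect x)"
  by (rule ext) (simp add: reflect_def translate_def)

lemma birkhoff_reflect:
  assumes "birkhoff x"
  shows "birkhoff (reflect x)"
  unfolding birkhoff_iff
proof (intro allI)
  fix a b
  have "reflect (translate (- a) b x) = translate a b (reflect x)" by (simp add: reflect_translate)
  moreover have "translate (- a) b x \<le> x \<or> x \<le> translate (- a) b x"
    using iffD1[OF birkhoff_iff assms] by blast
  ultimately show "translate a b (reflect x) \<le> reflect x \<or> reflect x \<le> translate a b (reflect x)"
    by (metis reflect_le_iff)
qed

lemma width_reflect: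
  assumes "width \<omega> x"
  shows "width (- \<omega>) (reflect x)"
  unfolding width_def
proof (intro allI)
  fix i m :: int
  have "real_of_int (- (i + m) - - i) * \<omega> = of_int m * - \<omega>" by simp
  with widthD[OF assms, of "- (i + m)" "- i"]
  show "\<bar>reflect x (i + m) - reflect x i - of_int m * - \<omega>\<bar> \<le> 1"
    by (simp only: reflect_def)
qed

lemma of_type_reflect:
  assumes "of_type p q x"
  shows "of_type (- p) q (reflect x)"
  unfolding of_type_iff
proof
  fix n
  show "reflect x (n + q) = reflect x n + of_int (- p)"
    using assms[unfolded of_type_iff, rule_format, of "- n - q"] by (simp add: reflect_def)
qed

lemma force_reflect: "force (swap h) (reflect x) n = force h x (- n)"
  unfolding force_def D1_swap[of h] D2_swap[of h] by (simp add: reflect_def)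

lemma equilibrium_reflect:
  assumes "equilibrium h F x"
  shows "equilibrium (swap h) F (reflect x)"
  using assms by (simp add: equilibrium_iff force_reflect)

lemma retreating_reflect:
  assumes "y \<in> retreating_discommensurations h p q"
  shows "reflect y \<in> advancing_discommensurations (swap h) (- p) q"
proof -
  obtain xm xp where x: "xm < y" "y < xp" "\<forall>z\<in>{xm, y, xp}. equilibrium h 0 z \<and> birkhoff z"
    "of_type p q xm" "of_type p q xp" "((\<lambda>n. \<bar>y n - xp n\<bar>) \<longlongrightarrow> 0) at_bot" "((\<lambda>n. \<bar>y n - xm n\<bar>) \<longlongrightarrow> 0) at_top"
    using assms unfolding retreating_discommensurations_def by blast
  have "((\<lambda>n. \<bar>reflect y n - reflect xm n\<bar>) \<longlongrightarrow> 0) at_bot"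
    using x(7) unfolding at_bot_mirror filterlim_filtermap by (simp add: reflect_def)
  moreover have "((\<lambda>n. \<bar>reflect y n - reflect xp n\<bar>) \<longlongrightarrow> 0) at_top"
    using x(6) unfolding at_bot_mirror filterlim_filtermap by (simp add: reflect_def)
  ultimately show ?thesis
    unfolding advancing_discommensurations_def using x(1-5)
    by (intro CollectI exI[of _ "reflect xm"] exI[of _ "reflect xp"])
      (simp add: equilibrium_reflect birkhoff_reflect of_type_reflect)
qed

lemma advancing_reflect:
  assumes "y \<in> advancing_discommensurations h p q"
  shows "reflect y \<in> retreating_discommensurations (swap h) (- p) q"
proof -
  obtain xm xp where x: "xm < y" "y < xp" "\<forall>z\<in>{xm, y, xp}. equilibrium h 0 z \<and> birkhoff z"
    "of_type p q xm" "of_type p q xp" "((\<lambda>n. \<bar>y n - xm n\<bar>) \<longlongrightarrow> 0) at_bot" "((\<lambda>n. \<bar>y n - xp n\<bar>) \<longlongrightarrow> 0) at_top"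
    using assms unfolding advancing_discommensurations_def by blast
  have "((\<lambda>n. \<bar>reflect y n - reflect xp n\<bar>) \<longlongrightarrow> 0) at_bot"
    using x(7) unfolding at_bot_mirror filterlim_filtermap by (simp add: reflect_def)
  moreover have "((\<lambda>n. \<bar>reflect y n - reflect xm n\<bar>) \<longlongrightarrow> 0) at_top"
    using x(6) unfolding at_bot_mirror filterlim_filtermap by (simp add: reflect_def)
  ultimately show ?thesis
    unfolding retreating_discommensurations_def using x(1-5)
    by (intro CollectI exI[of _ "reflect xm"] exI[of _ "reflect xp"])
      (simp add: equilibrium_reflect birkhoff_reflect of_type_reflect)
qed

lemma equilibrium_circle_reflect:
  assumes "equilibrium_circle h \<omega> X"
  shows "equilibrium_circle (swap h) (- \<omega>) (\<lambda>s. reflect (X s))"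
proof -
  have X: "\<And>s. X s 0 = s" "\<And>n. continuous_on UNIV (\<lambda>s. X s n)" "\<And>s t n. s < t \<Longrightarrow> X s n < X t n"
    "\<And>s. equilibrium h 0 (X s)" "\<And>s. birkhoff (X s)" "\<And>s. width \<omega> (X s)" "\<And>a b s. \<exists>t. translate a b (X s) = X t"
    using assms by (simp_all add: equilibrium_circle_def)
  have "\<exists>t. translate a b (reflect (X s)) = reflect (X t)" for a b s
  proof -
    obtain t where "translate (- a) b (X s) = X t" using X(7) by blast
    then have "reflect (translate (- a) b (X s)) = reflect (X t)" by simp
    then show ?thesis by (auto simp: reflect_translate)
  qed
  then show ?thesis
    unfolding equilibrium_circle_def
    using X(1-3) equilibrium_reflect[OF X(4)] birkhoff_reflect[OF X(5)] width_reflect[OF X(6)]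
    by (simp add: reflect_def)
qed

context twist
begin

lemma admits_swap:
  assumes "admits_birkhoff_equilibrium h F \<omega>"
  shows "admits_birkhoff_equilibrium (swap h) F (- \<omega>)"
proof -
  interpret s: twist "swap h" c by (rule twist_swap) (rule twist_axioms)
  obtain x where x: "equilibrium h F x" "birkhoff x" "width \<omega> x"
    "\<And>p q. q > 0 \<and> coprime p q \<and> \<omega> = of_int p / of_int q \<Longrightarrow> of_type p q x"
    using assms unfolding admits_iff by blast
  have "of_type p q (reflect x)" if "q > 0 \<and> coprime p q \<and> - \<omega> = of_int p / of_int q" for p q
  proof -
    have "\<omega> = of_int (- p) / of_int q" using that by simp
    then have "of_type (- p) q x" using that by (intro x(4)) simp
    from of_type_reflect[OF this] show ?thesis by simp
  qed
  then show ?thesis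
    unfolding s.admits_iff using equilibrium_reflect[OF x(1)] birkhoff_reflect[OF x(2)] width_reflect[OF x(3)] by blast
qed

lemma depinning_force_swap: "depinning_force (swap h) \<omega> = depinning_force h (- \<omega>)"
proof -
  interpret s: twist "swap h" c by (rule twist_swap) (rule twist_axioms)
  have "admits_birkhoff_equilibrium (swap h) F \<omega> \<longleftrightarrow> admits_birkhoff_equilibrium h F (- \<omega>)" for F
    using s.admits_swap[of F \<omega>] admits_swap[of F "- \<omega>"] by auto
  then show ?thesis by (simp add: depinning_force_def)
qed

lemma depinning_limit_swap:
  "(depinning_force (swap h) \<longlongrightarrow> 0) (at_right (of_int (- p) / of_int q)) \<longleftrightarrow>
    (depinning_force h \<longlongrightarrow> 0) (at_left (of_int p / of_int q))"
proof -
  have "depinning_force (swap h) = (\<lambda>\<omega>. depinning_force h (- \<omega>))"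
    by (rule ext) (rule depinning_force_swap)
  then show ?thesis
    by (simp add: filterlim_at_left_to_right[of "depinning_force h" "nhds 0" "of_int p / of_int q"])
qed

section \<open>Invariant circles and one-sided limits of the depinning force, for both
  orientations\<close>

lemma advancing_circle_depinning:
  assumes "q > 0" "rotational_invariant_circle h C" "C = (\<Union>x\<in>S. orbit_of h x)"
    "S \<subseteq> periodic_equilibria h p q \<union> advancing_discommensurations h p q"
  shows "(depinning_force h \<longlongrightarrow> 0) (at_right (of_int p / of_int q))"
proof -
  have eq: "equilibrium h 0 y" if "y \<in> S" for y
    using assms(4) that by (auto simp: periodic_equilibria_def advancing_discommensurations_def)
  have adv: "advances p q y" if "y \<in> S" for y
    using assms(4) that advancing_advances[OF _ assms(1)] by (auto simp: periodic_equilibria_def of_type_advances)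
  obtain x :: "real \<Rightarrow> configuration" and d :: int where x: "d > 0" "\<And>n. continuous_on UNIV (\<lambda>t. x t n)"
    "\<And>t n. x (t + 1) n = x t n + of_int d" "\<And>t. equilibrium h 0 (x t)" "\<And>t. advances p q (x t)"
    by (rule circle_family[of C S "advances p q", OF assms(2,3) eq adv advances_translate]) blast+
  show ?thesis by (rule family_depinning[OF assms(1) x])
qed

lemma retreating_circle_depinning:
  assumes "q > 0" "rotational_invariant_circle h C" "C = (\<Union>x\<in>S. orbit_of h x)"
    "S \<subseteq> periodic_equilibria h p q \<union> retreating_discommensurations h p q"
  shows "(depinning_force h \<longlongrightarrow> 0) (at_left (of_int p / of_int q))"
proof -
  interpret s: twist "swap h" c by (rule twist_swap) (rule twist_axioms)
  \<comment> \<open>The reflection is built into the predicate: the circle is lifted for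
    \<open>h\<close> itself, and the resulting family is reflected afterwards.\<close>
  define R where "R = (\<lambda>y. advances (- p) q (reflect y))"
  have eq: "equilibrium h 0 y" if "y \<in> S" for y
    using assms(4) that by (auto simp: periodic_equilibria_def retreating_discommensurations_def)
  have R: "R y" if "y \<in> S" for y
  proof -
    have "of_type p q y \<or> y \<in> retreating_discommensurations h p q"
      using assms(4) that by (auto simp: periodic_equilibria_def)
    then show ?thesis
      unfolding R_def
    proof
      assume "of_type p q y"
      from of_type_advances[OF of_type_reflect[OF this]] show "advances (- p) q (reflect y)" .
    next
      assume "y \<in> retreating_discommensurations h p q"
      from advancing_advances[OF retreating_reflect[OF this] assms(1)] show "advances (- p) q (reflect y)" .
    qed
  qed
  have trans: "R (translate a b y)" if "R y" for y a b
    using advances_translate[OF that[unfolded R_def]] by (simp add: R_def reflect_translate)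
  obtain x :: "real \<Rightarrow> configuration" and d :: int where x: "d > 0" "\<And>n. continuous_on UNIV (\<lambda>t. x t n)"
    "\<And>t n. x (t + 1) n = x t n + of_int d" "\<And>t. equilibrium h 0 (x t)" "\<And>t. R (x t)"
    by (rule circle_family[of C S R, OF assms(2,3) eq R trans]) blast+
  have "(depinning_force (swap h) \<longlongrightarrow> 0) (at_right (of_int (- p) / of_int q))"
  proof (rule s.family_depinning[OF assms(1) x(1)])
    show "continuous_on UNIV (\<lambda>t. reflect (x t) n)" for n unfolding reflect_def by (rule x(2))
    show "reflect (x (t + 1)) n = reflect (x t) n + of_int d" for t n by (simp add: reflect_def x(3))
    show "equilibrium (swap h) 0 (reflect (x t))" for t by (rule equilibrium_reflect[OF x(4)])
    show "advances (- p) q (reflect (x t))" for t using x(5) by (simp add: R_def)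
  qed
  then show ?thesis by (simp only: depinning_limit_swap)
qed

lemma depinning_advancing_circle:
  assumes "q > 0" "(depinning_force h \<longlongrightarrow> 0) (at_right (of_int p / of_int q))"
  obtains X where "equilibrium_circle h (of_int p / of_int q) X"
    "\<And>s. of_type p q (X s) \<or> X s \<in> advancing_discommensurations h p q" "\<exists>s. of_type p q (X s)"
proof -
  obtain X where X: "equilibrium_circle h (of_int p / of_int q) X" "\<And>s. translate q p (X s) \<le> X s"
    by (rule equilibrium_circle_exists[OF assms]) blast
  have "of_type p q (X s) \<or> X s \<in> advancing_discommensurations h p q" for s
    by (rule discommensuration_or_periodic[OF _ _ _ X(2) assms(1)]) (use X(1) in \<open>simp_all add: equilibrium_circle_def\<close>)
  with X(1) show ?thesis using that equilibrium_circle_periodic[OF X assms(1)] by blast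
qed

lemma depinning_retreating_circle:
  assumes "q > 0" "(depinning_force h \<longlongrightarrow> 0) (at_left (of_int p / of_int q))"
  obtains X where "equilibrium_circle h (of_int p / of_int q) X"
    "\<And>s. of_type p q (X s) \<or> X s \<in> retreating_discommensurations h p q" "\<exists>s. of_type p q (X s)"
proof -
  interpret s: twist "swap h" c by (rule twist_swap) (rule twist_axioms)
  have "(depinning_force (swap h) \<longlongrightarrow> 0) (at_right (of_int (- p) / of_int q))"
    using assms(2) by (simp only: depinning_limit_swap)
  then obtain X where X: "equilibrium_circle (swap h) (of_int (- p) / of_int q) X"
    "\<And>s. of_type (- p) q (X s) \<or> X s \<in> advancing_discommensurations (swap h) (- p) q" "\<exists>s. of_type (- p) q (X s)"
    by (rule s.depinning_advancing_circle[OF assms(1)]) blast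
  show ?thesis
  proof (rule that[of "\<lambda>s. reflect (X s)"])
    show "equilibrium_circle h (of_int p / of_int q) (\<lambda>s. reflect (X s))"
      using equilibrium_circle_reflect[OF X(1)] by simp
    show "of_type p q (reflect (X s)) \<or> reflect (X s) \<in> retreating_discommensurations h p q" for s
      using X(2)[of s] of_type_reflect[of "- p" q "X s"] advancing_reflect[of "X s" "swap h" "- p" q] by auto
    obtain s where "of_type (- p) q (X s)" using X(3) by blast
    from of_type_reflect[OF this] show "\<exists>s. of_type p q (reflect (X s))" by auto
  qed
qed

end

theorem theoremC:
  fixes h :: "real \<Rightarrow> real \<Rightarrow> real" and p q :: int
  assumes "C2_plane h"
    and "\<forall>x x'. h (x + 1) (x' + 1) = h x x'"
    and "\<exists>c>0. \<forall>x x'. D2 (D1 h) x x' \<le> - c"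
    and "q > 0" and "coprime p q"
  shows
    "((\<exists>C. rotational_invariant_circle h C \<and>
         ((\<exists>X \<subseteq> periodic_equilibria h p q. C = (\<Union>x\<in>X. orbit_of h x)) \<or>
          (\<exists>X \<subseteq> periodic_equilibria h p q. \<exists>Y \<subseteq> advancing_discommensurations h p q.
             X \<noteq> {} \<and> Y \<noteq> {} \<and> C = (\<Union>x\<in>X \<union> Y. orbit_of h x))))
       \<longleftrightarrow> (depinning_force h \<longlongrightarrow> 0) (at_right (of_int p / of_int q)))
     \<and>
     ((\<exists>C. rotational_invariant_circle h C \<and>
         ((\<exists>X \<subseteq> periodic_equilibria h p q. C = (\<Union>x\<in>X. orbit_of h x)) \<or>
          (\<exists>X \<subseteq> periodic_equilibria h p q. \<exists>Y \<subseteq> retreating_discommensurations h p q.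
             X \<noteq> {} \<and> Y \<noteq> {} \<and> C = (\<Union>x\<in>X \<union> Y. orbit_of h x))))
       \<longleftrightarrow> (depinning_force h \<longlongrightarrow> 0) (at_left (of_int p / of_int q)))"
proof -
  obtain c where "c > 0" "\<forall>x x'. D2 (D1 h) x x' \<le> - c" using assms(3) by blast
  from twist_of_C2[OF assms(1,2) this] interpret twist h c .
  let ?P = "periodic_equilibria h p q"
  have "(\<exists>C. rotational_invariant_circle h C \<and> ((\<exists>X\<subseteq>?P. C = (\<Union>x\<in>X. orbit_of h x)) \<or>
      (\<exists>X\<subseteq>?P. \<exists>Y\<subseteq>advancing_discommensurations h p q.
        X \<noteq> {} \<and> Y \<noteq> {} \<and> C = (\<Union>x\<in>X \<union> Y. orbit_of h x))))
      \<longleftrightarrow> (depinning_force h \<longlongrightarrow> 0) (at_right (of_int p / of_int q))" (is "?L \<longleftrightarrow> ?R")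
  proof
    assume ?L
    then obtain C S where "rotational_invariant_circle h C" "C = (\<Union>x\<in>S. orbit_of h x)"
      "S \<subseteq> ?P \<union> advancing_discommensurations h p q" by (metis Un_mono le_supI1)
    then show ?R by (rule advancing_circle_depinning[OF assms(4)])
  next
    assume ?R
    then obtain X where X: "equilibrium_circle h (of_int p / of_int q) X"
      "\<And>s. of_type p q (X s) \<or> X s \<in> advancing_discommensurations h p q" "\<exists>s. of_type p q (X s)"
      by (rule depinning_advancing_circle[OF assms(4)]) blast
    show ?L by (rule circle_of_family[OF X])
  qed
  moreover have "(\<exists>C. rotational_invariant_circle h C \<and> ((\<exists>X\<subseteq>?P. C = (\<Union>x\<in>X. orbit_of h x)) \<or>
      (\<exists>X\<subseteq>?P. \<exists>Y\<subseteq>retreating_discommensurations h p q.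
        X \<noteq> {} \<and> Y \<noteq> {} \<and> C = (\<Union>x\<in>X \<union> Y. orbit_of h x))))
      \<longleftrightarrow> (depinning_force h \<longlongrightarrow> 0) (at_left (of_int p / of_int q))" (is "?L \<longleftrightarrow> ?R")
  proof
    assume ?L
    then obtain C S where "rotational_invariant_circle h C" "C = (\<Union>x\<in>S. orbit_of h x)"
      "S \<subseteq> ?P \<union> retreating_discommensurations h p q" by (metis Un_mono le_supI1)
    then show ?R by (rule retreating_circle_depinning[OF assms(4)])
  next
    assume ?R
    then obtain X where X: "equilibrium_circle h (of_int p / of_int q) X"
      "\<And>s. of_type p q (X s) \<or> X s \<in> retreating_discommensurations h p q" "\<exists>s. of_type p q (X s)"
      by (rule depinning_retreating_circle[OF assms(4)]) blast
    show ?L by (rule circle_of_family[OF X])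
  qed
  ultimately show ?thesis by blast
qed

end
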